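(* Let $k$ be a field with $\operatorname{char}(k)\ne2,3$. Let $(A,-)=C_1\otimes C_2$ be an $(m_1,m_2)$-product algebra over $k$, with $m_1\neq m_2$. The canonical homomorphism of algebraic groups $\varphi:\mathbf{Aut}(C_1)\times\mathbf{Aut}(C_2)\to\mathbf{Aut}(A,-)$ is an isomorphism.
   Context: $C_1,C_2$ are (unital) composition algebras over $k$ of dimensions $m_1,m_2\in\{1,2,4,8\}$, and $A=C_1\otimes_kC_2$ carries the tensor product of the standard involutions of $C_1$ and $C_2$. $\mathbf{Aut}(C_i)$ is the automorphism group scheme of the $k$-algebra $C_i$, and $\mathbf{Aut}(A,-)$ is the group scheme of $k$-algebra automorphisms of $A$ commuting with the involution. The map $\varphi$ sends $(f_1,f_2)$ to $f_1\otimes f_2$. *)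

theory Defs
  imports
    "HOL-Algebra.Bij"
    "HOL-Algebra.Free_Abelian_Groups"
    "Jordan_Normal_Form.Missing_VectorSpace"
begin

section \<open>Unital nonassociative algebras and composition algebras\<close>

text \<open>
  The record type of modules already has a multiplication and a unit, so it also serves for
  algebras.  The library locale \<^locale>\<open>algebra\<close> requires the multiplication to be associative and
  commutative; it is used below only for the commutative algebras over which we change base.
\<close>

locale unital_algebra = module R A for R and A (structure) +
  assumes mult_closed: "\<lbrakk>x \<in> carrier A; y \<in> carrier A\<rbrakk> \<Longrightarrow> x \<otimes> y \<in> carrier A"
    and unit_closed: "\<one> \<in> carrier A"
    and unit_left: "x \<in> carrier A \<Longrightarrow> \<one> \<otimes> x = x"
    and unit_right: "x \<in> carrier A \<Longrightarrow> x \<otimes> \<one> = x"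
    and mult_add_left:
      "\<lbrakk>x \<in> carrier A; y \<in> carrier A; z \<in> carrier A\<rbrakk> \<Longrightarrow> (x \<oplus> y) \<otimes> z = x \<otimes> z \<oplus> y \<otimes> z"
    and mult_add_right:
      "\<lbrakk>x \<in> carrier A; y \<in> carrier A; z \<in> carrier A\<rbrakk> \<Longrightarrow> x \<otimes> (y \<oplus> z) = x \<otimes> y \<oplus> x \<otimes> z"
    and mult_smult_left:
      "\<lbrakk>r \<in> carrier R; x \<in> carrier A; y \<in> carrier A\<rbrakk> \<Longrightarrow> (r \<odot> x) \<otimes> y = r \<odot> (x \<otimes> y)"
    and mult_smult_right:
      "\<lbrakk>r \<in> carrier R; x \<in> carrier A; y \<in> carrier A\<rbrakk> \<Longrightarrow> x \<otimes> (r \<odot> y) = r \<odot> (x \<otimes> y)"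

definition polar_form ::
  "('k, 'p) ring_scheme \<Rightarrow> ('k, 'a, 'm) module_scheme \<Rightarrow> ('a \<Rightarrow> 'k) \<Rightarrow> 'a \<Rightarrow> 'a \<Rightarrow> 'k"
  where "polar_form k C n x y = n (x \<oplus>\<^bsub>C\<^esub> y) \<ominus>\<^bsub>k\<^esub> n x \<ominus>\<^bsub>k\<^esub> n y"

text \<open>Nondegeneracy refers to the polar form; this is the usual notion away from characteristic 2.\<close>

locale composition_algebra = unital_algebra k C + field k for k and C (structure) +
  fixes n :: "_ \<Rightarrow> _"
  assumes norm_closed: "x \<in> carrier C \<Longrightarrow> n x \<in> carrier k"
    and norm_smult:
      "\<lbrakk>r \<in> carrier k; x \<in> carrier C\<rbrakk> \<Longrightarrow> n (r \<odot> x) = r \<otimes>\<^bsub>k\<^esub> r \<otimes>\<^bsub>k\<^esub> n x"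
    and polar_add:
      "\<lbrakk>x \<in> carrier C; y \<in> carrier C; z \<in> carrier C\<rbrakk> \<Longrightarrow>
       polar_form k C n (x \<oplus> y) z = polar_form k C n x z \<oplus>\<^bsub>k\<^esub> polar_form k C n y z"
    and polar_smult:
      "\<lbrakk>r \<in> carrier k; x \<in> carrier C; y \<in> carrier C\<rbrakk> \<Longrightarrow>
       polar_form k C n (r \<odot> x) y = r \<otimes>\<^bsub>k\<^esub> polar_form k C n x y"
    and norm_nondegenerate:
      "\<lbrakk>x \<in> carrier C; \<And>y. y \<in> carrier C \<Longrightarrow> polar_form k C n x y = \<zero>\<^bsub>k\<^esub>\<rbrakk> \<Longrightarrow> x = \<zero>"
    and norm_mult:
      "\<lbrakk>x \<in> carrier C; y \<in> carrier C\<rbrakk> \<Longrightarrow> n (x \<otimes> y) = n x \<otimes>\<^bsub>k\<^esub> n y"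

definition standard_involution ::
  "('k, 'p) ring_scheme \<Rightarrow> ('k, 'a, 'm) module_scheme \<Rightarrow> ('a \<Rightarrow> 'k) \<Rightarrow> 'a \<Rightarrow> 'a"
  where "standard_involution k C n x = (polar_form k C n x \<one>\<^bsub>C\<^esub> \<odot>\<^bsub>C\<^esub> \<one>\<^bsub>C\<^esub>) \<ominus>\<^bsub>C\<^esub> x"

text \<open>
  \<^const>\<open>vectorspace.dim\<close> is a least element, unspecified for spaces without finite generating
  sets, hence the separate finiteness clause.
\<close>

definition has_dimension ::
  "('k, 'p) ring_scheme \<Rightarrow> ('k, 'a, 'm) module_scheme \<Rightarrow> nat \<Rightarrow> bool"
  where "has_dimension k V m \<longleftrightarrow>
    vectorspace k V \<and> vectorspace.fin_dim k V \<and> vectorspace.dim k V = m"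


section \<open>Tensor products\<close>

definition tensor_relators ::
  "('r, 'p) ring_scheme \<Rightarrow> ('r, 'a, 'm) module_scheme \<Rightarrow> ('r, 'b, 'n) module_scheme
   \<Rightarrow> ('a \<times> 'b \<Rightarrow>\<^sub>0 int) set"
  where "tensor_relators R M N =
    {frag_of (x \<oplus>\<^bsub>M\<^esub> x', y) - frag_of (x, y) - frag_of (x', y) | x x' y.
       x \<in> carrier M \<and> x' \<in> carrier M \<and> y \<in> carrier N} \<union>
    {frag_of (x, y \<oplus>\<^bsub>N\<^esub> y') - frag_of (x, y) - frag_of (x, y') | x y y'.
       x \<in> carrier M \<and> y \<in> carrier N \<and> y' \<in> carrier N} \<union>
    {frag_of (r \<odot>\<^bsub>M\<^esub> x, y) - frag_of (x, r \<odot>\<^bsub>N\<^esub> y) | r x y.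
       r \<in> carrier R \<and> x \<in> carrier M \<and> y \<in> carrier N}"

definition tensor_kernel ::
  "('r, 'p) ring_scheme \<Rightarrow> ('r, 'a, 'm) module_scheme \<Rightarrow> ('r, 'b, 'n) module_scheme
   \<Rightarrow> ('a \<times> 'b \<Rightarrow>\<^sub>0 int) set"
  where "tensor_kernel R M N =
    generate (free_Abelian_group (carrier M \<times> carrier N)) (tensor_relators R M N)"

text \<open>The additive group of the tensor product, written multiplicatively as all quotient groups.\<close>

definition tensor_group ::
  "('r, 'p) ring_scheme \<Rightarrow> ('r, 'a, 'm) module_scheme \<Rightarrow> ('r, 'b, 'n) module_scheme
   \<Rightarrow> ('a \<times> 'b \<Rightarrow>\<^sub>0 int) set monoid"
  where "tensor_group R M N =
    free_Abelian_group (carrier M \<times> carrier N) Mod tensor_kernel R M N"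

definition pure_tensor ::
  "('r, 'p) ring_scheme \<Rightarrow> ('r, 'a, 'm) module_scheme \<Rightarrow> ('r, 'b, 'n) module_scheme
   \<Rightarrow> 'a \<Rightarrow> 'b \<Rightarrow> ('a \<times> 'b \<Rightarrow>\<^sub>0 int) set"
  where "pure_tensor R M N x y =
    tensor_kernel R M N #>\<^bsub>free_Abelian_group (carrier M \<times> carrier N)\<^esub> frag_of (x, y)"

text \<open>
  The homomorphism induced by a biadditive balanced map \<open>h\<close> through the universal property.
\<close>

definition tensor_lift ::
  "('r, 'p) ring_scheme \<Rightarrow> ('r, 'a, 'm) module_scheme \<Rightarrow> ('r, 'b, 'n) module_scheme
   \<Rightarrow> ('c, 'q) monoid_scheme \<Rightarrow> ('a \<Rightarrow> 'b \<Rightarrow> 'c) \<Rightarrow> ('a \<times> 'b \<Rightarrow>\<^sub>0 int) set \<Rightarrow> 'c"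
  where "tensor_lift R M N G h =
    (THE f. f \<in> hom (tensor_group R M N) G \<and> f \<in> extensional (carrier (tensor_group R M N)) \<and>
       (\<forall>x \<in> carrier M. \<forall>y \<in> carrier N. f (pure_tensor R M N x y) = h x y))"

definition balanced ::
  "('r, 'p) ring_scheme \<Rightarrow> ('r, 'a, 'm) module_scheme \<Rightarrow> ('r, 'b, 'n) module_scheme
   \<Rightarrow> ('c, 'q) monoid_scheme \<Rightarrow> ('a \<Rightarrow> 'b \<Rightarrow> 'c) \<Rightarrow> bool"
  where "balanced R M N G h \<longleftrightarrow>
    (\<forall>x \<in> carrier M. \<forall>y \<in> carrier N. h x y \<in> carrier G) \<and>
    (\<forall>x \<in> carrier M. \<forall>x' \<in> carrier M. \<forall>y \<in> carrier N. h (x \<oplus>\<^bsub>M\<^esub> x') y = h x y \<otimes>\<^bsub>G\<^esub> h x' y) \<and>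
    (\<forall>x \<in> carrier M. \<forall>y \<in> carrier N. \<forall>y' \<in> carrier N. h x (y \<oplus>\<^bsub>N\<^esub> y') = h x y \<otimes>\<^bsub>G\<^esub> h x y') \<and>
    (\<forall>r \<in> carrier R. \<forall>x \<in> carrier M. \<forall>y \<in> carrier N. h (r \<odot>\<^bsub>M\<^esub> x) y = h x (r \<odot>\<^bsub>N\<^esub> y))"

lemma diff_in_free_Abelian_group:
  "\<lbrakk>a \<in> carrier (free_Abelian_group S); b \<in> carrier (free_Abelian_group S)\<rbrakk>
   \<Longrightarrow> a - b \<in> carrier (free_Abelian_group S)"
  using keys_diff[of a b] by (auto simp: free_Abelian_group_def)

lemma tensor_relators_subset:
  assumes "module R M" "module R N"
  shows "tensor_relators R M N \<subseteq> carrier (free_Abelian_group (carrier M \<times> carrier N))"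
proof -
  interpret M: module R M by fact
  interpret N: module R N by fact
  show ?thesis
    unfolding tensor_relators_def
    by (intro Un_least subsetI; elim CollectE exE conjE; hypsubst)
      (simp_all add: diff_in_free_Abelian_group del: carrier_free_Abelian_group_iff)
qed

lemma tensor_kernel_normal:
  assumes "module R M" "module R N"
  shows "tensor_kernel R M N \<lhd> free_Abelian_group (carrier M \<times> carrier N)"
proof -
  interpret F: comm_group "free_Abelian_group (carrier M \<times> carrier N)"
    by (rule abelian_free_Abelian_group)
  show ?thesis
    unfolding tensor_kernel_def
    using F.normal_iff_subgroup F.generate_is_subgroup[OF tensor_relators_subset[OF assms]] by blast
qed

text \<open>The universal property: the description in \<^const>\<open>tensor_lift\<close> is proper.\<close>

lemma tensor_lift_ex1:
  assumes M: "module R M" and N: "module R N" and G: "comm_group G"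
    and h: "balanced R M N G h"
  shows "\<exists>!f. f \<in> hom (tensor_group R M N) G \<and> f \<in> extensional (carrier (tensor_group R M N)) \<and>
       (\<forall>x \<in> carrier M. \<forall>y \<in> carrier N. f (pure_tensor R M N x y) = h x y)"
proof -
  define F where "F = free_Abelian_group (carrier M \<times> carrier N)"
  define K where "K = tensor_kernel R M N"
  interpret G: comm_group G by fact
  interpret F: group F by (simp add: F_def)
  interpret K: normal K F unfolding F_def K_def by (rule tensor_kernel_normal[OF M N])
  have T: "tensor_group R M N = F Mod K" by (simp add: tensor_group_def F_def K_def)
  have pure: "pure_tensor R M N x y = K #>\<^bsub>F\<^esub> frag_of (x, y)" for x y
    by (simp add: pure_tensor_def F_def K_def)
  have "case_prod h ` (carrier M \<times> carrier N) \<subseteq> carrier G"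
    using h by (auto simp: balanced_def)
  then obtain g where g: "g \<in> hom F G"
    and g_of: "\<And>p. p \<in> carrier M \<times> carrier N \<Longrightarrow> g (frag_of p) = case_prod h p"
    using G.free_Abelian_group_universal unfolding F_def by metis
  interpret g: group_hom F G g
    using g by (simp add: group_hom_def group_hom_axioms_def F.is_group G.is_group)
  have kerI: "d \<in> kernel F G g"
    if "d \<in> carrier F" "d = a - b" "a \<in> carrier F" "b \<in> carrier F" "g a = g b" for a b d
  proof -
    have "a = d \<otimes>\<^bsub>F\<^esub> b" using that by (simp add: F_def free_Abelian_group_def)
    then have "g a = g d \<otimes>\<^bsub>G\<^esub> g b" using g.hom_mult[OF that(1,4)] by simp
    then have "g d = \<one>\<^bsub>G\<^esub>" using that by (metis G.r_cancel_one' g.hom_closed)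
    then show ?thesis using that by (simp add: kernel_def)
  qed
  have rel: "tensor_relators R M N \<subseteq> carrier F"
    unfolding F_def by (rule tensor_relators_subset[OF M N])
  have addF: "a \<otimes>\<^bsub>F\<^esub> b = a + b" for a b by (simp add: F_def free_Abelian_group_def)
  have ofF: "frag_of p \<in> carrier F \<longleftrightarrow> p \<in> carrier M \<times> carrier N" for p by (simp add: F_def)
  have sumF: "a + b \<in> carrier F" if "a \<in> carrier F" "b \<in> carrier F" for a b
    using F.m_closed[OF that] by (simp add: addF)
  have gsum: "g (a + b) = g a \<otimes>\<^bsub>G\<^esub> g b" if "a \<in> carrier F" "b \<in> carrier F" for a b
    using g.hom_mult[OF that] by (simp add: addF)
  interpret M: module R M by fact
  interpret N: module R N by fact
  have "d \<in> kernel F G g" if d: "d \<in> tensor_relators R M N" for d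
  proof -
    have dF: "d \<in> carrier F" using d rel by blast
    note hs = h[unfolded balanced_def]
    from d show ?thesis
      unfolding tensor_relators_def diff_diff_add
      by (elim UnE CollectE exE conjE)
        (rule kerI[OF dF], assumption; simp add: ofF sumF gsum g_of hs)+
  qed
  then have "K \<subseteq> kernel F G g"
    unfolding K_def tensor_kernel_def F_def[symmetric]
    by (intro F.generate_subgroup_incl g.subgroup_kernel subsetI)
  then obtain f where f: "f \<in> hom (F Mod K) G" and f_of: "\<And>x. x \<in> carrier F \<Longrightarrow> f (K #>\<^bsub>F\<^esub> x) = g x"
    using g.FactGroup_universal_kernel[OF K.normal_axioms] by metis
  let ?f = "restrict f (carrier (F Mod K))"
  have cos: "K #>\<^bsub>F\<^esub> x \<in> carrier (F Mod K)" if "x \<in> carrier F" for x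
    using that by (auto simp: FactGroup_def RCOSETS_def)
  have ex: "?f \<in> hom (F Mod K) G \<and> ?f \<in> extensional (carrier (F Mod K)) \<and>
       (\<forall>x \<in> carrier M. \<forall>y \<in> carrier N. ?f (K #>\<^bsub>F\<^esub> frag_of (x, y)) = h x y)"
    using f cos f_of g_of monoid.m_closed[OF group.is_monoid[OF K.factorgroup_is_group]]
    by (auto simp: hom_def ofF simp del: mult_FactGroup)
  have uniq: "f1 = f2"
    if f1: "f1 \<in> hom (F Mod K) G" "f1 \<in> extensional (carrier (F Mod K))"
      "\<And>x y. x \<in> carrier M \<Longrightarrow> y \<in> carrier N \<Longrightarrow> f1 (K #>\<^bsub>F\<^esub> frag_of (x, y)) = h x y"
    and f2: "f2 \<in> hom (F Mod K) G" "f2 \<in> extensional (carrier (F Mod K))"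
      "\<And>x y. x \<in> carrier M \<Longrightarrow> y \<in> carrier N \<Longrightarrow> f2 (K #>\<^bsub>F\<^esub> frag_of (x, y)) = h x y"
    for f1 f2
  proof (rule extensionalityI[OF f1(2) f2(2)])
    fix U assume "U \<in> carrier (F Mod K)"
    then obtain u where u: "u \<in> carrier F" "U = K #>\<^bsub>F\<^esub> u"
      by (auto simp: FactGroup_def RCOSETS_def)
    have lift_hom: "(\<lambda>u. e (K #>\<^bsub>F\<^esub> u)) \<in> hom F G" if "e \<in> hom (F Mod K) G" for e
      using hom_compose[OF K.r_coset_hom_Mod that] by (simp add: comp_def)
    note e1 = lift_hom[OF f1(1)] and e2 = lift_hom[OF f2(1)]
    have "Poly_Mapping.keys u \<subseteq> carrier M \<times> carrier N" using u by (simp add: F_def free_Abelian_group_def)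
    then have "f1 (K #>\<^bsub>F\<^esub> u) = f2 (K #>\<^bsub>F\<^esub> u)"
    proof (induction rule: free_Abelian_group_induct[consumes 1, case_names zero diff one])
      case zero
      show ?case
        using hom_one[OF e1 F.is_group G.is_group] hom_one[OF e2 F.is_group G.is_group]
        by (simp add: F_def free_Abelian_group_def)
    next
      case (diff a b)
      have ab: "a \<in> carrier F" "b \<in> carrier F" "a - b \<in> carrier F"
        using diff keys_diff[of a b] by (auto simp: F_def free_Abelian_group_def)
      have a: "a = (a - b) \<otimes>\<^bsub>F\<^esub> b" by (simp add: addF)
      have e: "e (K #>\<^bsub>F\<^esub> a) = e (K #>\<^bsub>F\<^esub> (a - b)) \<otimes>\<^bsub>G\<^esub> e (K #>\<^bsub>F\<^esub> b)"
        if "(\<lambda>u. e (K #>\<^bsub>F\<^esub> u)) \<in> hom F G" for e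
        using hom_mult[OF that ab(3,2)] a by metis
      show ?case
        using e[OF e1] e[OF e2] diff(3,4) hom_in_carrier[OF e1 ab(2)] hom_in_carrier[OF e1 ab(3)]
          hom_in_carrier[OF e2 ab(3)] by (simp add: G.right_cancel)
    next
      case (one p)
      then show ?case using f1(3) f2(3) by (cases p) auto
    qed
    then show "f1 U = f2 U" by (simp add: u)
  qed
  show ?thesis
    unfolding T pure
  proof (rule ex_ex1I, rule exI, rule ex)
    fix f1 f2
    let ?P = "\<lambda>f. f \<in> hom (F Mod K) G \<and> f \<in> extensional (carrier (F Mod K)) \<and>
       (\<forall>x \<in> carrier M. \<forall>y \<in> carrier N. f (K #>\<^bsub>F\<^esub> frag_of (x, y)) = h x y)"
    assume "?P f1" "?P f2"
    then show "f1 = f2" by (intro uniq) blast+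
  qed
qed

definition tensor_map ::
  "('r, 'p) ring_scheme \<Rightarrow> ('r, 'a, 'm) module_scheme \<Rightarrow> ('r, 'b, 'n) module_scheme
   \<Rightarrow> ('r, 'c, 'm') module_scheme \<Rightarrow> ('r, 'd, 'n') module_scheme
   \<Rightarrow> ('a \<Rightarrow> 'c) \<Rightarrow> ('b \<Rightarrow> 'd) \<Rightarrow> ('a \<times> 'b \<Rightarrow>\<^sub>0 int) set \<Rightarrow> ('c \<times> 'd \<Rightarrow>\<^sub>0 int) set"
  where "tensor_map R M N M' N' f g =
    tensor_lift R M N (tensor_group R M' N') (\<lambda>x y. pure_tensor R M' N' (f x) (g y))"

definition tensor_mult ::
  "('r, 'p) ring_scheme \<Rightarrow> ('r, 'a, 'm) module_scheme \<Rightarrow> ('r, 'b, 'n) module_scheme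
   \<Rightarrow> ('a \<times> 'b \<Rightarrow>\<^sub>0 int) set \<Rightarrow> ('a \<times> 'b \<Rightarrow>\<^sub>0 int) set \<Rightarrow> ('a \<times> 'b \<Rightarrow>\<^sub>0 int) set"
  where "tensor_mult R A B U V =
    tensor_lift R A B (tensor_group R A B)
      (\<lambda>x y. tensor_lift R A B (tensor_group R A B)
         (\<lambda>x' y'. pure_tensor R A B (x \<otimes>\<^bsub>A\<^esub> x') (y \<otimes>\<^bsub>B\<^esub> y')) V) U"

definition tensor_algebra ::
  "('r, 'p) ring_scheme \<Rightarrow> ('r, 'a, 'm) module_scheme \<Rightarrow> ('r, 'b, 'n) module_scheme
   \<Rightarrow> ('r, ('a \<times> 'b \<Rightarrow>\<^sub>0 int) set) module"
  where "tensor_algebra R A B =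
    \<lparr>carrier = carrier (tensor_group R A B),
     mult = tensor_mult R A B,
     one = pure_tensor R A B \<one>\<^bsub>A\<^esub> \<one>\<^bsub>B\<^esub>,
     zero = \<one>\<^bsub>tensor_group R A B\<^esub>,
     add = (\<lambda>U V. U \<otimes>\<^bsub>tensor_group R A B\<^esub> V),
     smult = (\<lambda>r. tensor_lift R A B (tensor_group R A B)
                (\<lambda>x y. pure_tensor R A B (r \<odot>\<^bsub>A\<^esub> x) y))\<rparr>"

text \<open>\<open>A \<otimes>\<^sub>k R\<close> as an algebra over \<open>R\<close>.\<close>

definition base_change ::
  "('k, 'p) ring_scheme \<Rightarrow> ('k, 'a, 'm) module_scheme \<Rightarrow> ('k, 'r, 'n) module_scheme
   \<Rightarrow> ('r, ('a \<times> 'r \<Rightarrow>\<^sub>0 int) set) module"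
  where "base_change k A R =
    \<lparr>carrier = carrier (tensor_algebra k A R),
     mult = mult (tensor_algebra k A R),
     one = one (tensor_algebra k A R),
     zero = zero (tensor_algebra k A R),
     add = add (tensor_algebra k A R),
     smult = (\<lambda>r. tensor_lift k A R (tensor_group k A R)
                (\<lambda>x s. pure_tensor k A R x (r \<otimes>\<^bsub>R\<^esub> s)))\<rparr>"


section \<open>Automorphism group schemes\<close>

text \<open>
  Affine group schemes over \<open>k\<close> are represented by their functors of points on commutative
  \<open>k\<close>-algebras.
\<close>

definition algebra_hom ::
  "('k, 'p) ring_scheme \<Rightarrow> ('k, 'a, 'm) module_scheme \<Rightarrow> ('k, 'b, 'n) module_scheme \<Rightarrow> ('a \<Rightarrow> 'b) set"
  where "algebra_hom k A B =
    {f \<in> ring_hom A B. \<forall>r \<in> carrier k. \<forall>x \<in> carrier A. f (r \<odot>\<^bsub>A\<^esub> x) = r \<odot>\<^bsub>B\<^esub> f x}"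

definition algebra_aut ::
  "('k, 'p) ring_scheme \<Rightarrow> ('k, 'a, 'm) module_scheme \<Rightarrow> ('a \<Rightarrow> 'a) set"
  where "algebra_aut k A = algebra_hom k A A \<inter> Bij (carrier A)"

definition Aut_scheme ::
  "('k, 'p) ring_scheme \<Rightarrow> ('k, 'a, 'm) module_scheme \<Rightarrow> ('k, 'r, 'n) module_scheme
   \<Rightarrow> (('a \<times> 'r \<Rightarrow>\<^sub>0 int) set \<Rightarrow> ('a \<times> 'r \<Rightarrow>\<^sub>0 int) set) monoid"
  where "Aut_scheme k A R =
    BijGroup (carrier (base_change k A R)) \<lparr>carrier := algebra_aut R (base_change k A R)\<rparr>"

definition Aut_inv_scheme ::
  "('k, 'p) ring_scheme \<Rightarrow> ('k, 'a, 'm) module_scheme \<Rightarrow> ('a \<Rightarrow> 'a) \<Rightarrow> ('k, 'r, 'n) module_scheme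
   \<Rightarrow> (('a \<times> 'r \<Rightarrow>\<^sub>0 int) set \<Rightarrow> ('a \<times> 'r \<Rightarrow>\<^sub>0 int) set) monoid"
  where "Aut_inv_scheme k A \<sigma> R =
    BijGroup (carrier (base_change k A R))
      \<lparr>carrier := {f \<in> algebra_aut R (base_change k A R).
         \<forall>u \<in> carrier (base_change k A R).
           f (tensor_map k A R A R \<sigma> (\<lambda>r. r) u) = tensor_map k A R A R \<sigma> (\<lambda>r. r) (f u)}\<rparr>"

text \<open>
  Functoriality of both schemes along \<open>\<rho> : R \<rightarrow> S\<close>: the automorphism \<open>f\<close> of \<open>A\<^sub>R\<close> is sent to the
  \<open>S\<close>-linear map on \<open>A\<^sub>S\<close> that extends \<open>x \<otimes> 1 \<mapsto> (id \<otimes> \<rho>) (f (x \<otimes> 1))\<close>.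
\<close>

definition Aut_map ::
  "('k, 'p) ring_scheme \<Rightarrow> ('k, 'a, 'm) module_scheme
   \<Rightarrow> ('k, 'r, 'n) module_scheme \<Rightarrow> ('k, 's, 'q) module_scheme \<Rightarrow> ('r \<Rightarrow> 's)
   \<Rightarrow> (('a \<times> 'r \<Rightarrow>\<^sub>0 int) set \<Rightarrow> ('a \<times> 'r \<Rightarrow>\<^sub>0 int) set)
   \<Rightarrow> ('a \<times> 's \<Rightarrow>\<^sub>0 int) set \<Rightarrow> ('a \<times> 's \<Rightarrow>\<^sub>0 int) set"
  where "Aut_map k A R S \<rho> f =
    tensor_lift k A S (tensor_group k A S)
      (\<lambda>x s. s \<odot>\<^bsub>base_change k A S\<^esub>
         tensor_map k A R A S (\<lambda>a. a) \<rho> (f (pure_tensor k A R x \<one>\<^bsub>R\<^esub>)))"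

text \<open>
  An isomorphism of group schemes is a natural isomorphism of group-valued functors of points.
  All algebras \<open>R\<close> have their carriers inside one type \<open>'r\<close>; as \<open>'r\<close> is arbitrary
  and carriers may be proper subsets, any set of algebras is covered.
\<close>

definition group_scheme_iso ::
  "('k, 'p) ring_scheme \<Rightarrow> (('k, 'r) module \<Rightarrow> 'g monoid)
   \<Rightarrow> (('k, 'r) module \<Rightarrow> ('k, 'r) module \<Rightarrow> ('r \<Rightarrow> 'r) \<Rightarrow> 'g \<Rightarrow> 'g)
   \<Rightarrow> (('k, 'r) module \<Rightarrow> 'h monoid)
   \<Rightarrow> (('k, 'r) module \<Rightarrow> ('k, 'r) module \<Rightarrow> ('r \<Rightarrow> 'r) \<Rightarrow> 'h \<Rightarrow> 'h)
   \<Rightarrow> (('k, 'r) module \<Rightarrow> 'g \<Rightarrow> 'h) \<Rightarrow> bool"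
  where "group_scheme_iso k G Gmap H Hmap \<phi> \<longleftrightarrow>
    (\<forall>R. algebra k R \<longrightarrow> group (G R) \<and> group (H R) \<and> \<phi> R \<in> iso (G R) (H R)) \<and>
    (\<forall>R S \<rho>. algebra k R \<and> algebra k S \<and> \<rho> \<in> algebra_hom k R S \<longrightarrow>
       (\<forall>g \<in> carrier (G R). \<phi> S (Gmap R S \<rho> g) = Hmap R S \<rho> (\<phi> R g)))"

text \<open>
  The canonical isomorphism from \<open>(A \<otimes>\<^sub>k R) \<otimes>\<^sub>R (B \<otimes>\<^sub>k R)\<close> to \<open>(A \<otimes>\<^sub>k B) \<otimes>\<^sub>k R\<close>, which maps
  \<open>(x \<otimes> r) \<otimes> (y \<otimes> s)\<close> to \<open>(x \<otimes> y) \<otimes> r s\<close>.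
\<close>

definition tensor_base_change ::
  "('k, 'p) ring_scheme \<Rightarrow> ('k, 'a, 'm) module_scheme \<Rightarrow> ('k, 'b, 'n) module_scheme
   \<Rightarrow> ('k, 'r, 'q) module_scheme
   \<Rightarrow> (('a \<times> 'r \<Rightarrow>\<^sub>0 int) set \<times> ('b \<times> 'r \<Rightarrow>\<^sub>0 int) set \<Rightarrow>\<^sub>0 int) set
   \<Rightarrow> (('a \<times> 'b \<Rightarrow>\<^sub>0 int) set \<times> 'r \<Rightarrow>\<^sub>0 int) set"
  where "tensor_base_change k A B R =
    (let T = tensor_group k (tensor_algebra k A B) R in
     tensor_lift R (base_change k A R) (base_change k B R) T
       (\<lambda>U V. tensor_lift k A R T
          (\<lambda>x r. tensor_lift k B R T
             (\<lambda>y s. pure_tensor k (tensor_algebra k A B) R (pure_tensor k A B x y) (r \<otimes>\<^bsub>R\<^esub> s)) V) U))"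

text \<open>
  The map \<open>(f\<^sub>1, f\<^sub>2) \<mapsto> f\<^sub>1 \<otimes> f\<^sub>2\<close> on \<open>R\<close>-points: the tensor product over \<open>R\<close> of the two maps,
  transported along the canonical isomorphism.
\<close>

definition tensor_aut ::
  "('k, 'p) ring_scheme \<Rightarrow> ('k, 'a, 'm) module_scheme \<Rightarrow> ('k, 'b, 'n) module_scheme
   \<Rightarrow> ('k, 'r, 'q) module_scheme
   \<Rightarrow> (('a \<times> 'r \<Rightarrow>\<^sub>0 int) set \<Rightarrow> ('a \<times> 'r \<Rightarrow>\<^sub>0 int) set)
      \<times> (('b \<times> 'r \<Rightarrow>\<^sub>0 int) set \<Rightarrow> ('b \<times> 'r \<Rightarrow>\<^sub>0 int) set)
   \<Rightarrow> (('a \<times> 'b \<Rightarrow>\<^sub>0 int) set \<times> 'r \<Rightarrow>\<^sub>0 int) set \<Rightarrow> (('a \<times> 'b \<Rightarrow>\<^sub>0 int) set \<times> 'r \<Rightarrow>\<^sub>0 int) set"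
  where "tensor_aut k A B R = (\<lambda>(f\<^sub>1, f\<^sub>2).
    restrict
      (\<lambda>W. tensor_base_change k A B R
         (tensor_map R (base_change k A R) (base_change k B R)
            (base_change k A R) (base_change k B R) f\<^sub>1 f\<^sub>2
            (inv_into (carrier (tensor_group R (base_change k A R) (base_change k B R)))
               (tensor_base_change k A B R) W)))
      (carrier (base_change k (tensor_algebra k A B) R)))"

end

theory Submission
  imports Defs
begin

text \<open>
  Fix a commutative \<open>k\<close>-algebra \<open>R\<close> and let \<open>A\<close> and \<open>B\<close> be the extensions of \<open>C\<^sub>1\<close> and \<open>C\<^sub>2\<close> to \<open>R\<close>, so
  that the extension \<open>W\<close> of \<open>C\<^sub>1 \<otimes> C\<^sub>2\<close> is \<open>A \<otimes> B\<close>.  Both factors are quadratic algebras: half of the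
  trace is a functional \<open>l\<close> with \<open>l 1 = 1\<close>, elements with \<open>l s = 0\<close> have scalar squares, and the
  standard involution fixes the scalars and negates the traceless elements.  Since 2 is invertible,
  the skew elements of \<open>W\<close> are the sums \<open>u \<otimes> 1 + 1 \<otimes> v\<close> with \<open>u\<close> and \<open>v\<close> traceless
  (\<open>skew_decomposition\<close>).

  Let \<open>f\<close> be an automorphism of \<open>W\<close> that commutes with the involution and let \<open>s\<close> be traceless in \<open>A\<close>.
  Then \<open>f (s \<otimes> 1) = a \<otimes> 1 + 1 \<otimes> c\<close> is again skew with a scalar square, and therefore \<open>a \<otimes> c = 0\<close>.
  The point is to show \<open>c = 0\<close>.  If \<open>C\<^sub>1\<close> or \<open>C\<^sub>2\<close> has dimension one, then it has no traceless
  elements besides 0 and there is nothing to do.  Otherwise nondegeneracy of the norm yields a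
  traceless \<open>s\<^sub>0\<close> with invertible square \<open>\<nu>\<close> (\<open>scalars_or_anisotropic\<close>), and the squares \<open>\<mu>\<close> and \<open>\<kappa>\<close>
  of the two components of \<open>f (s\<^sub>0 \<otimes> 1)\<close> split the base: \<open>\<mu> + \<kappa> = \<nu>\<close>, and \<open>\<mu> c = 0\<close> and \<open>\<kappa> a = 0\<close> for
  all \<open>s\<close> (\<open>base_splits\<close>).  The other factor gives \<open>\<mu>'\<close> and \<open>\<kappa>'\<close> in the same way.  Where \<open>\<kappa>\<close> and
  \<open>\<mu>'\<close> both live, \<open>f\<close> would map both factors to \<open>B\<close>, contradicting surjectivity (\<open>no_merge\<close>); where
  \<open>\<kappa>\<close> and \<open>\<kappa>'\<close> both live, \<open>f\<close> would exchange the factors, and the equality of the traces of \<open>G \<circ> H\<close>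
  and \<open>H \<circ> G\<close> for the induced maps \<open>G\<close> and \<open>H\<close> shows \<open>m\<^sub>1 \<kappa> \<kappa>' = m\<^sub>2 \<kappa> \<kappa>'\<close> (\<open>no_swap\<close>).  As \<open>m\<^sub>1 - m\<^sub>2\<close> is
  up to sign 2, 4 or 6, which is invertible away from characteristic 2 and 3, this forces
  \<open>\<kappa> \<kappa>' = 0\<close>.  Hence \<open>\<kappa> (\<mu>' + \<kappa>') = 0\<close> with an invertible second
  factor, so \<open>\<kappa> = 0\<close>, \<open>\<mu>\<close> is invertible, and \<open>c = 0\<close>.

  It follows that \<open>f\<close> preserves \<open>A \<otimes> 1\<close> and \<open>1 \<otimes> B\<close> and equals \<open>f\<^sub>1 \<otimes> f\<^sub>2\<close> for its restrictions
  (\<open>automorphism_splits\<close>).  Conversely \<open>f\<^sub>1 \<otimes> f\<^sub>2\<close> commutes with the involution because automorphisms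
  of the factors preserve traceless elements (\<open>automorphism_traceless\<close>), and \<open>f\<^sub>1\<close> and \<open>f\<^sub>2\<close> are
  recovered from \<open>f\<^sub>1 \<otimes> f\<^sub>2\<close> by the partial half traces.  Calculations in tensor products
  reduce to pure tensors throughout: the universal property provides additive maps with prescribed
  values on pure tensors, and these values determine them.
\<close>

section \<open>Calculating in tensor products\<close>

locale tensor_modules = M: module R M + N: module R N for R and M and N
begin

abbreviation T where "T \<equiv> tensor_group R M N"
abbreviation pure where "pure \<equiv> pure_tensor R M N"

lemma tensor_comm_group: "comm_group T"
proof -
  interpret F: comm_group "free_Abelian_group (carrier M \<times> carrier N)"
    by (rule abelian_free_Abelian_group)
  have "tensor_kernel R M N \<lhd> free_Abelian_group (carrier M \<times> carrier N)"
    by (rule tensor_kernel_normal) unfold_locales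
  then show ?thesis
    unfolding tensor_group_def by (intro F.abelian_FactGroup normal_imp_subgroup)
qed

sublocale T: comm_group T
  by (rule tensor_comm_group)

lemma pure_closed [simp, intro]:
  "x \<in> carrier M \<Longrightarrow> y \<in> carrier N \<Longrightarrow> pure x y \<in> carrier T"
  by (auto simp: pure_tensor_def tensor_group_def FactGroup_def RCOSETS_def)

lemma pure_add_left:
    "\<lbrakk>x \<in> carrier M; x' \<in> carrier M; y \<in> carrier N\<rbrakk>
      \<Longrightarrow> pure (x \<oplus>\<^bsub>M\<^esub> x') y = pure x y \<otimes>\<^bsub>T\<^esub> pure x' y"
  and pure_add_right:
    "\<lbrakk>x \<in> carrier M; y \<in> carrier N; y' \<in> carrier N\<rbrakk>
      \<Longrightarrow> pure x (y \<oplus>\<^bsub>N\<^esub> y') = pure x y \<otimes>\<^bsub>T\<^esub> pure x y'"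
  and pure_balanced:
    "\<lbrakk>r \<in> carrier R; x \<in> carrier M; y \<in> carrier N\<rbrakk>
      \<Longrightarrow> pure (r \<odot>\<^bsub>M\<^esub> x) y = pure x (r \<odot>\<^bsub>N\<^esub> y)"
proof -
  define F where "F = free_Abelian_group (carrier M \<times> carrier N)"
  define K where "K = tensor_kernel R M N"
  have modules: "module R M" "module R N" by unfold_locales
  interpret F: comm_group F
    unfolding F_def by (rule abelian_free_Abelian_group)
  interpret K: normal K F
    unfolding F_def K_def by (rule tensor_kernel_normal[OF modules])
  have rel: "d \<in> K" if "d \<in> tensor_relators R M N" for d
    using that unfolding K_def tensor_kernel_def by (rule generate.incl)
  have of_F: "frag_of p \<in> carrier F \<longleftrightarrow> p \<in> carrier M \<times> carrier N" for p
    by (simp add: F_def)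
  have eqI: "K #>\<^bsub>F\<^esub> a = K #>\<^bsub>F\<^esub> b" if "a \<in> carrier F" "b \<in> carrier F" "a - b \<in> K" for a b
  proof -
    have "a = (a - b) \<otimes>\<^bsub>F\<^esub> b" by (simp add: F_def)
    also have "K #>\<^bsub>F\<^esub> \<dots> = (K #>\<^bsub>F\<^esub> (a - b)) #>\<^bsub>F\<^esub> b"
      using that K.subset by (intro F.coset_mult_assoc[symmetric]) auto
    also have "K #>\<^bsub>F\<^esub> (a - b) = K"
      using that K.subset by (intro F.coset_join2 K.subgroup_axioms) auto
    finally show ?thesis .
  qed
  have p: "pure x y = K #>\<^bsub>F\<^esub> frag_of (x, y)" for x y
    by (simp add: pure_tensor_def F_def K_def)
  have m: "(K #>\<^bsub>F\<^esub> a) \<otimes>\<^bsub>T\<^esub> (K #>\<^bsub>F\<^esub> b) = K #>\<^bsub>F\<^esub> (a + b)"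
    if "a \<in> carrier F" "b \<in> carrier F" for a b
    using K.rcos_sum[OF that] by (simp add: tensor_group_def F_def K_def)
  show "pure (x \<oplus>\<^bsub>M\<^esub> x') y = pure x y \<otimes>\<^bsub>T\<^esub> pure x' y"
    if "x \<in> carrier M" "x' \<in> carrier M" "y \<in> carrier N"
  proof -
    have "frag_of (x \<oplus>\<^bsub>M\<^esub> x', y) - (frag_of (x, y) + frag_of (x', y)) \<in> K"
      unfolding diff_diff_add[symmetric] using that
      by (intro rel) (auto simp: tensor_relators_def)
    moreover have "frag_of (x, y) + frag_of (x', y) \<in> carrier F"
      using that F.m_closed[of "frag_of (x, y)" "frag_of (x', y)"] by (simp add: F_def)
    ultimately have "K #>\<^bsub>F\<^esub> frag_of (x \<oplus>\<^bsub>M\<^esub> x', y) = K #>\<^bsub>F\<^esub> (frag_of (x, y) + frag_of (x', y))"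
      using that by (intro eqI) (simp_all add: of_F)
    then show ?thesis
      using that by (simp add: p m of_F)
  qed
  show "pure x (y \<oplus>\<^bsub>N\<^esub> y') = pure x y \<otimes>\<^bsub>T\<^esub> pure x y'"
    if "x \<in> carrier M" "y \<in> carrier N" "y' \<in> carrier N"
  proof -
    have "frag_of (x, y \<oplus>\<^bsub>N\<^esub> y') - (frag_of (x, y) + frag_of (x, y')) \<in> K"
      unfolding diff_diff_add[symmetric] using that
      by (intro rel) (auto simp: tensor_relators_def)
    moreover have "frag_of (x, y) + frag_of (x, y') \<in> carrier F"
      using that F.m_closed[of "frag_of (x, y)" "frag_of (x, y')"] by (simp add: F_def)
    ultimately have "K #>\<^bsub>F\<^esub> frag_of (x, y \<oplus>\<^bsub>N\<^esub> y') = K #>\<^bsub>F\<^esub> (frag_of (x, y) + frag_of (x, y'))"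
      using that by (intro eqI) (simp_all add: of_F)
    then show ?thesis
      using that by (simp add: p m of_F)
  qed
  show "pure (r \<odot>\<^bsub>M\<^esub> x) y = pure x (r \<odot>\<^bsub>N\<^esub> y)"
    if "r \<in> carrier R" "x \<in> carrier M" "y \<in> carrier N"
  proof -
    have "frag_of (r \<odot>\<^bsub>M\<^esub> x, y) - frag_of (x, r \<odot>\<^bsub>N\<^esub> y) \<in> K"
      using that by (intro rel) (auto simp: tensor_relators_def)
    then show ?thesis
      using that unfolding p by (intro eqI) (simp_all add: of_F)
  qed
qed

text \<open>
  No case for zero or for inverses is needed because the negative of a pure tensor is again a
  pure tensor.
\<close>

lemma tensor_induct [consumes 1, case_names pure add]:
  assumes U: "U \<in> carrier T"
    and P_pure: "\<And>x y. x \<in> carrier M \<Longrightarrow> y \<in> carrier N \<Longrightarrow> P (pure x y)"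
    and P_add: "\<And>U V. U \<in> carrier T \<Longrightarrow> V \<in> carrier T \<Longrightarrow> P U \<Longrightarrow> P V \<Longrightarrow> P (U \<otimes>\<^bsub>T\<^esub> V)"
  shows "P U"
proof -
  define F where "F = free_Abelian_group (carrier M \<times> carrier N)"
  define K where "K = tensor_kernel R M N"
  have modules: "module R M" "module R N" by unfold_locales
  interpret F: comm_group F
    unfolding F_def by (rule abelian_free_Abelian_group)
  interpret K: normal K F
    unfolding F_def K_def by (rule tensor_kernel_normal[OF modules])
  have T: "T = F Mod K" by (simp add: tensor_group_def F_def K_def)
  have hom: "(\<lambda>u. K #>\<^bsub>F\<^esub> u) \<in> hom F T"
    unfolding T by (rule K.r_coset_hom_Mod)
  interpret q: group_hom F T "\<lambda>u. K #>\<^bsub>F\<^esub> u"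
    by unfold_locales (rule hom)
  have p: "pure x y = K #>\<^bsub>F\<^esub> frag_of (x, y)" for x y
    by (simp add: pure_tensor_def F_def K_def)
  obtain u where u: "u \<in> carrier F" "U = K #>\<^bsub>F\<^esub> u"
    using U unfolding T by (auto simp: FactGroup_def RCOSETS_def)
  have neg: "inv\<^bsub>T\<^esub> pure x y = pure (\<ominus>\<^bsub>M\<^esub> x) y" if "x \<in> carrier M" "y \<in> carrier N" for x y
  proof -
    have "pure \<zero>\<^bsub>M\<^esub> y = pure \<zero>\<^bsub>M\<^esub> y \<otimes>\<^bsub>T\<^esub> pure \<zero>\<^bsub>M\<^esub> y"
      using pure_add_left[of "\<zero>\<^bsub>M\<^esub>" "\<zero>\<^bsub>M\<^esub>" y] that by simp
    then have "pure \<zero>\<^bsub>M\<^esub> y = \<one>\<^bsub>T\<^esub>"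
      using that by (metis T.l_cancel_one' pure_closed M.zero_closed)
    then have "pure (\<ominus>\<^bsub>M\<^esub> x) y \<otimes>\<^bsub>T\<^esub> pure x y = \<one>\<^bsub>T\<^esub>"
      using pure_add_left[of "\<ominus>\<^bsub>M\<^esub> x" x y] that by (simp add: M.l_neg)
    then show ?thesis
      using that by (intro T.inv_equality) auto
  qed
  have "Poly_Mapping.keys u \<subseteq> carrier M \<times> carrier N"
    using u by (simp add: F_def)
  then have "P (K #>\<^bsub>F\<^esub> u) \<and> P (inv\<^bsub>T\<^esub> (K #>\<^bsub>F\<^esub> u))"
  proof (induction rule: free_Abelian_group_induct[consumes 1, case_names zero diff one])
    case zero
    have "pure \<zero>\<^bsub>M\<^esub> \<zero>\<^bsub>N\<^esub> \<otimes>\<^bsub>T\<^esub> pure \<zero>\<^bsub>M\<^esub> \<zero>\<^bsub>N\<^esub> = pure \<zero>\<^bsub>M\<^esub> \<zero>\<^bsub>N\<^esub>"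
      using pure_add_left[of "\<zero>\<^bsub>M\<^esub>" "\<zero>\<^bsub>M\<^esub>" "\<zero>\<^bsub>N\<^esub>"] by simp
    then have "pure \<zero>\<^bsub>M\<^esub> \<zero>\<^bsub>N\<^esub> = \<one>\<^bsub>T\<^esub>"
      by (metis T.l_cancel_one' pure_closed M.zero_closed N.zero_closed)
    then have "P \<one>\<^bsub>T\<^esub>" using P_pure[of "\<zero>\<^bsub>M\<^esub>" "\<zero>\<^bsub>N\<^esub>"] by simp
    moreover have "K #>\<^bsub>F\<^esub> 0 = \<one>\<^bsub>T\<^esub>"
      using q.hom_one by (simp add: F_def)
    ultimately show ?case by simp
  next
    case (diff a b)
    have ab: "a \<in> carrier F" "b \<in> carrier F" using diff by (auto simp: F_def)
    have e: "a - b = a \<otimes>\<^bsub>F\<^esub> inv\<^bsub>F\<^esub> b" using ab by (simp add: F_def)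
    have 1: "K #>\<^bsub>F\<^esub> (a - b) = (K #>\<^bsub>F\<^esub> a) \<otimes>\<^bsub>T\<^esub> inv\<^bsub>T\<^esub> (K #>\<^bsub>F\<^esub> b)"
      unfolding e using ab by simp
    have 2: "inv\<^bsub>T\<^esub> (K #>\<^bsub>F\<^esub> (a - b)) = inv\<^bsub>T\<^esub> (K #>\<^bsub>F\<^esub> a) \<otimes>\<^bsub>T\<^esub> (K #>\<^bsub>F\<^esub> b)"
      unfolding 1 using ab by (simp add: T.inv_mult)
    show ?case
      unfolding 2 unfolding 1 using diff ab by (auto intro!: P_add)
  next
    case (one s)
    then obtain x y where s: "s = (x, y)" "x \<in> carrier M" "y \<in> carrier N" by auto
    then show ?case
      using neg[of x y] P_pure[of x y] P_pure[of "\<ominus>\<^bsub>M\<^esub> x" y] by (simp add: p)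
  qed
  then show ?thesis by (simp add: u)
qed

lemma tensor_lift:
  assumes "comm_group G" "balanced R M N G h"
  shows lift_hom: "tensor_lift R M N G h \<in> hom T G"
    and lift_extensional: "tensor_lift R M N G h \<in> extensional (carrier T)"
    and lift_pure [simp]:
      "\<And>x y. x \<in> carrier M \<Longrightarrow> y \<in> carrier N \<Longrightarrow> tensor_lift R M N G h (pure x y) = h x y"
proof -
  have "module R M" "module R N" by unfold_locales
  from theI'[OF tensor_lift_ex1[OF this assms]]
  show "tensor_lift R M N G h \<in> hom T G"
    and "tensor_lift R M N G h \<in> extensional (carrier T)"
    and "\<And>x y. x \<in> carrier M \<Longrightarrow> y \<in> carrier N \<Longrightarrow> tensor_lift R M N G h (pure x y) = h x y"
    by (auto simp: tensor_lift_def)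
qed

lemma lift_closed:
  "\<lbrakk>comm_group G; balanced R M N G h; U \<in> carrier T\<rbrakk> \<Longrightarrow> tensor_lift R M N G h U \<in> carrier G"
  by (rule hom_in_carrier[OF lift_hom])

lemma lift_mult:
  "\<lbrakk>comm_group G; balanced R M N G h; U \<in> carrier T; V \<in> carrier T\<rbrakk>
    \<Longrightarrow> tensor_lift R M N G h (U \<otimes>\<^bsub>T\<^esub> V) = tensor_lift R M N G h U \<otimes>\<^bsub>G\<^esub> tensor_lift R M N G h V"
  by (rule hom_mult[OF lift_hom])

end

text \<open>
  A lift depends only on the carrier and the operation of its target, so the tensor group may be
  exchanged for the additive group of an algebra that is built on it.
\<close>

lemma tensor_lift_cong_group:
  assumes "carrier G = carrier G'" "\<And>x y. mult G x y = mult G' x y"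
  shows "tensor_lift R M N G h = tensor_lift R M N G' h"
  using assms by (simp add: tensor_lift_def hom_def)

lemma balancedI:
  assumes "\<And>x y. x \<in> carrier M \<Longrightarrow> y \<in> carrier N \<Longrightarrow> h x y \<in> carrier G"
    and "\<And>x x' y. x \<in> carrier M \<Longrightarrow> x' \<in> carrier M \<Longrightarrow> y \<in> carrier N \<Longrightarrow>
      h (x \<oplus>\<^bsub>M\<^esub> x') y = h x y \<otimes>\<^bsub>G\<^esub> h x' y"
    and "\<And>x y y'. x \<in> carrier M \<Longrightarrow> y \<in> carrier N \<Longrightarrow> y' \<in> carrier N \<Longrightarrow>
      h x (y \<oplus>\<^bsub>N\<^esub> y') = h x y \<otimes>\<^bsub>G\<^esub> h x y'"
    and "\<And>r x y. r \<in> carrier R \<Longrightarrow> x \<in> carrier M \<Longrightarrow> y \<in> carrier N \<Longrightarrow>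
      h (r \<odot>\<^bsub>M\<^esub> x) y = h x (r \<odot>\<^bsub>N\<^esub> y)"
  shows "balanced R M N G h"
  using assms by (auto simp: balanced_def)

text \<open>
  Maps out of iterated tensor products are lifts of lifts; this is what makes the outer map
  balanced.
\<close>

lemma balanced_lift:
  assumes "tensor_modules R M N" "tensor_modules R' M' N'" and G: "comm_group G"
    and inner: "\<And>x y. x \<in> carrier M \<Longrightarrow> y \<in> carrier N \<Longrightarrow> balanced R' M' N' G (h x y)"
    and outer: "\<And>x' y'. x' \<in> carrier M' \<Longrightarrow> y' \<in> carrier N' \<Longrightarrow> balanced R M N G (\<lambda>x y. h x y x' y')"
    and V: "V \<in> carrier (tensor_group R' M' N')"
  shows "balanced R M N G (\<lambda>x y. tensor_lift R' M' N' G (h x y) V)"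
proof -
  interpret tensor_modules R M N by fact
  interpret T': tensor_modules R' M' N' by fact
  interpret G: comm_group G by fact
  show ?thesis
    using V
  proof (induction rule: T'.tensor_induct)
    case (pure x' y')
    then show ?case
      using outer[OF pure] by (auto simp: balanced_def T'.lift_pure[OF G inner])
  next
    case (add U V)
    then show ?case
      by (intro balancedI)
        (auto simp: balanced_def T'.lift_mult[OF G inner] T'.lift_closed[OF G inner] G.m_ac)
  qed
qed

section \<open>Tensor products of algebras and change of base\<close>

abbreviation add_hom :: "('a, 'm) ring_scheme \<Rightarrow> ('b, 'n) ring_scheme \<Rightarrow> ('a \<Rightarrow> 'b) set"
  where "add_hom X Y \<equiv> hom (add_monoid X) (add_monoid Y)"

lemma add_hom_iff:
  "f \<in> add_hom X Y \<longleftrightarrow>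
    (\<forall>x \<in> carrier X. f x \<in> carrier Y) \<and>
    (\<forall>x \<in> carrier X. \<forall>y \<in> carrier X. f (x \<oplus>\<^bsub>X\<^esub> y) = f x \<oplus>\<^bsub>Y\<^esub> f y)"
  by (auto simp: hom_def)

lemma add_hom_zero:
  assumes "abelian_group X" "abelian_group Y" "f \<in> add_hom X Y"
  shows "f \<zero>\<^bsub>X\<^esub> = \<zero>\<^bsub>Y\<^esub>"
  using hom_one[OF assms(3)] assms(1,2) by (simp add: abelian_group.a_group)

lemma add_hom_a_inv:
  assumes "abelian_group X" "abelian_group Y" "f \<in> add_hom X Y" "x \<in> carrier X"
  shows "f (\<ominus>\<^bsub>X\<^esub> x) = \<ominus>\<^bsub>Y\<^esub> f x"
proof -
  interpret X: abelian_group X by fact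
  interpret Y: abelian_group Y by fact
  have "f (\<ominus>\<^bsub>X\<^esub> x) \<oplus>\<^bsub>Y\<^esub> f x = \<zero>\<^bsub>Y\<^esub>"
    using assms(3,4) add_hom_zero[OF assms(1-3)] by (metis X.a_inv_closed X.l_neg add_hom_iff)
  then show ?thesis
    using assms(3,4) by (metis X.a_inv_closed Y.minus_equality add_hom_iff)
qed

text \<open>
  Only the behaviour on the carrier matters, so neither notion requires extensionality.  Functionals
  are kept apart from linear maps because the ring \<open>R\<close> carries no scalar multiplication of its own.
\<close>

definition linear_maps ::
  "('r, 'p) ring_scheme \<Rightarrow> ('r, 'a, 'm) module_scheme \<Rightarrow> ('r, 'b, 'n) module_scheme \<Rightarrow> ('a \<Rightarrow> 'b) set"
  where "linear_maps R M N =
    {f \<in> add_hom M N. \<forall>r \<in> carrier R. \<forall>x \<in> carrier M. f (r \<odot>\<^bsub>M\<^esub> x) = r \<odot>\<^bsub>N\<^esub> f x}"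

definition functionals ::
  "('r, 'p) ring_scheme \<Rightarrow> ('r, 'a, 'm) module_scheme \<Rightarrow> ('a \<Rightarrow> 'r) set"
  where "functionals R M =
    {f \<in> add_hom M R. \<forall>r \<in> carrier R. \<forall>x \<in> carrier M. f (r \<odot>\<^bsub>M\<^esub> x) = r \<otimes>\<^bsub>R\<^esub> f x}"

lemma linear_mapsD:
  assumes "f \<in> linear_maps R M N"
  shows linear_maps_closed: "\<And>x. x \<in> carrier M \<Longrightarrow> f x \<in> carrier N"
    and linear_maps_add: "\<And>x y. x \<in> carrier M \<Longrightarrow> y \<in> carrier M \<Longrightarrow> f (x \<oplus>\<^bsub>M\<^esub> y) = f x \<oplus>\<^bsub>N\<^esub> f y"
    and linear_maps_smult: "\<And>r x. r \<in> carrier R \<Longrightarrow> x \<in> carrier M \<Longrightarrow> f (r \<odot>\<^bsub>M\<^esub> x) = r \<odot>\<^bsub>N\<^esub> f x"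
    and linear_maps_add_hom: "f \<in> add_hom M N"
  using assms by (auto simp: linear_maps_def add_hom_iff)

lemma functionalsD:
  assumes "f \<in> functionals R M"
  shows functionals_closed: "\<And>x. x \<in> carrier M \<Longrightarrow> f x \<in> carrier R"
    and functionals_add: "\<And>x y. x \<in> carrier M \<Longrightarrow> y \<in> carrier M \<Longrightarrow> f (x \<oplus>\<^bsub>M\<^esub> y) = f x \<oplus>\<^bsub>R\<^esub> f y"
    and functionals_smult: "\<And>r x. r \<in> carrier R \<Longrightarrow> x \<in> carrier M \<Longrightarrow> f (r \<odot>\<^bsub>M\<^esub> x) = r \<otimes>\<^bsub>R\<^esub> f x"
    and functionals_add_hom: "f \<in> add_hom M R"
  using assms by (auto simp: functionals_def add_hom_iff)

lemma tensor_map_props: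
  assumes "tensor_modules R M N" "tensor_modules R M' N'"
    and f: "f \<in> linear_maps R M M'" and g: "g \<in> linear_maps R N N'"
  shows tensor_map_hom: "tensor_map R M N M' N' f g \<in> hom (tensor_group R M N) (tensor_group R M' N')"
    and tensor_map_pure: "\<And>x y. x \<in> carrier M \<Longrightarrow> y \<in> carrier N \<Longrightarrow>
      tensor_map R M N M' N' f g (pure_tensor R M N x y) = pure_tensor R M' N' (f x) (g y)"
proof -
  interpret T: tensor_modules R M N by fact
  interpret T': tensor_modules R M' N' by fact
  note fs = linear_mapsD(1-3)[OF f] and gs = linear_mapsD(1-3)[OF g]
  have bal: "balanced R M N (tensor_group R M' N') (\<lambda>x y. pure_tensor R M' N' (f x) (g y))"
    by (intro balancedI)
      (simp_all add: fs gs T'.pure_add_left T'.pure_add_right T'.pure_balanced)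
  show "tensor_map R M N M' N' f g \<in> hom (tensor_group R M N) (tensor_group R M' N')"
    unfolding tensor_map_def by (rule T.lift_hom[OF T'.tensor_comm_group bal])
  show "tensor_map R M N M' N' f g (pure_tensor R M N x y) = pure_tensor R M' N' (f x) (g y)"
    if "x \<in> carrier M" "y \<in> carrier N" for x y
    unfolding tensor_map_def by (rule T.lift_pure[OF T'.tensor_comm_group bal that])
qed

lemma abelian_group_comm_group: "abelian_group X \<Longrightarrow> comm_group (add_monoid X)"
  by (rule abelian_group.a_comm_group)

lemma (in tensor_modules) abelian_group_of_tensor:
  assumes "carrier X = carrier T" "zero X = \<one>\<^bsub>T\<^esub>" "\<And>U V. add X U V = U \<otimes>\<^bsub>T\<^esub> V"
  shows "abelian_group X"
  by (rule abelian_groupI) (use T.l_inv_ex in \<open>auto simp: assms T.m_ac\<close>)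

locale tensor_algebras = A: unital_algebra R A + B: unital_algebra R B for R and A and B
begin

sublocale tensor_modules R A B by unfold_locales

abbreviation AB where "AB \<equiv> tensor_algebra R A B"

lemma AB_simps [simp]:
  "carrier AB = carrier T" "add AB = (\<lambda>U V. U \<otimes>\<^bsub>T\<^esub> V)" "zero AB = \<one>\<^bsub>T\<^esub>"
  "one AB = pure \<one>\<^bsub>A\<^esub> \<one>\<^bsub>B\<^esub>"
  by (simp_all add: tensor_algebra_def)

lemma balanced_mult_pure:
  assumes "x \<in> carrier A" "y \<in> carrier B"
  shows "balanced R A B T (\<lambda>x' y'. pure (x \<otimes>\<^bsub>A\<^esub> x') (y \<otimes>\<^bsub>B\<^esub> y'))"
  using assms
  by (intro balancedI)
    (auto simp: A.mult_closed B.mult_closed A.mult_add_right B.mult_add_right A.mult_smult_right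
      B.mult_smult_right pure_add_left pure_add_right pure_balanced)

lemma balanced_pure_mult:
  assumes "x' \<in> carrier A" "y' \<in> carrier B"
  shows "balanced R A B T (\<lambda>x y. pure (x \<otimes>\<^bsub>A\<^esub> x') (y \<otimes>\<^bsub>B\<^esub> y'))"
  using assms
  by (intro balancedI)
    (auto simp: A.mult_closed B.mult_closed A.mult_add_left B.mult_add_left A.mult_smult_left
      B.mult_smult_left pure_add_left pure_add_right pure_balanced)

lemma balanced_mult:
  "V \<in> carrier T \<Longrightarrow>
    balanced R A B T (\<lambda>x y. tensor_lift R A B T (\<lambda>x' y'. pure (x \<otimes>\<^bsub>A\<^esub> x') (y \<otimes>\<^bsub>B\<^esub> y')) V)"
  by (intro balanced_lift balanced_mult_pure balanced_pure_mult tensor_comm_group tensor_modules_axioms)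

lemma mult_AB: "U \<otimes>\<^bsub>AB\<^esub> V =
    tensor_lift R A B T
      (\<lambda>x y. tensor_lift R A B T (\<lambda>x' y'. pure (x \<otimes>\<^bsub>A\<^esub> x') (y \<otimes>\<^bsub>B\<^esub> y')) V) U"
  by (simp add: tensor_algebra_def tensor_mult_def)

lemma mult_pure [simp]:
  "\<lbrakk>x \<in> carrier A; y \<in> carrier B; x' \<in> carrier A; y' \<in> carrier B\<rbrakk>
    \<Longrightarrow> pure x y \<otimes>\<^bsub>AB\<^esub> pure x' y' = pure (x \<otimes>\<^bsub>A\<^esub> x') (y \<otimes>\<^bsub>B\<^esub> y')"
  by (simp add: mult_AB lift_pure[OF tensor_comm_group balanced_mult]
      lift_pure[OF tensor_comm_group balanced_mult_pure])

lemma mult_AB_closed [simp]: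
  "U \<in> carrier T \<Longrightarrow> V \<in> carrier T \<Longrightarrow> U \<otimes>\<^bsub>AB\<^esub> V \<in> carrier T"
  by (simp add: mult_AB lift_closed[OF tensor_comm_group balanced_mult])

lemma mult_AB_add_left:
  "\<lbrakk>U \<in> carrier T; U' \<in> carrier T; V \<in> carrier T\<rbrakk>
    \<Longrightarrow> (U \<otimes>\<^bsub>T\<^esub> U') \<otimes>\<^bsub>AB\<^esub> V = (U \<otimes>\<^bsub>AB\<^esub> V) \<otimes>\<^bsub>T\<^esub> (U' \<otimes>\<^bsub>AB\<^esub> V)"
  by (simp add: mult_AB lift_mult[OF tensor_comm_group balanced_mult])

lemma mult_AB_add_right:
  assumes "U \<in> carrier T" "V \<in> carrier T" "V' \<in> carrier T"
  shows "U \<otimes>\<^bsub>AB\<^esub> (V \<otimes>\<^bsub>T\<^esub> V') = (U \<otimes>\<^bsub>AB\<^esub> V) \<otimes>\<^bsub>T\<^esub> (U \<otimes>\<^bsub>AB\<^esub> V')"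
  using assms(1)
proof (induction rule: tensor_induct)
  case (pure x y)
  then show ?case
    using assms
    by (simp add: mult_AB lift_pure[OF tensor_comm_group balanced_mult]
        lift_mult[OF tensor_comm_group balanced_mult_pure])
next
  case (add U U')
  then show ?case using assms by (simp add: mult_AB_add_left T.m_ac)
qed

lemma balanced_smult:
  "r \<in> carrier R \<Longrightarrow> balanced R A B T (\<lambda>x y. pure (r \<odot>\<^bsub>A\<^esub> x) y)"
  by (intro balancedI)
    (auto simp: A.smult_r_distr pure_add_left pure_add_right pure_balanced B.smult_assoc1[symmetric] A.m_comm)

lemma smult_AB: "r \<odot>\<^bsub>AB\<^esub> U = tensor_lift R A B T (\<lambda>x y. pure (r \<odot>\<^bsub>A\<^esub> x) y) U"
  by (simp add: tensor_algebra_def)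

lemma smult_pure [simp]:
  "\<lbrakk>r \<in> carrier R; x \<in> carrier A; y \<in> carrier B\<rbrakk> \<Longrightarrow> r \<odot>\<^bsub>AB\<^esub> pure x y = pure (r \<odot>\<^bsub>A\<^esub> x) y"
  by (simp add: smult_AB lift_pure[OF tensor_comm_group balanced_smult])

lemma smult_AB_closed [simp]:
  "r \<in> carrier R \<Longrightarrow> U \<in> carrier T \<Longrightarrow> r \<odot>\<^bsub>AB\<^esub> U \<in> carrier T"
  by (simp add: smult_AB lift_closed[OF tensor_comm_group balanced_smult])

lemma smult_AB_add:
  "\<lbrakk>r \<in> carrier R; U \<in> carrier T; V \<in> carrier T\<rbrakk>
    \<Longrightarrow> r \<odot>\<^bsub>AB\<^esub> (U \<otimes>\<^bsub>T\<^esub> V) = (r \<odot>\<^bsub>AB\<^esub> U) \<otimes>\<^bsub>T\<^esub> (r \<odot>\<^bsub>AB\<^esub> V)"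
  by (simp add: smult_AB lift_mult[OF tensor_comm_group balanced_smult])

lemma module_AB: "module R AB"
proof (rule moduleI)
  show "cring R" by (rule A.is_cring)
  show "abelian_group AB" by (rule abelian_group_of_tensor) simp_all
  fix r s U assume rs: "r \<in> carrier R" "s \<in> carrier R" and "U \<in> carrier AB"
  then have U: "U \<in> carrier T" by simp
  show "(r \<oplus>\<^bsub>R\<^esub> s) \<odot>\<^bsub>AB\<^esub> U = r \<odot>\<^bsub>AB\<^esub> U \<oplus>\<^bsub>AB\<^esub> s \<odot>\<^bsub>AB\<^esub> U"
    using U by (induction rule: tensor_induct)
      (use rs in \<open>auto simp: A.smult_l_distr pure_add_left smult_AB_add T.m_ac\<close>)
  show "(r \<otimes>\<^bsub>R\<^esub> s) \<odot>\<^bsub>AB\<^esub> U = r \<odot>\<^bsub>AB\<^esub> (s \<odot>\<^bsub>AB\<^esub> U)"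
    using U by (induction rule: tensor_induct) (use rs in \<open>auto simp: A.smult_assoc1 smult_AB_add\<close>)
next
  fix U assume "U \<in> carrier AB"
  then have "U \<in> carrier T" by simp
  then show "\<one>\<^bsub>R\<^esub> \<odot>\<^bsub>AB\<^esub> U = U"
    by (induction rule: tensor_induct) (auto simp: smult_AB_add)
qed (auto simp: smult_AB_add)

lemma unital_algebra_AB: "unital_algebra R AB"
proof (intro unital_algebra.intro module_AB unital_algebra_axioms.intro)
  fix U assume "U \<in> carrier AB"
  then have U: "U \<in> carrier T" by simp
  show "\<one>\<^bsub>AB\<^esub> \<otimes>\<^bsub>AB\<^esub> U = U"
    using U by (induction rule: tensor_induct)
      (auto simp: mult_AB_add_right A.unit_left B.unit_left A.unit_closed B.unit_closed)
  show "U \<otimes>\<^bsub>AB\<^esub> \<one>\<^bsub>AB\<^esub> = U"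
    using U by (induction rule: tensor_induct)
      (auto simp: mult_AB_add_left A.unit_right B.unit_right A.unit_closed B.unit_closed)
next
  fix r U V assume r: "r \<in> carrier R" and "U \<in> carrier AB" "V \<in> carrier AB"
  then have U: "U \<in> carrier T" and V: "V \<in> carrier T" by simp_all
  show "(r \<odot>\<^bsub>AB\<^esub> U) \<otimes>\<^bsub>AB\<^esub> V = r \<odot>\<^bsub>AB\<^esub> (U \<otimes>\<^bsub>AB\<^esub> V)"
    using U
  proof (induction rule: tensor_induct)
    case (pure x y)
    show ?case using V by (induction rule: tensor_induct)
        (use r pure in \<open>auto simp: mult_AB_add_right smult_AB_add A.mult_smult_left A.mult_closed B.mult_closed\<close>)
  qed (use r V in \<open>auto simp: mult_AB_add_left smult_AB_add\<close>)
  show "U \<otimes>\<^bsub>AB\<^esub> (r \<odot>\<^bsub>AB\<^esub> V) = r \<odot>\<^bsub>AB\<^esub> (U \<otimes>\<^bsub>AB\<^esub> V)"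
    using U
  proof (induction rule: tensor_induct)
    case (pure x y)
    show ?case using V by (induction rule: tensor_induct)
        (use r pure in \<open>auto simp: mult_AB_add_right smult_AB_add A.mult_smult_right A.mult_closed B.mult_closed\<close>)
  qed (use r V in \<open>auto simp: mult_AB_add_left smult_AB_add\<close>)
qed (auto simp: mult_AB_add_left mult_AB_add_right A.unit_closed B.unit_closed)

end

lemma algebra_imp_unital_algebra:
  assumes "algebra k R" shows "unital_algebra k R"
proof -
  interpret algebra k R by fact
  have smult_assoc2_right: "x \<otimes>\<^bsub>R\<^esub> (r \<odot>\<^bsub>R\<^esub> y) = r \<odot>\<^bsub>R\<^esub> (x \<otimes>\<^bsub>R\<^esub> y)"
    if "r \<in> carrier k" "x \<in> carrier R" "y \<in> carrier R" for r x y
    using that smult_assoc2[of r y x] m_comm[of x "r \<odot>\<^bsub>R\<^esub> y"] m_comm[of x y] smult_closed[of r y] by simp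
  show ?thesis
    by unfold_locales
      (auto simp: smult_assoc2 smult_assoc2_right l_distr r_distr)
qed

locale scalar_extension = A: unital_algebra k A + S: algebra k R for k and A and R
begin

sublocale tensor_algebras k A R
  using A.unital_algebra_axioms algebra_imp_unital_algebra[OF S.algebra_axioms]
  by (rule tensor_algebras.intro)

abbreviation AR where "AR \<equiv> base_change k A R"

lemma AR_simps:
  "carrier AR = carrier T" "add AR = (\<lambda>U V. U \<otimes>\<^bsub>T\<^esub> V)" "zero AR = \<one>\<^bsub>T\<^esub>"
  "one AR = pure \<one>\<^bsub>A\<^esub> \<one>\<^bsub>R\<^esub>" "mult AR = mult AB"
  by (simp_all add: tensor_algebra_def base_change_def)

lemma balanced_scale:
  "r \<in> carrier R \<Longrightarrow> balanced k A R T (\<lambda>x s. pure x (r \<otimes>\<^bsub>R\<^esub> s))"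
  by (intro balancedI)
    (auto simp: S.r_distr pure_add_left pure_add_right pure_balanced B.mult_smult_right)

lemma smult_AR: "r \<odot>\<^bsub>AR\<^esub> U = tensor_lift k A R T (\<lambda>x s. pure x (r \<otimes>\<^bsub>R\<^esub> s)) U"
  by (simp add: base_change_def)

lemma ext_smult_pure [simp]:
  "\<lbrakk>r \<in> carrier R; x \<in> carrier A; s \<in> carrier R\<rbrakk> \<Longrightarrow> r \<odot>\<^bsub>AR\<^esub> pure x s = pure x (r \<otimes>\<^bsub>R\<^esub> s)"
  by (simp add: smult_AR lift_pure[OF tensor_comm_group balanced_scale])

lemma unital_algebra_AR: "unital_algebra R AR"
proof -
  have c: "r \<odot>\<^bsub>AR\<^esub> U \<in> carrier T" if "r \<in> carrier R" "U \<in> carrier T" for r U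
    using that by (simp add: smult_AR lift_closed[OF tensor_comm_group balanced_scale])
  have a: "r \<odot>\<^bsub>AR\<^esub> (U \<otimes>\<^bsub>T\<^esub> V) = (r \<odot>\<^bsub>AR\<^esub> U) \<otimes>\<^bsub>T\<^esub> (r \<odot>\<^bsub>AR\<^esub> V)"
    if "r \<in> carrier R" "U \<in> carrier T" "V \<in> carrier T" for r U V
    using that by (simp add: smult_AR lift_mult[OF tensor_comm_group balanced_scale])
  interpret X: unital_algebra k AB by (rule unital_algebra_AB)
  have mod: "module R AR"
  proof (rule moduleI)
    show "cring R" ..
    show "abelian_group AR" by (rule abelian_group_of_tensor) (simp_all add: AR_simps)
    fix r s U assume rs: "r \<in> carrier R" "s \<in> carrier R" and "U \<in> carrier AR"
    then have U: "U \<in> carrier T" by (simp add: AR_simps)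
    show "(r \<oplus>\<^bsub>R\<^esub> s) \<odot>\<^bsub>AR\<^esub> U = r \<odot>\<^bsub>AR\<^esub> U \<oplus>\<^bsub>AR\<^esub> s \<odot>\<^bsub>AR\<^esub> U"
      using U by (induction rule: tensor_induct)
        (use rs in \<open>auto simp: AR_simps S.l_distr pure_add_right a c T.m_ac\<close>)
    show "(r \<otimes>\<^bsub>R\<^esub> s) \<odot>\<^bsub>AR\<^esub> U = r \<odot>\<^bsub>AR\<^esub> (s \<odot>\<^bsub>AR\<^esub> U)"
      using U by (induction rule: tensor_induct) (use rs in \<open>auto simp: S.m_assoc a c\<close>)
  next
    fix U assume "U \<in> carrier AR"
    then have "U \<in> carrier T" by (simp add: AR_simps)
    then show "\<one>\<^bsub>R\<^esub> \<odot>\<^bsub>AR\<^esub> U = U"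
      by (induction rule: tensor_induct) (auto simp: a)
  qed (auto simp: AR_simps a c)
  show ?thesis
  proof (intro unital_algebra.intro mod unital_algebra_axioms.intro)
    fix r U V assume r: "r \<in> carrier R" and "U \<in> carrier AR" "V \<in> carrier AR"
    then have U: "U \<in> carrier T" and V: "V \<in> carrier T" by (simp_all add: AR_simps)
    show "(r \<odot>\<^bsub>AR\<^esub> U) \<otimes>\<^bsub>AR\<^esub> V = r \<odot>\<^bsub>AR\<^esub> (U \<otimes>\<^bsub>AR\<^esub> V)"
      using U
    proof (induction rule: tensor_induct)
      case (pure x y)
      show ?case using V by (induction rule: tensor_induct)
          (use r pure in \<open>auto simp: AR_simps mult_AB_add_right a c S.m_assoc A.mult_closed\<close>)
    qed (use r V in \<open>auto simp: AR_simps mult_AB_add_left a c\<close>)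
    show "U \<otimes>\<^bsub>AR\<^esub> (r \<odot>\<^bsub>AR\<^esub> V) = r \<odot>\<^bsub>AR\<^esub> (U \<otimes>\<^bsub>AR\<^esub> V)"
      using U
    proof (induction rule: tensor_induct)
      case (pure x y)
      show ?case using V by (induction rule: tensor_induct)
          (use r pure in \<open>auto simp: AR_simps mult_AB_add_right a c S.m_lcomm A.mult_closed\<close>)
    qed (use r V in \<open>auto simp: AR_simps mult_AB_add_left a c\<close>)
  qed (use X.unit_left X.unit_right X.unit_closed in
      \<open>auto simp: AR_simps mult_AB_add_left mult_AB_add_right\<close>)
qed

sublocale AR: unital_algebra R AR
  by (rule unital_algebra_AR)

lemma ext_pure_closed [simp, intro]:
  "x \<in> carrier A \<Longrightarrow> r \<in> carrier R \<Longrightarrow> pure x r \<in> carrier AR"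
  by (simp add: AR_simps)

lemma ext_induct [consumes 1, case_names pure add]:
  assumes "U \<in> carrier AR"
    and "\<And>x r. x \<in> carrier A \<Longrightarrow> r \<in> carrier R \<Longrightarrow> P (pure x r)"
    and "\<And>U V. U \<in> carrier AR \<Longrightarrow> V \<in> carrier AR \<Longrightarrow> P U \<Longrightarrow> P V \<Longrightarrow> P (U \<oplus>\<^bsub>AR\<^esub> V)"
  shows "P U"
  using assms tensor_induct[of U P] by (simp add: AR_simps)

lemma ext_pure_add_left:
    "\<lbrakk>x \<in> carrier A; x' \<in> carrier A; r \<in> carrier R\<rbrakk>
      \<Longrightarrow> pure (x \<oplus>\<^bsub>A\<^esub> x') r = pure x r \<oplus>\<^bsub>AR\<^esub> pure x' r"
  and ext_pure_add_right:
    "\<lbrakk>x \<in> carrier A; r \<in> carrier R; r' \<in> carrier R\<rbrakk>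
      \<Longrightarrow> pure x (r \<oplus>\<^bsub>R\<^esub> r') = pure x r \<oplus>\<^bsub>AR\<^esub> pure x r'"
  by (simp_all add: AR_simps pure_add_left pure_add_right)

lemma ext_mult_pure [simp]:
  "\<lbrakk>x \<in> carrier A; r \<in> carrier R; x' \<in> carrier A; r' \<in> carrier R\<rbrakk>
    \<Longrightarrow> pure x r \<otimes>\<^bsub>AR\<^esub> pure x' r' = pure (x \<otimes>\<^bsub>A\<^esub> x') (r \<otimes>\<^bsub>R\<^esub> r')"
  by (simp add: AR_simps)

lemma ext_one: "\<one>\<^bsub>AR\<^esub> = pure \<one>\<^bsub>A\<^esub> \<one>\<^bsub>R\<^esub>"
  by (simp add: AR_simps)

lemma ext_lift:
  assumes "abelian_group G" "balanced k A R (add_monoid G) h"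
  shows ext_lift_hom: "tensor_lift k A R (add_monoid G) h \<in> add_hom AR G"
    and ext_lift_extensional: "tensor_lift k A R (add_monoid G) h \<in> extensional (carrier AR)"
    and ext_lift_pure: "\<And>x r. x \<in> carrier A \<Longrightarrow> r \<in> carrier R \<Longrightarrow>
      tensor_lift k A R (add_monoid G) h (pure x r) = h x r"
  using tensor_lift[OF abelian_group_comm_group[OF assms(1)] assms(2)]
  by (auto simp: hom_def AR_simps)

end

section \<open>The tensor product of the extended algebras\<close>

locale double_extension = A: unital_algebra k A + B: unital_algebra k B + S: algebra k R
  for k and A and B and R
begin

sublocale AR: scalar_extension k A R
  by (intro scalar_extension.intro A.unital_algebra_axioms S.algebra_axioms)

sublocale BR: scalar_extension k B R
  by (intro scalar_extension.intro B.unital_algebra_axioms S.algebra_axioms)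

sublocale AB: tensor_algebras k A B
  by (intro tensor_algebras.intro A.unital_algebra_axioms B.unital_algebra_axioms)

sublocale W: scalar_extension k "tensor_algebra k A B" R
  by (intro scalar_extension.intro AB.unital_algebra_AB S.algebra_axioms)

sublocale ARBR: tensor_modules R "base_change k A R" "base_change k B R"
  by (intro tensor_modules.intro AR.AR.module_axioms BR.AR.module_axioms)

abbreviation A\<^sub>R where "A\<^sub>R \<equiv> base_change k A R"
abbreviation B\<^sub>R where "B\<^sub>R \<equiv> base_change k B R"
abbreviation W where "W \<equiv> base_change k (tensor_algebra k A B) R"
abbreviation TW where "TW \<equiv> tensor_group k (tensor_algebra k A B) R"
abbreviation T\<^sub>R where "T\<^sub>R \<equiv> tensor_group R (base_change k A R) (base_change k B R)"
abbreviation pure\<^sub>R where "pure\<^sub>R \<equiv> pure_tensor R (base_change k A R) (base_change k B R)"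
abbreviation triple where
  "triple x y r \<equiv> pure_tensor k (tensor_algebra k A B) R (pure_tensor k A B x y) r"

text \<open>
  The bilinear map that makes the extension of \<open>A \<otimes> B\<close> the tensor product over \<open>R\<close> of the extensions of
  \<open>A\<close> and \<open>B\<close>: it sends \<open>(x \<otimes> r, y \<otimes> s)\<close> to \<open>(x \<otimes> y) \<otimes> r s\<close>.
\<close>

definition ext_prod where
  "ext_prod U V = tensor_lift k A R TW
     (\<lambda>x r. tensor_lift k B R TW (\<lambda>y s. triple x y (r \<otimes>\<^bsub>R\<^esub> s)) V) U"

lemma triple_closed:
  "\<lbrakk>x \<in> carrier A; y \<in> carrier B; r \<in> carrier R\<rbrakk> \<Longrightarrow> triple x y r \<in> carrier TW"
  by (intro W.pure_closed) auto

lemma triple_add_left: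
    "\<lbrakk>x \<in> carrier A; x' \<in> carrier A; y \<in> carrier B; r \<in> carrier R\<rbrakk>
      \<Longrightarrow> triple (x \<oplus>\<^bsub>A\<^esub> x') y r = triple x y r \<otimes>\<^bsub>TW\<^esub> triple x' y r"
  and triple_add_right:
    "\<lbrakk>x \<in> carrier A; y \<in> carrier B; y' \<in> carrier B; r \<in> carrier R\<rbrakk>
      \<Longrightarrow> triple x (y \<oplus>\<^bsub>B\<^esub> y') r = triple x y r \<otimes>\<^bsub>TW\<^esub> triple x y' r"
  using W.pure_add_left[of "AB.pure x y" "AB.pure x' y" r]
    W.pure_add_left[of "AB.pure x y" "AB.pure x y'" r]
  by (simp_all add: AB.pure_add_left AB.pure_add_right)

lemma triple_smult:
  "\<lbrakk>c \<in> carrier k; x \<in> carrier A; y \<in> carrier B; r \<in> carrier R\<rbrakk>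
    \<Longrightarrow> triple (c \<odot>\<^bsub>A\<^esub> x) y r = triple x y (c \<odot>\<^bsub>R\<^esub> r)"
  using W.pure_balanced[of c "AB.pure x y" r] by simp

lemma balanced_triple_B:
  "\<lbrakk>x \<in> carrier A; r \<in> carrier R\<rbrakk> \<Longrightarrow> balanced k B R TW (\<lambda>y s. triple x y (r \<otimes>\<^bsub>R\<^esub> s))"
  by (intro balancedI)
    (simp_all add: triple_closed triple_add_right W.pure_add_right S.r_distr
      AR.B.mult_smult_right AB.pure_balanced[symmetric] triple_smult)

lemma balanced_triple_A:
  "\<lbrakk>y \<in> carrier B; s \<in> carrier R\<rbrakk> \<Longrightarrow> balanced k A R TW (\<lambda>x r. triple x y (r \<otimes>\<^bsub>R\<^esub> s))"
  by (intro balancedI)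
    (simp_all add: triple_closed triple_add_left W.pure_add_right S.l_distr
      AR.B.mult_smult_left triple_smult)

lemma balanced_ext_prod_A:
  "V \<in> carrier BR.T \<Longrightarrow>
    balanced k A R TW (\<lambda>x r. tensor_lift k B R TW (\<lambda>y s. triple x y (r \<otimes>\<^bsub>R\<^esub> s)) V)"
  by (intro balanced_lift balanced_triple_A balanced_triple_B W.tensor_comm_group
      AR.tensor_modules_axioms BR.tensor_modules_axioms)

lemma ext_prod_pure [simp]:
  "\<lbrakk>x \<in> carrier A; r \<in> carrier R; y \<in> carrier B; s \<in> carrier R\<rbrakk>
    \<Longrightarrow> ext_prod (AR.pure x r) (BR.pure y s) = triple x y (r \<otimes>\<^bsub>R\<^esub> s)"
  unfolding ext_prod_def
  by (simp add: AR.lift_pure[OF W.tensor_comm_group balanced_ext_prod_A]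
      BR.lift_pure[OF W.tensor_comm_group balanced_triple_B])

lemma ext_prod_closed [simp, intro]:
  "\<lbrakk>U \<in> carrier A\<^sub>R; V \<in> carrier B\<^sub>R\<rbrakk> \<Longrightarrow> ext_prod U V \<in> carrier W"
  unfolding ext_prod_def AR.AR_simps BR.AR_simps W.AR_simps
  by (intro AR.lift_closed W.tensor_comm_group balanced_ext_prod_A)

lemma ext_prod_add_left:
  "\<lbrakk>U \<in> carrier A\<^sub>R; U' \<in> carrier A\<^sub>R; V \<in> carrier B\<^sub>R\<rbrakk>
    \<Longrightarrow> ext_prod (U \<oplus>\<^bsub>A\<^sub>R\<^esub> U') V = ext_prod U V \<oplus>\<^bsub>W\<^esub> ext_prod U' V"
  unfolding ext_prod_def AR.AR_simps BR.AR_simps W.AR_simps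
  by (intro AR.lift_mult W.tensor_comm_group balanced_ext_prod_A)

lemma ext_prod_add_right:
  assumes "U \<in> carrier A\<^sub>R" "V \<in> carrier B\<^sub>R" "V' \<in> carrier B\<^sub>R"
  shows "ext_prod U (V \<oplus>\<^bsub>B\<^sub>R\<^esub> V') = ext_prod U V \<oplus>\<^bsub>W\<^esub> ext_prod U V'"
  using assms(1)
proof (induction rule: AR.ext_induct)
  case (pure x r)
  have "ext_prod (AR.pure x r) Z = tensor_lift k B R TW (\<lambda>y s. triple x y (r \<otimes>\<^bsub>R\<^esub> s)) Z"
    if "Z \<in> carrier B\<^sub>R" for Z
    using that pure unfolding ext_prod_def
    by (simp add: AR.lift_pure[OF W.tensor_comm_group balanced_ext_prod_A] BR.AR_simps)
  then show ?case
    using pure assms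
    by (simp add: BR.lift_mult[OF W.tensor_comm_group balanced_triple_B] BR.AR_simps W.AR_simps)
next
  case (add U U')
  then show ?case using assms by (simp add: ext_prod_add_left W.AR.a_ac)
qed

lemma ext_prod_smult_left:
  assumes "t \<in> carrier R" "U \<in> carrier A\<^sub>R" "V \<in> carrier B\<^sub>R"
  shows "ext_prod (t \<odot>\<^bsub>A\<^sub>R\<^esub> U) V = t \<odot>\<^bsub>W\<^esub> ext_prod U V"
  using assms(2)
proof (induction rule: AR.ext_induct)
  case (pure x r)
  show ?case using assms(3)
    by (induction rule: BR.ext_induct)
      (use pure assms(1) in \<open>auto simp: ext_prod_add_right W.AR.smult_r_distr S.m_assoc\<close>)
next
  case (add U U')
  then show ?case
    using assms by (simp add: ext_prod_add_left W.AR.smult_r_distr AR.AR.smult_r_distr)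
qed

lemma ext_prod_smult_right:
  assumes "t \<in> carrier R" "U \<in> carrier A\<^sub>R" "V \<in> carrier B\<^sub>R"
  shows "ext_prod U (t \<odot>\<^bsub>B\<^sub>R\<^esub> V) = t \<odot>\<^bsub>W\<^esub> ext_prod U V"
  using assms(2)
proof (induction rule: AR.ext_induct)
  case (pure x r)
  show ?case using assms(3)
    by (induction rule: BR.ext_induct)
      (use pure assms(1) in \<open>auto simp: ext_prod_add_right W.AR.smult_r_distr BR.AR.smult_r_distr S.m_lcomm\<close>)
next
  case (add U U')
  then show ?case
    using assms by (simp add: ext_prod_add_left W.AR.smult_r_distr)
qed

lemma ext_prod_mult:
  assumes "U \<in> carrier A\<^sub>R" "U' \<in> carrier A\<^sub>R" "V \<in> carrier B\<^sub>R" "V' \<in> carrier B\<^sub>R"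
  shows "ext_prod U V \<otimes>\<^bsub>W\<^esub> ext_prod U' V' = ext_prod (U \<otimes>\<^bsub>A\<^sub>R\<^esub> U') (V \<otimes>\<^bsub>B\<^sub>R\<^esub> V')"
  using assms(1)
proof (induction rule: AR.ext_induct)
  case p1: (pure x r)
  show ?case using assms(2)
  proof (induction rule: AR.ext_induct)
    case p2: (pure x' r')
    show ?case using assms(3)
    proof (induction rule: BR.ext_induct)
      case p3: (pure y s)
      show ?case using assms(4)
      proof (induction rule: BR.ext_induct)
        case p4: (pure y' s')
        have "(r \<otimes>\<^bsub>R\<^esub> s) \<otimes>\<^bsub>R\<^esub> (r' \<otimes>\<^bsub>R\<^esub> s') = (r \<otimes>\<^bsub>R\<^esub> r') \<otimes>\<^bsub>R\<^esub> (s \<otimes>\<^bsub>R\<^esub> s')"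
          using p1 p2 p3 p4 by (simp add: S.m_ac)
        then show ?case
          using p1 p2 p3 p4 by (simp add: A.mult_closed B.mult_closed)
      next
        case (add V V')
        then show ?case
          using p1 p2 p3
          by (simp add: ext_prod_add_right W.AR.mult_add_right BR.AR.mult_add_right
              BR.AR.mult_closed A.mult_closed)
      qed
    next
      case (add V V')
      then show ?case
        using p1 p2 assms
        by (simp add: ext_prod_add_right W.AR.mult_add_left BR.AR.mult_add_left
            BR.AR.mult_closed A.mult_closed)
    qed
  next
    case (add U U')
    then show ?case
      using p1 assms
      by (simp add: ext_prod_add_left W.AR.mult_add_right AR.AR.mult_add_right
          AR.AR.mult_closed BR.AR.mult_closed)
  qed
next
  case (add U U')
  then show ?case
    using assms
    by (simp add: ext_prod_add_left W.AR.mult_add_left AR.AR.mult_add_left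
        AR.AR.mult_closed BR.AR.mult_closed)
qed

lemma ext_prod_one: "ext_prod \<one>\<^bsub>A\<^sub>R\<^esub> \<one>\<^bsub>B\<^sub>R\<^esub> = \<one>\<^bsub>W\<^esub>"
  by (simp add: AR.ext_one BR.ext_one W.ext_one A.unit_closed B.unit_closed)

lemma triple_induct [consumes 1, case_names triple add]:
  assumes "w \<in> carrier W"
    and P_triple: "\<And>x y r. x \<in> carrier A \<Longrightarrow> y \<in> carrier B \<Longrightarrow> r \<in> carrier R \<Longrightarrow> P (triple x y r)"
    and P_add: "\<And>w w'. w \<in> carrier W \<Longrightarrow> w' \<in> carrier W \<Longrightarrow> P w \<Longrightarrow> P w' \<Longrightarrow> P (w \<oplus>\<^bsub>W\<^esub> w')"
  shows "P w"
  using assms(1)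
proof (induction rule: W.ext_induct)
  case (pure Z r)
  then have "Z \<in> carrier AB.T" by simp
  then show ?case
  proof (induction rule: AB.tensor_induct)
    case (pure x y)
    then show ?case using P_triple \<open>r \<in> carrier R\<close> by simp
  next
    case (add Z Z')
    then show ?case
      using P_add[of "W.pure Z r" "W.pure Z' r"] W.ext_pure_add_left[of Z Z' r] \<open>r \<in> carrier R\<close>
      by simp
  qed
qed (rule P_add)

lemma ext_prod_induct [consumes 1, case_names prod add]:
  assumes "w \<in> carrier W"
    and P_prod: "\<And>U V. U \<in> carrier A\<^sub>R \<Longrightarrow> V \<in> carrier B\<^sub>R \<Longrightarrow> P (ext_prod U V)"
    and P_add: "\<And>w w'. w \<in> carrier W \<Longrightarrow> w' \<in> carrier W \<Longrightarrow> P w \<Longrightarrow> P w' \<Longrightarrow> P (w \<oplus>\<^bsub>W\<^esub> w')"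
  shows "P w"
  using assms(1)
proof (induction rule: triple_induct)
  case (triple x y r)
  then show ?case using P_prod[of "AR.pure x \<one>\<^bsub>R\<^esub>" "BR.pure y r"] by simp
qed (rule P_add)

lemma balanced_ext_prod: "balanced R A\<^sub>R B\<^sub>R (add_monoid W) ext_prod"
  by (intro balancedI)
    (auto simp: ext_prod_add_left ext_prod_add_right ext_prod_smult_left ext_prod_smult_right)

lemma tensor_base_change_eq:
  "tensor_base_change k A B R = tensor_lift R A\<^sub>R B\<^sub>R (add_monoid W) ext_prod"
proof -
  have "tensor_base_change k A B R = tensor_lift R A\<^sub>R B\<^sub>R TW (\<lambda>U V. ext_prod U V)"
    by (simp add: tensor_base_change_def ext_prod_def Let_def)
  also have "\<dots> = tensor_lift R A\<^sub>R B\<^sub>R (add_monoid W) ext_prod"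
    by (rule tensor_lift_cong_group) (simp_all add: W.AR_simps)
  finally show ?thesis .
qed

lemma W_comm_group: "comm_group (add_monoid W)"
  by (intro abelian_group_comm_group W.AR.abelian_group_axioms)

lemma tensor_base_change_pure:
  "\<lbrakk>U \<in> carrier A\<^sub>R; V \<in> carrier B\<^sub>R\<rbrakk>
    \<Longrightarrow> tensor_base_change k A B R (pure\<^sub>R U V) = ext_prod U V"
  by (simp add: tensor_base_change_eq ARBR.lift_pure[OF W_comm_group balanced_ext_prod])

lemma tensor_base_change_hom: "tensor_base_change k A B R \<in> hom T\<^sub>R (add_monoid W)"
  unfolding tensor_base_change_eq by (rule ARBR.lift_hom[OF W_comm_group balanced_ext_prod])

text \<open>
  The inverse sends \<open>(x \<otimes> y) \<otimes> r\<close> to \<open>(x \<otimes> 1) \<otimes> (y \<otimes> r)\<close>, since over \<open>R\<close> the scalar in the first factor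
  of \<open>(x \<otimes> r) \<otimes> (y \<otimes> s)\<close> can be moved to the second.
\<close>

lemma tensor_base_change_inverse:
  obtains \<Theta> where "\<Theta> \<in> hom (add_monoid W) T\<^sub>R"
    "\<And>U V. U \<in> carrier A\<^sub>R \<Longrightarrow> V \<in> carrier B\<^sub>R \<Longrightarrow> \<Theta> (ext_prod U V) = pure\<^sub>R U V"
proof -
  define h where "h x y r = pure\<^sub>R (AR.pure x \<one>\<^bsub>R\<^esub>) (BR.pure y r)" for x y r
  have h_closed: "h x y r \<in> carrier T\<^sub>R" if "x \<in> carrier A" "y \<in> carrier B" "r \<in> carrier R" for x y r
    using that by (simp add: h_def)
  have h_x: "h (x \<oplus>\<^bsub>A\<^esub> x') y r = h x y r \<otimes>\<^bsub>T\<^sub>R\<^esub> h x' y r"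
    if "x \<in> carrier A" "x' \<in> carrier A" "y \<in> carrier B" "r \<in> carrier R" for x x' y r
    using that by (simp add: h_def AR.ext_pure_add_left ARBR.pure_add_left)
  have h_y: "h x (y \<oplus>\<^bsub>B\<^esub> y') r = h x y r \<otimes>\<^bsub>T\<^sub>R\<^esub> h x y' r"
    if "x \<in> carrier A" "y \<in> carrier B" "y' \<in> carrier B" "r \<in> carrier R" for x y y' r
    using that by (simp add: h_def BR.ext_pure_add_left ARBR.pure_add_right)
  have h_r: "h x y (r \<oplus>\<^bsub>R\<^esub> r') = h x y r \<otimes>\<^bsub>T\<^sub>R\<^esub> h x y r'"
    if "x \<in> carrier A" "y \<in> carrier B" "r \<in> carrier R" "r' \<in> carrier R" for x y r r'
    using that by (simp add: h_def BR.ext_pure_add_right ARBR.pure_add_right)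
  have h_yr: "h x (c \<odot>\<^bsub>B\<^esub> y) r = h x y (c \<odot>\<^bsub>R\<^esub> r)"
    if "c \<in> carrier k" "x \<in> carrier A" "y \<in> carrier B" "r \<in> carrier R" for c x y r
    using that by (simp add: h_def BR.pure_balanced)
  have h_xr: "h (c \<odot>\<^bsub>A\<^esub> x) y r = h x y (c \<odot>\<^bsub>R\<^esub> r)"
    if "c \<in> carrier k" "x \<in> carrier A" "y \<in> carrier B" "r \<in> carrier R" for c x y r
  proof -
    \<comment> \<open>The scalar \<open>c\<close> crosses the tensor product over \<open>R\<close> as the element \<open>c 1\<close> of \<open>R\<close>.\<close>
    let ?c = "c \<odot>\<^bsub>R\<^esub> \<one>\<^bsub>R\<^esub>"
    have "AR.pure (c \<odot>\<^bsub>A\<^esub> x) \<one>\<^bsub>R\<^esub> = ?c \<odot>\<^bsub>A\<^sub>R\<^esub> AR.pure x \<one>\<^bsub>R\<^esub>"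
      using that by (simp add: AR.pure_balanced)
    moreover have "?c \<odot>\<^bsub>B\<^sub>R\<^esub> BR.pure y r = BR.pure y (c \<odot>\<^bsub>R\<^esub> r)"
      using that by (simp add: AR.B.mult_smult_left)
    moreover have "pure\<^sub>R (?c \<odot>\<^bsub>A\<^sub>R\<^esub> AR.pure x \<one>\<^bsub>R\<^esub>) (BR.pure y r)
        = pure\<^sub>R (AR.pure x \<one>\<^bsub>R\<^esub>) (?c \<odot>\<^bsub>B\<^sub>R\<^esub> BR.pure y r)"
      using that by (intro ARBR.pure_balanced) auto
    ultimately show ?thesis by (simp only: h_def)
  qed
  have h_xy: "h (c \<odot>\<^bsub>A\<^esub> x) y r = h x (c \<odot>\<^bsub>B\<^esub> y) r"
    if "c \<in> carrier k" "x \<in> carrier A" "y \<in> carrier B" "r \<in> carrier R" for c x y r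
    using that by (simp add: h_xr h_yr)
  have bal: "balanced k A B T\<^sub>R (\<lambda>x y. h x y r)" if "r \<in> carrier R" for r
    using that by (intro balancedI) (simp_all add: h_closed h_x h_y h_xy)
  define g where "g Z r = tensor_lift k A B T\<^sub>R (\<lambda>x y. h x y r) Z" for Z r
  have g_pure: "g (AB.pure x y) r = h x y r" if "x \<in> carrier A" "y \<in> carrier B" "r \<in> carrier R" for x y r
    using that by (simp add: g_def AB.lift_pure[OF ARBR.tensor_comm_group bal])
  have g_closed: "g Z r \<in> carrier T\<^sub>R" if "Z \<in> carrier AB.T" "r \<in> carrier R" for Z r
    using that by (simp add: g_def AB.lift_closed[OF ARBR.tensor_comm_group bal])
  have g_add: "g (Z \<otimes>\<^bsub>AB.T\<^esub> Z') r = g Z r \<otimes>\<^bsub>T\<^sub>R\<^esub> g Z' r"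
    if "Z \<in> carrier AB.T" "Z' \<in> carrier AB.T" "r \<in> carrier R" for Z Z' r
    using that by (simp add: g_def AB.lift_mult[OF ARBR.tensor_comm_group bal])
  have g_r: "g Z (r \<oplus>\<^bsub>R\<^esub> r') = g Z r \<otimes>\<^bsub>T\<^sub>R\<^esub> g Z r'"
    if "Z \<in> carrier AB.T" "r \<in> carrier R" "r' \<in> carrier R" for Z r r'
    using that(1) by (induction rule: AB.tensor_induct)
      (use that in \<open>auto simp: g_pure h_r g_add g_closed ARBR.T.m_ac\<close>)
  have g_c: "g (c \<odot>\<^bsub>tensor_algebra k A B\<^esub> Z) r = g Z (c \<odot>\<^bsub>R\<^esub> r)"
    if "c \<in> carrier k" "Z \<in> carrier AB.T" "r \<in> carrier R" for c Z r
    using that(2) by (induction rule: AB.tensor_induct)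
      (use that in \<open>auto simp: g_pure h_xr g_add AB.smult_AB_add\<close>)
  have gbal: "balanced k (tensor_algebra k A B) R T\<^sub>R g"
    by (intro balancedI) (simp_all add: g_closed g_add g_r g_c)
  define \<Theta> where "\<Theta> = tensor_lift k (tensor_algebra k A B) R T\<^sub>R g"
  have hom: "\<Theta> \<in> hom (add_monoid W) T\<^sub>R"
    using W.lift_hom[OF ARBR.tensor_comm_group gbal] by (auto simp: \<Theta>_def hom_def W.AR_simps)
  have pp: "\<Theta> (triple x y r) = h x y r" if "x \<in> carrier A" "y \<in> carrier B" "r \<in> carrier R" for x y r
    using that by (simp add: \<Theta>_def W.lift_pure[OF ARBR.tensor_comm_group gbal] g_pure)
  have \<Theta>_add: "\<Theta> (w \<oplus>\<^bsub>W\<^esub> w') = \<Theta> w \<otimes>\<^bsub>T\<^sub>R\<^esub> \<Theta> w'" if "w \<in> carrier W" "w' \<in> carrier W" for w w'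
    using hom_mult[OF hom] that by simp
  have "\<Theta> (ext_prod U V) = pure\<^sub>R U V" if U: "U \<in> carrier A\<^sub>R" and V: "V \<in> carrier B\<^sub>R" for U V
    using U
  proof (induction rule: AR.ext_induct)
    case p1: (pure x r)
    show ?case using V
    proof (induction rule: BR.ext_induct)
      case p2: (pure y s)
      have "pure\<^sub>R (AR.pure x r) (BR.pure y s) = pure\<^sub>R (r \<odot>\<^bsub>A\<^sub>R\<^esub> AR.pure x \<one>\<^bsub>R\<^esub>) (BR.pure y s)"
        using p1 by simp
      also have "\<dots> = h x y (r \<otimes>\<^bsub>R\<^esub> s)"
        using p1 p2 by (simp add: ARBR.pure_balanced h_def del: AR.ext_smult_pure)
      finally show ?case using p1 p2 by (simp add: pp)
    next
      case (add V V')
      then show ?case using p1 by (simp add: ext_prod_add_right \<Theta>_add ARBR.pure_add_right)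
    qed
  next
    case (add U U')
    then show ?case using V by (simp add: ext_prod_add_left \<Theta>_add ARBR.pure_add_left)
  qed
  then show ?thesis using hom that by blast
qed

lemma tensor_base_change_inj: "inj_on (tensor_base_change k A B R) (carrier T\<^sub>R)"
proof -
  obtain \<Theta> where \<Theta>: "\<Theta> \<in> hom (add_monoid W) T\<^sub>R"
    "\<And>U V. U \<in> carrier A\<^sub>R \<Longrightarrow> V \<in> carrier B\<^sub>R \<Longrightarrow> \<Theta> (ext_prod U V) = pure\<^sub>R U V"
    using tensor_base_change_inverse by blast
  have "\<Theta> (tensor_base_change k A B R Z) = Z" if "Z \<in> carrier T\<^sub>R" for Z
    using that
  proof (induction rule: ARBR.tensor_induct)
    case (pure U V)
    then show ?case by (simp add: tensor_base_change_pure \<Theta>(2))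
  next
    case (add Z Z')
    then show ?case
      using hom_mult[OF tensor_base_change_hom] hom_mult[OF \<Theta>(1)]
        hom_in_carrier[OF tensor_base_change_hom] by simp
  qed
  then show ?thesis by (rule inj_on_inverseI)
qed

lemma tensor_base_change_surj: "tensor_base_change k A B R ` carrier T\<^sub>R = carrier W"
proof
  show "tensor_base_change k A B R ` carrier T\<^sub>R \<subseteq> carrier W"
    using hom_in_carrier[OF tensor_base_change_hom] by auto
  show "carrier W \<subseteq> tensor_base_change k A B R ` carrier T\<^sub>R"
  proof
    fix w assume "w \<in> carrier W"
    then show "w \<in> tensor_base_change k A B R ` carrier T\<^sub>R"
    proof (induction rule: ext_prod_induct)
      case (prod U V)
      then show ?case by (metis tensor_base_change_pure ARBR.pure_closed imageI)
    next
      case (add w w')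
      then show ?case
        using hom_mult[OF tensor_base_change_hom] ARBR.T.m_closed by (smt (verit) image_iff monoid.simps(1))
    qed
  qed
qed

text \<open>The universal property of the tensor product over \<open>R\<close>, transported to the extension.\<close>

definition ext_lift where
  "ext_lift G h = (\<lambda>w \<in> carrier W. tensor_lift R A\<^sub>R B\<^sub>R G h
     (inv_into (carrier T\<^sub>R) (tensor_base_change k A B R) w))"

lemma ext_lift_props:
  assumes "abelian_group G" "balanced R A\<^sub>R B\<^sub>R (add_monoid G) h"
  shows ext_lift_hom: "ext_lift (add_monoid G) h \<in> add_hom W G"
    and ext_lift_prod: "\<And>U V. U \<in> carrier A\<^sub>R \<Longrightarrow> V \<in> carrier B\<^sub>R \<Longrightarrow>
      ext_lift (add_monoid G) h (ext_prod U V) = h U V"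
proof -
  note G = abelian_group_comm_group[OF assms(1)]
  let ?\<Psi> = "tensor_base_change k A B R"
  let ?\<Phi> = "inv_into (carrier T\<^sub>R) ?\<Psi>"
  have iso: "?\<Psi> \<in> iso T\<^sub>R (add_monoid W)"
    using tensor_base_change_hom tensor_base_change_inj tensor_base_change_surj
    by (simp add: iso_def bij_betw_def)
  have inv: "?\<Phi> \<in> hom (add_monoid W) T\<^sub>R"
    using ARBR.T.iso_set_sym[OF iso] by (simp add: iso_def)
  have "tensor_lift R A\<^sub>R B\<^sub>R (add_monoid G) h \<circ> ?\<Phi> \<in> add_hom W G"
    by (rule hom_compose[OF inv ARBR.lift_hom[OF G assms(2)]])
  then show "ext_lift (add_monoid G) h \<in> add_hom W G"
    by (auto simp: ext_lift_def hom_def)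
  show "ext_lift (add_monoid G) h (ext_prod U V) = h U V"
    if "U \<in> carrier A\<^sub>R" "V \<in> carrier B\<^sub>R" for U V
  proof -
    have "?\<Phi> (ext_prod U V) = pure\<^sub>R U V"
      using that tensor_base_change_inj
      by (simp add: tensor_base_change_pure[symmetric])
    then show ?thesis
      using that by (simp add: ext_lift_def ARBR.lift_pure[OF G assms(2)])
  qed
qed

lemma ext_add_hom_eq:
  assumes "f \<in> add_hom W G" "g \<in> add_hom W G"
    and "\<And>U V. U \<in> carrier A\<^sub>R \<Longrightarrow> V \<in> carrier B\<^sub>R \<Longrightarrow> f (ext_prod U V) = g (ext_prod U V)"
    and "w \<in> carrier W"
  shows "f w = g w"
  using assms(4) by (induction rule: ext_prod_induct) (use assms in \<open>auto simp: add_hom_iff\<close>)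

lemma tensor_aut_props:
  assumes f1: "f1 \<in> linear_maps R A\<^sub>R A\<^sub>R" and f2: "f2 \<in> linear_maps R B\<^sub>R B\<^sub>R"
  shows tensor_aut_hom: "tensor_aut k A B R (f1, f2) \<in> add_hom W W"
    and tensor_aut_extensional: "tensor_aut k A B R (f1, f2) \<in> extensional (carrier W)"
    and tensor_aut_prod: "\<And>U V. U \<in> carrier A\<^sub>R \<Longrightarrow> V \<in> carrier B\<^sub>R \<Longrightarrow>
      tensor_aut k A B R (f1, f2) (ext_prod U V) = ext_prod (f1 U) (f2 V)"
proof -
  note f = linear_mapsD[OF f1] linear_mapsD[OF f2]
  let ?F = "tensor_map R A\<^sub>R B\<^sub>R A\<^sub>R B\<^sub>R f1 f2"
  let ?\<Psi> = "tensor_base_change k A B R"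
  let ?\<Phi> = "inv_into (carrier T\<^sub>R) ?\<Psi>"
  note F = tensor_map_props[OF ARBR.tensor_modules_axioms ARBR.tensor_modules_axioms f1 f2]
  have iso: "?\<Psi> \<in> iso T\<^sub>R (add_monoid W)"
    using tensor_base_change_hom tensor_base_change_inj tensor_base_change_surj
    by (simp add: iso_def bij_betw_def)
  have inv: "?\<Phi> \<in> hom (add_monoid W) T\<^sub>R"
    using ARBR.T.iso_set_sym[OF iso] by (simp add: iso_def)
  have eq: "tensor_aut k A B R (f1, f2) = (\<lambda>w \<in> carrier W. ?\<Psi> (?F (?\<Phi> w)))"
    by (simp add: tensor_aut_def)
  have "?\<Psi> \<circ> (?F \<circ> ?\<Phi>) \<in> add_hom W W"
    by (intro hom_compose[OF _ tensor_base_change_hom] hom_compose[OF inv F(1)])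
  then show "tensor_aut k A B R (f1, f2) \<in> add_hom W W"
    by (auto simp: eq hom_def)
  show "tensor_aut k A B R (f1, f2) \<in> extensional (carrier W)"
    by (simp add: eq)
  show "tensor_aut k A B R (f1, f2) (ext_prod U V) = ext_prod (f1 U) (f2 V)"
    if "U \<in> carrier A\<^sub>R" "V \<in> carrier B\<^sub>R" for U V
  proof -
    have "?\<Phi> (ext_prod U V) = pure\<^sub>R U V"
      using that tensor_base_change_inj by (simp add: tensor_base_change_pure[symmetric])
    then show ?thesis
      using that by (simp add: eq F tensor_base_change_pure f)
  qed
qed

end

section \<open>Splitting automorphisms of a product of quadratic algebras\<close>

text \<open>
  Coordinates for a module.  Of the duality relations only the diagonal ones are demanded: they
  are all that the trace of the identity involves.
\<close>

definition dual_basis ::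
  "('r, 'p) ring_scheme \<Rightarrow> ('r, 'a, 'm) module_scheme \<Rightarrow> 'i set \<Rightarrow> ('i \<Rightarrow> 'a) \<Rightarrow> ('i \<Rightarrow> 'a \<Rightarrow> 'r) \<Rightarrow> bool"
  where "dual_basis R M I x \<xi> \<longleftrightarrow> finite I \<and> x \<in> I \<rightarrow> carrier M \<and> \<xi> \<in> I \<rightarrow> functionals R M \<and>
    (\<forall>i \<in> I. \<xi> i (x i) = \<one>\<^bsub>R\<^esub>) \<and>
    (\<forall>u \<in> carrier M. u = (\<Oplus>\<^bsub>M\<^esub>i \<in> I. \<xi> i u \<odot>\<^bsub>M\<^esub> x i))"

lemma add_hom_finsum:
  assumes "abelian_group X" "abelian_group Y" "f \<in> add_hom X Y" "finite I" "u \<in> I \<rightarrow> carrier X"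
  shows "f (\<Oplus>\<^bsub>X\<^esub>i \<in> I. u i) = (\<Oplus>\<^bsub>Y\<^esub>i \<in> I. f (u i))"
proof -
  interpret X: abelian_group X by fact
  interpret Y: abelian_group Y by fact
  show ?thesis
    using assms(4,5)
  proof (induction rule: finite_induct)
    case empty
    then show ?case using add_hom_zero[OF assms(1-3)] by simp
  next
    case (insert i I)
    have "f (\<Oplus>\<^bsub>X\<^esub>i \<in> insert i I. u i) = f (u i \<oplus>\<^bsub>X\<^esub> (\<Oplus>\<^bsub>X\<^esub>i \<in> I. u i))"
      using insert by (subst X.finsum_insert) auto
    also have "\<dots> = f (u i) \<oplus>\<^bsub>Y\<^esub> f (\<Oplus>\<^bsub>X\<^esub>i \<in> I. u i)"
    proof -
      have "u i \<in> carrier X" "(\<Oplus>\<^bsub>X\<^esub>i \<in> I. u i) \<in> carrier X"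
        using insert by (auto intro!: X.finsum_closed)
      then show ?thesis using assms(3) unfolding add_hom_iff by blast
    qed
    also have "\<dots> = f (u i) \<oplus>\<^bsub>Y\<^esub> (\<Oplus>\<^bsub>Y\<^esub>i \<in> I. f (u i))"
      using insert by auto
    also have "\<dots> = (\<Oplus>\<^bsub>Y\<^esub>i \<in> insert i I. f (u i))"
    proof -
      have "\<forall>i \<in> insert i I. f (u i) \<in> carrier Y"
        using insert assms(3) unfolding add_hom_iff by blast
      then show ?thesis using insert by (subst Y.finsum_insert) auto
    qed
    finally show ?case .
  qed
qed

lemma (in abelian_monoid) finsum_exchange:
  assumes "finite I" "finite J" "\<And>i j. i \<in> I \<Longrightarrow> j \<in> J \<Longrightarrow> f i j \<in> carrier G"
  shows "(\<Oplus>i \<in> I. \<Oplus>j \<in> J. f i j) = (\<Oplus>j \<in> J. \<Oplus>i \<in> I. f i j)"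
  using assms(1,3)
proof (induction rule: finite_induct)
  case empty
  then show ?case by simp
next
  case (insert i I)
  then have "(\<Oplus>j \<in> J. \<Oplus>i \<in> insert i I. f i j) = (\<Oplus>j \<in> J. f i j \<oplus> (\<Oplus>i \<in> I. f i j))"
    by (intro finsum_cong) (auto simp: simp_implies_def intro!: finsum_closed finsum_insert)
  also have "\<dots> = (\<Oplus>j \<in> J. f i j) \<oplus> (\<Oplus>j \<in> J. \<Oplus>i \<in> I. f i j)"
    using insert by (intro finsum_addf) (auto intro!: finsum_closed)
  also have "(\<Oplus>j \<in> J. \<Oplus>i \<in> I. f i j) = (\<Oplus>i \<in> I. \<Oplus>j \<in> J. f i j)"
    using insert by simp
  also have "(\<Oplus>j \<in> J. f i j) \<oplus> (\<Oplus>i \<in> I. \<Oplus>j \<in> J. f i j) = (\<Oplus>i \<in> insert i I. \<Oplus>j \<in> J. f i j)"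
    using insert by (subst finsum_insert) (auto intro!: finsum_closed)
  finally show ?case by simp
qed

text \<open>Both traces are the double sum of the products \<open>\<eta>\<^sub>j (G x\<^sub>i) \<xi>\<^sub>i (H y\<^sub>j)\<close>.\<close>

lemma trace_commute:
  assumes "module R A" "module R B"
    and x: "dual_basis R A I x \<xi>" and y: "dual_basis R B J y \<eta>"
    and G: "G \<in> linear_maps R A B" and H: "H \<in> linear_maps R B A"
  shows "(\<Oplus>\<^bsub>R\<^esub>i \<in> I. \<xi> i (H (G (x i)))) = (\<Oplus>\<^bsub>R\<^esub>j \<in> J. \<eta> j (G (H (y j))))"
proof -
  interpret A: module R A by fact
  interpret B: module R B by fact
  note g = linear_mapsD[OF G] and h = linear_mapsD[OF H]
  have fin: "finite I" "finite J"
    and xs: "\<And>i. i \<in> I \<Longrightarrow> x i \<in> carrier A" and ys: "\<And>j. j \<in> J \<Longrightarrow> y j \<in> carrier B"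
    and xi: "\<And>i. i \<in> I \<Longrightarrow> \<xi> i \<in> functionals R A" and eta: "\<And>j. j \<in> J \<Longrightarrow> \<eta> j \<in> functionals R B"
    and expA: "\<And>u. u \<in> carrier A \<Longrightarrow> u = (\<Oplus>\<^bsub>A\<^esub>i \<in> I. \<xi> i u \<odot>\<^bsub>A\<^esub> x i)"
    and expB: "\<And>u. u \<in> carrier B \<Longrightarrow> u = (\<Oplus>\<^bsub>B\<^esub>j \<in> J. \<eta> j u \<odot>\<^bsub>B\<^esub> y j)"
    using x y unfolding dual_basis_def by blast+
  note xi_cl = functionals_closed[OF xi] and eta_cl = functionals_closed[OF eta]
  have 1: "\<xi> i (H u) = (\<Oplus>\<^bsub>R\<^esub>j \<in> J. \<eta> j u \<otimes>\<^bsub>R\<^esub> \<xi> i (H (y j)))"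
    if "i \<in> I" "u \<in> carrier B" for i u
  proof -
    have c: "(\<lambda>u. \<xi> i (H u)) \<in> add_hom B R"
      using that xi_cl h functionals_add[OF xi] by (simp add: add_hom_iff)
    have "\<xi> i (H u) = \<xi> i (H (\<Oplus>\<^bsub>B\<^esub>j \<in> J. \<eta> j u \<odot>\<^bsub>B\<^esub> y j))"
      using expB[OF that(2)] by simp
    also have "\<dots> = (\<Oplus>\<^bsub>R\<^esub>j \<in> J. \<xi> i (H (\<eta> j u \<odot>\<^bsub>B\<^esub> y j)))"
      using that fin ys eta_cl
      by (intro add_hom_finsum[OF B.abelian_group_axioms A.R.abelian_group_axioms c]) auto
    also have "\<dots> = (\<Oplus>\<^bsub>R\<^esub>j \<in> J. \<eta> j u \<otimes>\<^bsub>R\<^esub> \<xi> i (H (y j)))"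
      using that ys eta_cl h xi_cl
      by (intro A.R.finsum_cong) (auto simp: simp_implies_def functionals_smult[OF xi])
    finally show ?thesis .
  qed
  have 2: "\<eta> j (G u) = (\<Oplus>\<^bsub>R\<^esub>i \<in> I. \<xi> i u \<otimes>\<^bsub>R\<^esub> \<eta> j (G (x i)))"
    if "j \<in> J" "u \<in> carrier A" for j u
  proof -
    have c: "(\<lambda>u. \<eta> j (G u)) \<in> add_hom A R"
      using that eta_cl g functionals_add[OF eta] by (simp add: add_hom_iff)
    have "\<eta> j (G u) = \<eta> j (G (\<Oplus>\<^bsub>A\<^esub>i \<in> I. \<xi> i u \<odot>\<^bsub>A\<^esub> x i))"
      using expA[OF that(2)] by simp
    also have "\<dots> = (\<Oplus>\<^bsub>R\<^esub>i \<in> I. \<eta> j (G (\<xi> i u \<odot>\<^bsub>A\<^esub> x i)))"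
      using that fin xs xi_cl
      by (intro add_hom_finsum[OF A.abelian_group_axioms A.R.abelian_group_axioms c]) auto
    also have "\<dots> = (\<Oplus>\<^bsub>R\<^esub>i \<in> I. \<xi> i u \<otimes>\<^bsub>R\<^esub> \<eta> j (G (x i)))"
      using that xs xi_cl g eta_cl
      by (intro A.R.finsum_cong) (auto simp: simp_implies_def functionals_smult[OF eta])
    finally show ?thesis .
  qed
  have "(\<Oplus>\<^bsub>R\<^esub>i \<in> I. \<xi> i (H (G (x i)))) =
      (\<Oplus>\<^bsub>R\<^esub>i \<in> I. \<Oplus>\<^bsub>R\<^esub>j \<in> J. \<eta> j (G (x i)) \<otimes>\<^bsub>R\<^esub> \<xi> i (H (y j)))"
  proof (rule A.R.finsum_cong'[OF refl])
    show "(\<lambda>i. \<Oplus>\<^bsub>R\<^esub>j \<in> J. \<eta> j (G (x i)) \<otimes>\<^bsub>R\<^esub> \<xi> i (H (y j))) \<in> I \<rightarrow> carrier R"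
      using xs ys g h xi_cl eta_cl by (auto intro!: A.R.finsum_closed)
    show "\<xi> i (H (G (x i))) = (\<Oplus>\<^bsub>R\<^esub>j \<in> J. \<eta> j (G (x i)) \<otimes>\<^bsub>R\<^esub> \<xi> i (H (y j)))"
      if "i \<in> I" for i
      by (rule 1[OF that]) (use that xs g in auto)
  qed
  also have "\<dots> = (\<Oplus>\<^bsub>R\<^esub>j \<in> J. \<Oplus>\<^bsub>R\<^esub>i \<in> I. \<eta> j (G (x i)) \<otimes>\<^bsub>R\<^esub> \<xi> i (H (y j)))"
    using fin xs ys g h xi_cl eta_cl by (intro A.R.finsum_exchange) auto
  also have "\<dots> = (\<Oplus>\<^bsub>R\<^esub>j \<in> J. \<eta> j (G (H (y j))))"
  proof (rule A.R.finsum_cong'[OF refl])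
    show "(\<lambda>j. \<eta> j (G (H (y j)))) \<in> J \<rightarrow> carrier R"
      using ys g h eta_cl by auto
    fix j assume "j \<in> J"
    then have "\<eta> j (G (H (y j))) = (\<Oplus>\<^bsub>R\<^esub>i \<in> I. \<xi> i (H (y j)) \<otimes>\<^bsub>R\<^esub> \<eta> j (G (x i)))"
      by (intro 2) (use ys h in auto)
    also have "\<dots> = (\<Oplus>\<^bsub>R\<^esub>i \<in> I. \<eta> j (G (x i)) \<otimes>\<^bsub>R\<^esub> \<xi> i (H (y j)))"
      using \<open>j \<in> J\<close> xs ys g h xi_cl eta_cl
      by (intro A.R.finsum_cong) (auto simp: simp_implies_def A.R.m_comm)
    finally show "(\<Oplus>\<^bsub>R\<^esub>i \<in> I. \<eta> j (G (x i)) \<otimes>\<^bsub>R\<^esub> \<xi> i (H (y j))) = \<eta> j (G (H (y j)))" by simp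
  qed
  finally show ?thesis .
qed

lemma (in module) trace_of_scaled_identity:
  assumes x: "dual_basis R M I x \<xi>" and F: "F \<in> linear_maps R M M" and \<theta>: "\<theta> \<in> carrier R"
    and id: "\<And>u. u \<in> carrier M \<Longrightarrow> \<theta> \<odot>\<^bsub>M\<^esub> F u = \<theta> \<odot>\<^bsub>M\<^esub> u"
  shows "\<theta> \<otimes>\<^bsub>R\<^esub> (\<Oplus>\<^bsub>R\<^esub>i \<in> I. \<xi> i (F (x i))) = [card I] \<cdot>\<^bsub>R\<^esub> \<theta>"
proof -
  have fin: "finite I" and xs: "\<And>i. i \<in> I \<Longrightarrow> x i \<in> carrier M"
    and xi: "\<And>i. i \<in> I \<Longrightarrow> \<xi> i \<in> functionals R M" and one: "\<And>i. i \<in> I \<Longrightarrow> \<xi> i (x i) = \<one>\<^bsub>R\<^esub>"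
    using x unfolding dual_basis_def by blast+
  note F_cl = linear_maps_closed[OF F]
  have "\<theta> \<otimes>\<^bsub>R\<^esub> (\<Oplus>\<^bsub>R\<^esub>i \<in> I. \<xi> i (F (x i))) = (\<Oplus>\<^bsub>R\<^esub>i \<in> I. \<theta> \<otimes>\<^bsub>R\<^esub> \<xi> i (F (x i)))"
    using \<theta> fin xs functionals_closed[OF xi] F_cl by (intro R.finsum_rdistr) auto
  also have "\<dots> = (\<Oplus>\<^bsub>R\<^esub>i \<in> I. \<theta>)"
  proof (rule R.finsum_cong'[OF refl])
    show "(\<lambda>i. \<theta>) \<in> I \<rightarrow> carrier R" using \<theta> by simp
    fix i assume i: "i \<in> I"
    have "\<theta> \<otimes>\<^bsub>R\<^esub> \<xi> i (F (x i)) = \<xi> i (\<theta> \<odot>\<^bsub>M\<^esub> F (x i))"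
      using \<theta> xs[OF i] F_cl by (simp add: functionals_smult[OF xi[OF i]])
    also have "\<dots> = \<theta>"
      unfolding id[OF xs[OF i]] using \<theta> xs[OF i] one[OF i]
      by (simp add: functionals_smult[OF xi[OF i]])
    finally show "\<theta> \<otimes>\<^bsub>R\<^esub> \<xi> i (F (x i)) = \<theta>" .
  qed
  also have "\<dots> = [card I] \<cdot>\<^bsub>R\<^esub> \<theta>" using \<theta> by (rule R.add.finprod_const)
  finally show ?thesis .
qed

lemma (in module) double_zero:
  assumes "h \<in> carrier R" "h \<oplus>\<^bsub>R\<^esub> h = \<one>\<^bsub>R\<^esub>" "x \<in> carrier M" "x \<oplus>\<^bsub>M\<^esub> x = \<zero>\<^bsub>M\<^esub>"
  shows "x = \<zero>\<^bsub>M\<^esub>"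
proof -
  have "x = (h \<oplus>\<^bsub>R\<^esub> h) \<odot>\<^bsub>M\<^esub> x" using assms by simp
  also have "\<dots> = h \<odot>\<^bsub>M\<^esub> (x \<oplus>\<^bsub>M\<^esub> x)"
    using assms(1,3) by (simp add: smult_l_distr smult_r_distr)
  finally show ?thesis using assms by simp
qed

lemma (in unital_algebra) mult_zero:
  assumes "x \<in> carrier A"
  shows mult_zero_left: "\<zero>\<^bsub>A\<^esub> \<otimes>\<^bsub>A\<^esub> x = \<zero>\<^bsub>A\<^esub>"
    and mult_zero_right: "x \<otimes>\<^bsub>A\<^esub> \<zero>\<^bsub>A\<^esub> = \<zero>\<^bsub>A\<^esub>"
proof -
  have "\<zero>\<^bsub>A\<^esub> \<otimes>\<^bsub>A\<^esub> x = (\<zero>\<^bsub>R\<^esub> \<odot>\<^bsub>A\<^esub> \<zero>\<^bsub>A\<^esub>) \<otimes>\<^bsub>A\<^esub> x" by simp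
  also have "\<dots> = \<zero>\<^bsub>R\<^esub> \<odot>\<^bsub>A\<^esub> (\<zero>\<^bsub>A\<^esub> \<otimes>\<^bsub>A\<^esub> x)"
    using assms by (intro mult_smult_left) auto
  also have "\<dots> = \<zero>\<^bsub>A\<^esub>"
    using assms by (intro smult_l_null mult_closed) auto
  finally show "\<zero>\<^bsub>A\<^esub> \<otimes>\<^bsub>A\<^esub> x = \<zero>\<^bsub>A\<^esub>" .
  have "x \<otimes>\<^bsub>A\<^esub> \<zero>\<^bsub>A\<^esub> = x \<otimes>\<^bsub>A\<^esub> (\<zero>\<^bsub>R\<^esub> \<odot>\<^bsub>A\<^esub> \<zero>\<^bsub>A\<^esub>)" by simp
  also have "\<dots> = \<zero>\<^bsub>R\<^esub> \<odot>\<^bsub>A\<^esub> (x \<otimes>\<^bsub>A\<^esub> \<zero>\<^bsub>A\<^esub>)"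
    using assms by (intro mult_smult_right) auto
  also have "\<dots> = \<zero>\<^bsub>A\<^esub>"
    using assms by (intro smult_l_null mult_closed) auto
  finally show "x \<otimes>\<^bsub>A\<^esub> \<zero>\<^bsub>A\<^esub> = \<zero>\<^bsub>A\<^esub>" .
qed

text \<open>
  The functional \<open>l\<close> is half of the trace, normalized by \<open>l 1 = 1\<close>, and \<open>bar\<close> is the conjugation
  \<open>x \<mapsto> 2 l(x) 1 - x\<close>, written as an equation for \<open>bar x + x\<close>.
\<close>

locale quadratic_algebra = unital_algebra R A for R and A +
  fixes l and bar
  assumes half: "\<exists>h \<in> carrier R. h \<oplus>\<^bsub>R\<^esub> h = \<one>\<^bsub>R\<^esub>"
    and l_functional: "l \<in> functionals R A"
    and l_one: "l \<one>\<^bsub>A\<^esub> = \<one>\<^bsub>R\<^esub>"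
    and traceless_square: "s \<in> carrier A \<Longrightarrow> l s = \<zero>\<^bsub>R\<^esub> \<Longrightarrow> \<exists>\<rho> \<in> carrier R. s \<otimes>\<^bsub>A\<^esub> s = \<rho> \<odot>\<^bsub>A\<^esub> \<one>\<^bsub>A\<^esub>"
    and bar_closed: "x \<in> carrier A \<Longrightarrow> bar x \<in> carrier A"
    and bar_add_self: "x \<in> carrier A \<Longrightarrow> bar x \<oplus>\<^bsub>A\<^esub> x = (l x \<oplus>\<^bsub>R\<^esub> l x) \<odot>\<^bsub>A\<^esub> \<one>\<^bsub>A\<^esub>"
begin

definition traceless where "traceless = {s \<in> carrier A. l s = \<zero>\<^bsub>R\<^esub>}"

text \<open>
  Extensions of a composition algebra are trivial when its dimension is one and contain a unit
  square otherwise.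
\<close>

definition "trivial_algebra \<longleftrightarrow> (\<forall>x \<in> carrier A. x = l x \<odot>\<^bsub>A\<^esub> \<one>\<^bsub>A\<^esub>)"

definition "unit_square s \<longleftrightarrow> s \<in> traceless \<and> (\<exists>\<nu> \<in> Units R. s \<otimes>\<^bsub>A\<^esub> s = \<nu> \<odot>\<^bsub>A\<^esub> \<one>\<^bsub>A\<^esub>)"

lemmas l_closed [simp] = functionals_closed[OF l_functional]
lemmas l_add [simp] = functionals_add[OF l_functional]
lemmas l_smult [simp] = functionals_smult[OF l_functional]
declare mult_zero_left [simp] mult_zero_right [simp] unit_closed [simp] mult_closed [simp]
  l_one [simp] unit_left [simp] unit_right [simp]

lemma l_zero' [simp]: "l \<zero>\<^bsub>A\<^esub> = \<zero>\<^bsub>R\<^esub>"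
  by (rule add_hom_zero[OF abelian_group_axioms R.abelian_group_axioms functionals_add_hom[OF l_functional]])

lemma l_uminus [simp]: "x \<in> carrier A \<Longrightarrow> l (\<ominus>\<^bsub>A\<^esub> x) = \<ominus>\<^bsub>R\<^esub> l x"
  by (rule add_hom_a_inv[OF abelian_group_axioms R.abelian_group_axioms functionals_add_hom[OF l_functional]])

lemma smult_one_cancel:
  assumes "r \<in> carrier R" "s \<in> carrier R" and eq: "r \<odot>\<^bsub>A\<^esub> \<one>\<^bsub>A\<^esub> = s \<odot>\<^bsub>A\<^esub> \<one>\<^bsub>A\<^esub>"
  shows "r = s"
proof -
  have "r = l (r \<odot>\<^bsub>A\<^esub> \<one>\<^bsub>A\<^esub>)" using assms(1) by simp
  also have "\<dots> = s" unfolding eq using assms(2) by simp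
  finally show ?thesis .
qed

lemma double_zero_A: "x \<in> carrier A \<Longrightarrow> x \<oplus>\<^bsub>A\<^esub> x = \<zero>\<^bsub>A\<^esub> \<Longrightarrow> x = \<zero>\<^bsub>A\<^esub>"
  using half by (elim bexE) (rule double_zero)

lemma traceless_simps [simp]:
  "\<zero>\<^bsub>A\<^esub> \<in> traceless"
  "s \<in> traceless \<Longrightarrow> s \<in> carrier A"
  "s \<in> traceless \<Longrightarrow> l s = \<zero>\<^bsub>R\<^esub>"
  "s \<in> traceless \<Longrightarrow> t \<in> traceless \<Longrightarrow> s \<oplus>\<^bsub>A\<^esub> t \<in> traceless"
  "r \<in> carrier R \<Longrightarrow> s \<in> traceless \<Longrightarrow> r \<odot>\<^bsub>A\<^esub> s \<in> traceless"
  "s \<in> traceless \<Longrightarrow> \<ominus>\<^bsub>A\<^esub> s \<in> traceless"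
  by (simp_all add: traceless_def)

lemma scalar_plus_traceless:
  assumes "x \<in> carrier A"
  obtains s where "s \<in> traceless" "x = l x \<odot>\<^bsub>A\<^esub> \<one>\<^bsub>A\<^esub> \<oplus>\<^bsub>A\<^esub> s"
proof
  let ?c = "l x \<odot>\<^bsub>A\<^esub> \<one>\<^bsub>A\<^esub>"
  show "\<ominus>\<^bsub>A\<^esub> ?c \<oplus>\<^bsub>A\<^esub> x \<in> traceless"
    unfolding traceless_def using assms by (simp add: R.l_neg)
  show "x = ?c \<oplus>\<^bsub>A\<^esub> (\<ominus>\<^bsub>A\<^esub> ?c \<oplus>\<^bsub>A\<^esub> x)"
    using assms by (intro M.r_neg2[symmetric]) auto
qed

lemma scaled_identityI:
  assumes F: "F \<in> linear_maps R A A" "F \<one>\<^bsub>A\<^esub> = \<one>\<^bsub>A\<^esub>" and \<theta>: "\<theta> \<in> carrier R"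
    and S: "\<And>s. s \<in> traceless \<Longrightarrow> \<theta> \<odot>\<^bsub>A\<^esub> F s = \<theta> \<odot>\<^bsub>A\<^esub> s" and u: "u \<in> carrier A"
  shows "\<theta> \<odot>\<^bsub>A\<^esub> F u = \<theta> \<odot>\<^bsub>A\<^esub> u"
proof -
  obtain s where s: "s \<in> traceless" "u = l u \<odot>\<^bsub>A\<^esub> \<one>\<^bsub>A\<^esub> \<oplus>\<^bsub>A\<^esub> s"
    using scalar_plus_traceless[OF u] by blast
  define \<alpha> where "\<alpha> = l u"
  have \<alpha>: "\<alpha> \<in> carrier R" using u by (simp add: \<alpha>_def)
  have "\<theta> \<odot>\<^bsub>A\<^esub> F (\<alpha> \<odot>\<^bsub>A\<^esub> \<one>\<^bsub>A\<^esub> \<oplus>\<^bsub>A\<^esub> s) = \<theta> \<odot>\<^bsub>A\<^esub> (\<alpha> \<odot>\<^bsub>A\<^esub> \<one>\<^bsub>A\<^esub> \<oplus>\<^bsub>A\<^esub> s)"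
    using \<alpha> \<theta> s(1) S[OF s(1)] by (simp add: linear_mapsD(1-3)[OF F(1)] F(2) smult_r_distr)
  then show ?thesis by (simp only: s(2)[folded \<alpha>_def, symmetric])
qed

lemma traceless_of_trivial:
  assumes "trivial_algebra" "s \<in> traceless" shows "s = \<zero>\<^bsub>A\<^esub>"
proof -
  have "s = l s \<odot>\<^bsub>A\<^esub> \<one>\<^bsub>A\<^esub>" using assms traceless_simps(2) unfolding trivial_algebra_def by blast
  also have "\<dots> = \<zero>\<^bsub>A\<^esub>" using assms by simp
  finally show ?thesis .
qed

lemma bar_one [simp]: "bar \<one>\<^bsub>A\<^esub> = \<one>\<^bsub>A\<^esub>"
proof -
  have "bar \<one>\<^bsub>A\<^esub> \<oplus>\<^bsub>A\<^esub> \<one>\<^bsub>A\<^esub> = \<one>\<^bsub>A\<^esub> \<oplus>\<^bsub>A\<^esub> \<one>\<^bsub>A\<^esub>"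
    by (simp add: bar_add_self smult_l_distr)
  then show ?thesis by (simp add: bar_closed)
qed

lemma bar_eq:
  assumes "r \<in> carrier R" "s \<in> traceless"
  shows "bar (r \<odot>\<^bsub>A\<^esub> \<one>\<^bsub>A\<^esub> \<oplus>\<^bsub>A\<^esub> s) = r \<odot>\<^bsub>A\<^esub> \<one>\<^bsub>A\<^esub> \<oplus>\<^bsub>A\<^esub> \<ominus>\<^bsub>A\<^esub> s"
proof -
  let ?c = "r \<odot>\<^bsub>A\<^esub> \<one>\<^bsub>A\<^esub>"
  have "bar (?c \<oplus>\<^bsub>A\<^esub> s) \<oplus>\<^bsub>A\<^esub> (?c \<oplus>\<^bsub>A\<^esub> s) = ?c \<oplus>\<^bsub>A\<^esub> ?c"
    using assms by (simp add: bar_add_self smult_l_distr)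
  also have "\<dots> = (?c \<oplus>\<^bsub>A\<^esub> \<ominus>\<^bsub>A\<^esub> s) \<oplus>\<^bsub>A\<^esub> (?c \<oplus>\<^bsub>A\<^esub> s)"
  proof -
    have "(?c \<oplus>\<^bsub>A\<^esub> \<ominus>\<^bsub>A\<^esub> s) \<oplus>\<^bsub>A\<^esub> (?c \<oplus>\<^bsub>A\<^esub> s) = (?c \<oplus>\<^bsub>A\<^esub> ?c) \<oplus>\<^bsub>A\<^esub> (\<ominus>\<^bsub>A\<^esub> s \<oplus>\<^bsub>A\<^esub> s)"
      using assms by (simp add: M.a_ac)
    then show ?thesis using assms by (simp add: M.l_neg)
  qed
  finally show ?thesis using assms by (simp add: bar_closed)
qed

lemma bar_traceless [simp]: "s \<in> traceless \<Longrightarrow> bar s = \<ominus>\<^bsub>A\<^esub> s"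
  using bar_eq[of "\<zero>\<^bsub>R\<^esub>" s] by simp

lemma unit_square_cancel:
  assumes "unit_square s" "r \<in> carrier R" "r \<odot>\<^bsub>A\<^esub> s = \<zero>\<^bsub>A\<^esub>"
  shows "r = \<zero>\<^bsub>R\<^esub>"
proof -
  obtain \<nu> where s: "s \<in> traceless" and \<nu>: "\<nu> \<in> Units R" "s \<otimes>\<^bsub>A\<^esub> s = \<nu> \<odot>\<^bsub>A\<^esub> \<one>\<^bsub>A\<^esub>"
    using assms(1) by (auto simp: unit_square_def)
  have c: "\<nu> \<in> carrier R" using \<nu> by auto
  have "(r \<otimes>\<^bsub>R\<^esub> \<nu>) \<odot>\<^bsub>A\<^esub> \<one>\<^bsub>A\<^esub> = r \<odot>\<^bsub>A\<^esub> (s \<otimes>\<^bsub>A\<^esub> s)"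
    using assms c \<nu> by (simp add: smult_assoc1)
  also have "\<dots> = (r \<odot>\<^bsub>A\<^esub> s) \<otimes>\<^bsub>A\<^esub> s" using assms s by (subst mult_smult_left) auto
  also have "\<dots> = \<zero>\<^bsub>A\<^esub>" using assms s by simp
  finally have "(r \<otimes>\<^bsub>R\<^esub> \<nu>) \<odot>\<^bsub>A\<^esub> \<one>\<^bsub>A\<^esub> = \<zero>\<^bsub>R\<^esub> \<odot>\<^bsub>A\<^esub> \<one>\<^bsub>A\<^esub>" by simp
  then have "r \<otimes>\<^bsub>R\<^esub> \<nu> = \<zero>\<^bsub>R\<^esub>"
    using assms(2) c by (intro smult_one_cancel) auto
  then have "(r \<otimes>\<^bsub>R\<^esub> \<nu>) \<otimes>\<^bsub>R\<^esub> inv\<^bsub>R\<^esub> \<nu> = \<zero>\<^bsub>R\<^esub>" using \<nu> by simp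
  then show ?thesis using \<nu> assms c by (simp add: R.m_assoc)
qed

definition algebra_endos where
  "algebra_endos = {f \<in> linear_maps R A A.
     (\<forall>x \<in> carrier A. \<forall>y \<in> carrier A. f (x \<otimes>\<^bsub>A\<^esub> y) = f x \<otimes>\<^bsub>A\<^esub> f y) \<and> f \<one>\<^bsub>A\<^esub> = \<one>\<^bsub>A\<^esub>}"

lemma endo_square:
  assumes "f \<in> algebra_endos" "s \<in> traceless"
  obtains \<rho> where "\<rho> \<in> carrier R" "f s \<otimes>\<^bsub>A\<^esub> f s = \<rho> \<odot>\<^bsub>A\<^esub> \<one>\<^bsub>A\<^esub>" "s \<otimes>\<^bsub>A\<^esub> s = \<rho> \<odot>\<^bsub>A\<^esub> \<one>\<^bsub>A\<^esub>"
proof -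
  obtain \<rho> where "\<rho> \<in> carrier R" "s \<otimes>\<^bsub>A\<^esub> s = \<rho> \<odot>\<^bsub>A\<^esub> \<one>\<^bsub>A\<^esub>"
    using traceless_square[of s] assms by auto
  moreover have "f (s \<otimes>\<^bsub>A\<^esub> s) = f s \<otimes>\<^bsub>A\<^esub> f s"
    using assms by (simp add: algebra_endos_def)
  moreover have "f (\<rho> \<odot>\<^bsub>A\<^esub> \<one>\<^bsub>A\<^esub>) = \<rho> \<odot>\<^bsub>A\<^esub> \<one>\<^bsub>A\<^esub>" if "\<rho> \<in> carrier R" for \<rho>
  proof -
    have "f \<in> linear_maps R A A" "f \<one>\<^bsub>A\<^esub> = \<one>\<^bsub>A\<^esub>" using assms(1) by (auto simp: algebra_endos_def)
    then show ?thesis using linear_maps_smult[OF _ that unit_closed, of f A] by simp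
  qed
  ultimately show ?thesis using that[of \<rho>] by simp
qed

text \<open>
  The square of \<open>r + u\<close> is \<open>r\<^sup>2 + u\<^sup>2 + 2 r u\<close>, where \<open>r\<^sup>2 + u\<^sup>2\<close> is scalar and \<open>2 r u\<close> traceless.
\<close>

lemma square_scalar_imp:
  assumes "r \<in> carrier R" "u \<in> traceless" "\<rho> \<in> carrier R"
    and "(r \<odot>\<^bsub>A\<^esub> \<one>\<^bsub>A\<^esub> \<oplus>\<^bsub>A\<^esub> u) \<otimes>\<^bsub>A\<^esub> (r \<odot>\<^bsub>A\<^esub> \<one>\<^bsub>A\<^esub> \<oplus>\<^bsub>A\<^esub> u) = \<rho> \<odot>\<^bsub>A\<^esub> \<one>\<^bsub>A\<^esub>"
  shows "r \<odot>\<^bsub>A\<^esub> u = \<zero>\<^bsub>A\<^esub>"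
proof -
  obtain \<mu> where \<mu>: "\<mu> \<in> carrier R" "u \<otimes>\<^bsub>A\<^esub> u = \<mu> \<odot>\<^bsub>A\<^esub> \<one>\<^bsub>A\<^esub>"
    using traceless_square[of u] assms by auto
  let ?c = "r \<otimes>\<^bsub>R\<^esub> r \<oplus>\<^bsub>R\<^esub> \<mu>"
  have eq: "\<rho> \<odot>\<^bsub>A\<^esub> \<one>\<^bsub>A\<^esub> = ?c \<odot>\<^bsub>A\<^esub> \<one>\<^bsub>A\<^esub> \<oplus>\<^bsub>A\<^esub> (r \<odot>\<^bsub>A\<^esub> u \<oplus>\<^bsub>A\<^esub> r \<odot>\<^bsub>A\<^esub> u)" (is "_ = _ \<oplus>\<^bsub>A\<^esub> ?d")
    using assms(1-3) \<mu> unfolding assms(4)[symmetric]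
    by (simp add: mult_add_left mult_add_right mult_smult_left mult_smult_right smult_l_distr
        smult_r_distr smult_assoc1 M.a_ac)
  have "l (\<rho> \<odot>\<^bsub>A\<^esub> \<one>\<^bsub>A\<^esub>) = l (?c \<odot>\<^bsub>A\<^esub> \<one>\<^bsub>A\<^esub> \<oplus>\<^bsub>A\<^esub> ?d)"
    by (simp only: eq)
  then have c: "\<rho> = ?c"
    using assms(1-3) \<mu>(1) by simp
  have "?c \<odot>\<^bsub>A\<^esub> \<one>\<^bsub>A\<^esub> = ?c \<odot>\<^bsub>A\<^esub> \<one>\<^bsub>A\<^esub> \<oplus>\<^bsub>A\<^esub> ?d"
    using eq unfolding c .
  then have "?d = \<zero>\<^bsub>A\<^esub>"
    by (rule iffD1[OF M.add.l_cancel_one', rotated 2]) (use assms(1-3) \<mu>(1) in auto)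
  then show ?thesis using assms(1,2) by (intro double_zero_A[of "r \<odot>\<^bsub>A\<^esub> u"]) auto
qed

text \<open>
  The traceless part is determined by the algebra: when \<open>f s\<close> has scalar part \<open>r\<close> and traceless
  part \<open>u\<close>, the square of \<open>f s\<close> is scalar, hence \<open>2 r u = 0\<close>.  For an element \<open>s\<close> with invertible
  square this yields \<open>r (s - r) = 0\<close> after applying the inverse of \<open>f\<close>, so \<open>r = 0\<close>; the other
  elements are compared with this one by polarization.
\<close>

lemma automorphism_traceless:
  assumes f: "f \<in> algebra_endos" and g: "g \<in> algebra_endos"
    and gf: "\<And>x. x \<in> carrier A \<Longrightarrow> g (f x) = x"
    and nontriv: "trivial_algebra \<or> (\<exists>s. unit_square s)"
    and s: "s \<in> traceless"
  shows "f s \<in> traceless"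
proof (cases trivial_algebra)
  case True
  have "f \<zero>\<^bsub>A\<^esub> = \<zero>\<^bsub>A\<^esub>"
    using f add_hom_zero[OF abelian_group_axioms abelian_group_axioms]
    by (auto simp: algebra_endos_def linear_maps_def)
  then show ?thesis using traceless_of_trivial[OF True s] by simp
next
  case False
  then obtain s0 where s0: "unit_square s0" using nontriv by auto
  then have s0': "s0 \<in> traceless" by (simp add: unit_square_def)
  have fl: "f \<in> linear_maps R A A" and gl: "g \<in> linear_maps R A A" and g1: "g \<one>\<^bsub>A\<^esub> = \<one>\<^bsub>A\<^esub>"
    using f g by (auto simp: algebra_endos_def)
  note flin = linear_mapsD[OF fl] and glin = linear_mapsD[OF gl]
  have key: "r \<odot>\<^bsub>A\<^esub> u = \<zero>\<^bsub>A\<^esub>"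
    if t: "t \<in> traceless" "r \<in> carrier R" "u \<in> traceless" "f t = r \<odot>\<^bsub>A\<^esub> \<one>\<^bsub>A\<^esub> \<oplus>\<^bsub>A\<^esub> u" for t r u
  proof -
    obtain \<rho> where "\<rho> \<in> carrier R" "f t \<otimes>\<^bsub>A\<^esub> f t = \<rho> \<odot>\<^bsub>A\<^esub> \<one>\<^bsub>A\<^esub>"
      using endo_square[OF f t(1)] by blast
    then show ?thesis
      using square_scalar_imp[OF t(2,3)] unfolding t(4) by blast
  qed
  obtain u0 where u0: "u0 \<in> traceless" "f s0 = l (f s0) \<odot>\<^bsub>A\<^esub> \<one>\<^bsub>A\<^esub> \<oplus>\<^bsub>A\<^esub> u0"
    using scalar_plus_traceless[of "f s0"] flin(1) s0' by auto
  obtain u where u: "u \<in> traceless" "f s = l (f s) \<odot>\<^bsub>A\<^esub> \<one>\<^bsub>A\<^esub> \<oplus>\<^bsub>A\<^esub> u"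
    using scalar_plus_traceless[of "f s"] flin(1) s by auto
  define r0 r where "r0 = l (f s0)" and "r = l (f s)"
  have rr: "r0 \<in> carrier R" "r \<in> carrier R"
    using flin(1) s0' s by (auto simp: r0_def r_def)
  note e0 = u0(2)[folded r0_def] and e = u(2)[folded r_def]
  have "r0 \<odot>\<^bsub>A\<^esub> u0 = \<zero>\<^bsub>A\<^esub>" using key[OF s0' rr(1) u0(1) e0] .
  then have "r0 \<odot>\<^bsub>A\<^esub> f s0 = (r0 \<otimes>\<^bsub>R\<^esub> r0) \<odot>\<^bsub>A\<^esub> \<one>\<^bsub>A\<^esub>"
    using rr u0(1) by (simp add: e0 smult_r_distr smult_assoc1)
  then have "g (r0 \<odot>\<^bsub>A\<^esub> f s0) = g ((r0 \<otimes>\<^bsub>R\<^esub> r0) \<odot>\<^bsub>A\<^esub> \<one>\<^bsub>A\<^esub>)" by simp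
  then have eq: "r0 \<odot>\<^bsub>A\<^esub> s0 = (r0 \<otimes>\<^bsub>R\<^esub> r0) \<odot>\<^bsub>A\<^esub> \<one>\<^bsub>A\<^esub>"
    using rr s0' flin(1) glin(3) gf g1 by simp
  then have "l (r0 \<odot>\<^bsub>A\<^esub> s0) = l ((r0 \<otimes>\<^bsub>R\<^esub> r0) \<odot>\<^bsub>A\<^esub> \<one>\<^bsub>A\<^esub>)" by simp
  then have "r0 \<otimes>\<^bsub>R\<^esub> r0 = \<zero>\<^bsub>R\<^esub>" using rr s0' by simp
  then have "r0 \<odot>\<^bsub>A\<^esub> s0 = \<zero>\<^bsub>A\<^esub>" using eq by simp
  then have r0: "r0 = \<zero>\<^bsub>R\<^esub>" using unit_square_cancel[OF s0 rr(1)] by simp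
  have f0: "f s0 = u0" using e0 r0 u0(1) by simp
  have "f (s \<oplus>\<^bsub>A\<^esub> s0) = r \<odot>\<^bsub>A\<^esub> \<one>\<^bsub>A\<^esub> \<oplus>\<^bsub>A\<^esub> (u \<oplus>\<^bsub>A\<^esub> u0)"
    using s s0' rr u(1) u0(1) by (simp add: flin(2) e f0 M.a_assoc)
  then have "r \<odot>\<^bsub>A\<^esub> (u \<oplus>\<^bsub>A\<^esub> u0) = \<zero>\<^bsub>A\<^esub>"
    using key[of "s \<oplus>\<^bsub>A\<^esub> s0" r "u \<oplus>\<^bsub>A\<^esub> u0"] s s0' rr u(1) u0(1) by simp
  moreover have "r \<odot>\<^bsub>A\<^esub> u = \<zero>\<^bsub>A\<^esub>" using key[OF s rr(2) u(1) e] .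
  ultimately have rf: "r \<odot>\<^bsub>A\<^esub> f s0 = \<zero>\<^bsub>A\<^esub>"
    using rr u(1) u0(1) unfolding f0 by (simp add: smult_r_distr)
  have "r \<odot>\<^bsub>A\<^esub> s0 = g (r \<odot>\<^bsub>A\<^esub> f s0)"
    using rr s0' glin(3)[OF rr(2) flin(1), of s0] gf by simp
  also have "\<dots> = \<zero>\<^bsub>A\<^esub>"
    unfolding rf by (rule add_hom_zero[OF abelian_group_axioms abelian_group_axioms glin(4)])
  finally have "r \<odot>\<^bsub>A\<^esub> s0 = \<zero>\<^bsub>A\<^esub>" .
  then have "r = \<zero>\<^bsub>R\<^esub>" using unit_square_cancel[OF s0 rr(2)] by simp
  then show ?thesis using e u(1) by simp
qed

end

text \<open>
  A tensor product of \<open>A\<close> and \<open>B\<close>, described by its bilinear map \<open>p\<close>.  The maps \<open>E\<close> and \<open>E'\<close> are the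
  partial half traces \<open>id \<otimes> l'\<close> and \<open>l \<otimes> id\<close>; they read off the components of \<open>u \<otimes> 1 + 1 \<otimes> v\<close>.  The
  description is symmetric in \<open>A\<close> and \<open>B\<close>, so that lemmas about one factor transfer to the other.
\<close>

locale algebra_product =
  A: quadratic_algebra R A l bar + B: quadratic_algebra R B l' bar' + W: unital_algebra R W
  for R and A and l and bar and B and l' and bar' and W +
  fixes p and E and E' and \<sigma>
  assumes p_closed [simp]: "x \<in> carrier A \<Longrightarrow> y \<in> carrier B \<Longrightarrow> p x y \<in> carrier W"
    and p_add_left: "\<lbrakk>x \<in> carrier A; x' \<in> carrier A; y \<in> carrier B\<rbrakk>
      \<Longrightarrow> p (x \<oplus>\<^bsub>A\<^esub> x') y = p x y \<oplus>\<^bsub>W\<^esub> p x' y"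
    and p_add_right: "\<lbrakk>x \<in> carrier A; y \<in> carrier B; y' \<in> carrier B\<rbrakk>
      \<Longrightarrow> p x (y \<oplus>\<^bsub>B\<^esub> y') = p x y \<oplus>\<^bsub>W\<^esub> p x y'"
    and p_smult_left: "\<lbrakk>r \<in> carrier R; x \<in> carrier A; y \<in> carrier B\<rbrakk>
      \<Longrightarrow> p (r \<odot>\<^bsub>A\<^esub> x) y = r \<odot>\<^bsub>W\<^esub> p x y"
    and p_smult_right: "\<lbrakk>r \<in> carrier R; x \<in> carrier A; y \<in> carrier B\<rbrakk>
      \<Longrightarrow> p x (r \<odot>\<^bsub>B\<^esub> y) = r \<odot>\<^bsub>W\<^esub> p x y"
    and p_mult: "\<lbrakk>x \<in> carrier A; x' \<in> carrier A; y \<in> carrier B; y' \<in> carrier B\<rbrakk>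
      \<Longrightarrow> p x y \<otimes>\<^bsub>W\<^esub> p x' y' = p (x \<otimes>\<^bsub>A\<^esub> x') (y \<otimes>\<^bsub>B\<^esub> y')"
    and p_one: "p \<one>\<^bsub>A\<^esub> \<one>\<^bsub>B\<^esub> = \<one>\<^bsub>W\<^esub>"
    and p_induct: "\<And>P w. \<lbrakk>w \<in> carrier W;
      \<And>x y. x \<in> carrier A \<Longrightarrow> y \<in> carrier B \<Longrightarrow> P (p x y);
      \<And>w w'. w \<in> carrier W \<Longrightarrow> w' \<in> carrier W \<Longrightarrow> P w \<Longrightarrow> P w' \<Longrightarrow> P (w \<oplus>\<^bsub>W\<^esub> w')\<rbrakk> \<Longrightarrow> P w"
    and E_hom: "E \<in> add_hom W A" and E'_hom: "E' \<in> add_hom W B"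
    and E_p: "x \<in> carrier A \<Longrightarrow> y \<in> carrier B \<Longrightarrow> E (p x y) = l' y \<odot>\<^bsub>A\<^esub> x"
    and E'_p: "x \<in> carrier A \<Longrightarrow> y \<in> carrier B \<Longrightarrow> E' (p x y) = l x \<odot>\<^bsub>B\<^esub> y"
    and \<sigma>_hom: "\<sigma> \<in> add_hom W W"
    and \<sigma>_p: "x \<in> carrier A \<Longrightarrow> y \<in> carrier B \<Longrightarrow> \<sigma> (p x y) = p (bar x) (bar' y)"
begin

abbreviation S where "S \<equiv> A.traceless"
abbreviation S' where "S' \<equiv> B.traceless"
abbreviation \<iota> where "\<iota> x \<equiv> p x \<one>\<^bsub>B\<^esub>"
abbreviation \<iota>' where "\<iota>' y \<equiv> p \<one>\<^bsub>A\<^esub> y"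

lemma swapped: "algebra_product R B l' bar' A l bar W (\<lambda>y x. p x y) E' E \<sigma>"
  by unfold_locales
    (auto simp: p_add_left p_add_right p_smult_left p_smult_right p_mult p_one E_p E'_p \<sigma>_p
      E_hom E'_hom \<sigma>_hom intro: p_induct simp del: hom_def)

lemma E_linear: "E \<in> linear_maps R W A"
proof -
  have "E (r \<odot>\<^bsub>W\<^esub> w) = r \<odot>\<^bsub>A\<^esub> E w" if r: "r \<in> carrier R" and w: "w \<in> carrier W" for r w
    using w
  proof (rule p_induct)
    fix x y assume xy: "x \<in> carrier A" "y \<in> carrier B"
    have "E (r \<odot>\<^bsub>W\<^esub> p x y) = E (p (r \<odot>\<^bsub>A\<^esub> x) y)"
      using r xy by (simp add: p_smult_left)
    also have "\<dots> = r \<odot>\<^bsub>A\<^esub> E (p x y)"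
      using r xy by (simp add: E_p A.smult_assoc1[symmetric] A.R.m_comm)
    finally show "E (r \<odot>\<^bsub>W\<^esub> p x y) = r \<odot>\<^bsub>A\<^esub> E (p x y)" .
  next
    fix w w' assume "w \<in> carrier W" "w' \<in> carrier W"
      "E (r \<odot>\<^bsub>W\<^esub> w) = r \<odot>\<^bsub>A\<^esub> E w" "E (r \<odot>\<^bsub>W\<^esub> w') = r \<odot>\<^bsub>A\<^esub> E w'"
    then show "E (r \<odot>\<^bsub>W\<^esub> (w \<oplus>\<^bsub>W\<^esub> w')) = r \<odot>\<^bsub>A\<^esub> E (w \<oplus>\<^bsub>W\<^esub> w')"
      using r E_hom by (simp add: add_hom_iff W.smult_r_distr A.smult_r_distr)
  qed
  then show ?thesis using E_hom by (simp add: linear_maps_def)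
qed

lemma E'_linear: "E' \<in> linear_maps R W B"
  by (rule algebra_product.E_linear[OF swapped])

lemmas E_simps [simp] = linear_mapsD(1-3)[OF E_linear] E_p
lemmas E'_simps [simp] = linear_mapsD(1-3)[OF E'_linear] E'_p

lemma E_one [simp]: "E \<one>\<^bsub>W\<^esub> = \<one>\<^bsub>A\<^esub>"
  using E_p[OF A.unit_closed B.unit_closed] by (simp add: p_one)

lemma E'_one [simp]: "E' \<one>\<^bsub>W\<^esub> = \<one>\<^bsub>B\<^esub>"
  using E'_p[OF A.unit_closed B.unit_closed] by (simp add: p_one)

lemma p_zero_left: "y \<in> carrier B \<Longrightarrow> p \<zero>\<^bsub>A\<^esub> y = \<zero>\<^bsub>W\<^esub>"
  using p_smult_left[of "\<zero>\<^bsub>R\<^esub>" "\<one>\<^bsub>A\<^esub>" y] by simp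

lemma p_zero_right: "x \<in> carrier A \<Longrightarrow> p x \<zero>\<^bsub>B\<^esub> = \<zero>\<^bsub>W\<^esub>"
  using p_smult_right[of "\<zero>\<^bsub>R\<^esub>" x "\<one>\<^bsub>B\<^esub>"] by simp

lemma p_minus_left: "x \<in> carrier A \<Longrightarrow> y \<in> carrier B \<Longrightarrow> p (\<ominus>\<^bsub>A\<^esub> x) y = \<ominus>\<^bsub>W\<^esub> p x y"
  using p_smult_left[of "\<ominus>\<^bsub>R\<^esub> \<one>\<^bsub>R\<^esub>" x y]
  by (simp add: A.smult_l_minus W.smult_l_minus)

lemma p_minus_right: "x \<in> carrier A \<Longrightarrow> y \<in> carrier B \<Longrightarrow> p x (\<ominus>\<^bsub>B\<^esub> y) = \<ominus>\<^bsub>W\<^esub> p x y"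
  using p_smult_right[of "\<ominus>\<^bsub>R\<^esub> \<one>\<^bsub>R\<^esub>" x y]
  by (simp add: B.smult_l_minus W.smult_l_minus)

lemma components_unique:
  assumes "u \<in> S" "v \<in> S'" "u' \<in> S" "v' \<in> S'"
    and eq: "\<iota> u \<oplus>\<^bsub>W\<^esub> \<iota>' v = \<iota> u' \<oplus>\<^bsub>W\<^esub> \<iota>' v'"
  shows "u = u'" "v = v'"
proof -
  have "E (\<iota> u \<oplus>\<^bsub>W\<^esub> \<iota>' v) = u" "E' (\<iota> u \<oplus>\<^bsub>W\<^esub> \<iota>' v) = v"
    "E (\<iota> u' \<oplus>\<^bsub>W\<^esub> \<iota>' v') = u'" "E' (\<iota> u' \<oplus>\<^bsub>W\<^esub> \<iota>' v') = v'"
    using assms(1-4) by simp_all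
  then show "u = u'" "v = v'" unfolding eq by simp_all
qed

text \<open>
  The skew elements for \<open>\<sigma>\<close> are the sums of traceless elements of the two factors: modulo such sums
  every \<open>w\<close> agrees with \<open>\<sigma> w\<close>, so that \<open>2 w\<close> is such a sum when \<open>w\<close> is skew.
\<close>

lemma skew_decomposition:
  assumes w: "w \<in> carrier W" and skew: "\<sigma> w = \<ominus>\<^bsub>W\<^esub> w"
  obtains u v where "u \<in> S" "v \<in> S'" "w = \<iota> u \<oplus>\<^bsub>W\<^esub> \<iota>' v"
proof -
  have \<sigma>_closed: "\<sigma> z \<in> carrier W" if "z \<in> carrier W" for z
    using that \<sigma>_hom by (simp add: add_hom_iff)
  have "\<exists>u \<in> S. \<exists>v \<in> S'. w = \<sigma> w \<oplus>\<^bsub>W\<^esub> (\<iota> u \<oplus>\<^bsub>W\<^esub> \<iota>' v)"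
    using w
  proof (rule p_induct)
    fix x y assume "x \<in> carrier A" "y \<in> carrier B"
    then obtain s t where s: "s \<in> S" "x = l x \<odot>\<^bsub>A\<^esub> \<one>\<^bsub>A\<^esub> \<oplus>\<^bsub>A\<^esub> s"
      and t: "t \<in> S'" "y = l' y \<odot>\<^bsub>B\<^esub> \<one>\<^bsub>B\<^esub> \<oplus>\<^bsub>B\<^esub> t"
      by (metis A.scalar_plus_traceless B.scalar_plus_traceless)
    define \<alpha> \<beta> where "\<alpha> = l x" and "\<beta> = l' y"
    have ab: "\<alpha> \<in> carrier R" "\<beta> \<in> carrier R"
      using \<open>x \<in> carrier A\<close> \<open>y \<in> carrier B\<close> by (simp_all add: \<alpha>_def \<beta>_def)
    define a b where "a = \<alpha> \<odot>\<^bsub>A\<^esub> \<one>\<^bsub>A\<^esub>" and "b = \<beta> \<odot>\<^bsub>B\<^esub> \<one>\<^bsub>B\<^esub>"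
    have x: "x = a \<oplus>\<^bsub>A\<^esub> s" and y: "y = b \<oplus>\<^bsub>B\<^esub> t"
      using s(2) t(2) by (simp_all only: a_def b_def \<alpha>_def \<beta>_def)
    have cl: "a \<in> carrier A" "b \<in> carrier B" "s \<in> carrier A" "t \<in> carrier B"
      using ab s(1) t(1) by (simp_all add: a_def b_def)
    have bx: "bar x = a \<oplus>\<^bsub>A\<^esub> \<ominus>\<^bsub>A\<^esub> s" and bary: "bar' y = b \<oplus>\<^bsub>B\<^esub> \<ominus>\<^bsub>B\<^esub> t"
      unfolding x y using ab s(1) t(1) by (simp_all add: a_def b_def A.bar_eq B.bar_eq)
    let ?q1 = "p a b" and ?q2 = "p a t" and ?q3 = "p s b" and ?q4 = "p s t"
    let ?z = "(?q3 \<oplus>\<^bsub>W\<^esub> ?q3) \<oplus>\<^bsub>W\<^esub> (?q2 \<oplus>\<^bsub>W\<^esub> ?q2)"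
    have 1: "p x y = (?q1 \<oplus>\<^bsub>W\<^esub> ?q2) \<oplus>\<^bsub>W\<^esub> (?q3 \<oplus>\<^bsub>W\<^esub> ?q4)"
      unfolding x y using cl by (simp add: p_add_left p_add_right W.a_ac)
    have 2: "\<sigma> (p x y) = (?q1 \<oplus>\<^bsub>W\<^esub> \<ominus>\<^bsub>W\<^esub> ?q2) \<oplus>\<^bsub>W\<^esub> (\<ominus>\<^bsub>W\<^esub> ?q3 \<oplus>\<^bsub>W\<^esub> ?q4)"
      using \<open>x \<in> carrier A\<close> \<open>y \<in> carrier B\<close> cl
      by (simp add: \<sigma>_p bx bary p_add_left p_add_right p_minus_left p_minus_right W.minus_add W.a_ac)
    have "\<sigma> (p x y) \<oplus>\<^bsub>W\<^esub> ?z =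
        (\<ominus>\<^bsub>W\<^esub> ?q2 \<oplus>\<^bsub>W\<^esub> ?q2) \<oplus>\<^bsub>W\<^esub> ((\<ominus>\<^bsub>W\<^esub> ?q3 \<oplus>\<^bsub>W\<^esub> ?q3) \<oplus>\<^bsub>W\<^esub> p x y)"
      unfolding 2 unfolding 1 using cl by (simp add: W.a_ac)
    also have "\<dots> = p x y"
      using \<open>x \<in> carrier A\<close> \<open>y \<in> carrier B\<close> cl by (simp add: W.l_neg)
    finally have 3: "p x y = \<sigma> (p x y) \<oplus>\<^bsub>W\<^esub> ?z" by (rule sym)
    have "?z = \<iota> ((\<beta> \<oplus>\<^bsub>R\<^esub> \<beta>) \<odot>\<^bsub>A\<^esub> s) \<oplus>\<^bsub>W\<^esub> \<iota>' ((\<alpha> \<oplus>\<^bsub>R\<^esub> \<alpha>) \<odot>\<^bsub>B\<^esub> t)"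
      using ab cl by (simp add: a_def b_def p_smult_left p_smult_right W.smult_l_distr)
    moreover have "(\<beta> \<oplus>\<^bsub>R\<^esub> \<beta>) \<odot>\<^bsub>A\<^esub> s \<in> S" "(\<alpha> \<oplus>\<^bsub>R\<^esub> \<alpha>) \<odot>\<^bsub>B\<^esub> t \<in> S'"
      using ab s(1) t(1) by simp_all
    ultimately show "\<exists>u \<in> S. \<exists>v \<in> S'. p x y = \<sigma> (p x y) \<oplus>\<^bsub>W\<^esub> (\<iota> u \<oplus>\<^bsub>W\<^esub> \<iota>' v)"
      using 3 by metis
  next
    fix w w'
    assume cl: "w \<in> carrier W" "w' \<in> carrier W"
      and "\<exists>u \<in> S. \<exists>v \<in> S'. w = \<sigma> w \<oplus>\<^bsub>W\<^esub> (\<iota> u \<oplus>\<^bsub>W\<^esub> \<iota>' v)"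
      and "\<exists>u \<in> S. \<exists>v \<in> S'. w' = \<sigma> w' \<oplus>\<^bsub>W\<^esub> (\<iota> u \<oplus>\<^bsub>W\<^esub> \<iota>' v)"
    then obtain u v u' v' where uv: "u \<in> S" "v \<in> S'" "u' \<in> S" "v' \<in> S'"
      and e: "w = \<sigma> w \<oplus>\<^bsub>W\<^esub> (\<iota> u \<oplus>\<^bsub>W\<^esub> \<iota>' v)" "w' = \<sigma> w' \<oplus>\<^bsub>W\<^esub> (\<iota> u' \<oplus>\<^bsub>W\<^esub> \<iota>' v')"
      by blast
    have "w \<oplus>\<^bsub>W\<^esub> w' =
        (\<sigma> w \<oplus>\<^bsub>W\<^esub> (\<iota> u \<oplus>\<^bsub>W\<^esub> \<iota>' v)) \<oplus>\<^bsub>W\<^esub> (\<sigma> w' \<oplus>\<^bsub>W\<^esub> (\<iota> u' \<oplus>\<^bsub>W\<^esub> \<iota>' v'))"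
      by (rule arg_cong2[OF e])
    also have "\<dots> = (\<sigma> w \<oplus>\<^bsub>W\<^esub> \<sigma> w') \<oplus>\<^bsub>W\<^esub> (\<iota> (u \<oplus>\<^bsub>A\<^esub> u') \<oplus>\<^bsub>W\<^esub> \<iota>' (v \<oplus>\<^bsub>B\<^esub> v'))"
      using uv cl by (simp add: p_add_left p_add_right \<sigma>_closed W.a_ac)
    also have "\<sigma> w \<oplus>\<^bsub>W\<^esub> \<sigma> w' = \<sigma> (w \<oplus>\<^bsub>W\<^esub> w')"
      using cl \<sigma>_hom by (simp add: add_hom_iff)
    finally show "\<exists>u \<in> S. \<exists>v \<in> S'. w \<oplus>\<^bsub>W\<^esub> w' = \<sigma> (w \<oplus>\<^bsub>W\<^esub> w') \<oplus>\<^bsub>W\<^esub> (\<iota> u \<oplus>\<^bsub>W\<^esub> \<iota>' v)"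
      using uv by (meson A.traceless_simps(4) B.traceless_simps(4))
  qed
  then obtain u v where uv: "u \<in> S" "v \<in> S'" "w = \<sigma> w \<oplus>\<^bsub>W\<^esub> (\<iota> u \<oplus>\<^bsub>W\<^esub> \<iota>' v)" by blast
  let ?z = "\<iota> u \<oplus>\<^bsub>W\<^esub> \<iota>' v"
  have z: "?z \<in> carrier W" using uv by simp
  have "w \<oplus>\<^bsub>W\<^esub> w = w \<oplus>\<^bsub>W\<^esub> (\<ominus>\<^bsub>W\<^esub> w \<oplus>\<^bsub>W\<^esub> ?z)"
    using uv(3) unfolding skew by (rule arg_cong)
  also have "\<dots> = ?z" using w z by (rule W.r_neg2)
  finally have ww: "w \<oplus>\<^bsub>W\<^esub> w = ?z" .
  obtain h where h: "h \<in> carrier R" "h \<oplus>\<^bsub>R\<^esub> h = \<one>\<^bsub>R\<^esub>" using A.half by blast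
  have "w = (h \<oplus>\<^bsub>R\<^esub> h) \<odot>\<^bsub>W\<^esub> w" using w h by simp
  also have "\<dots> = h \<odot>\<^bsub>W\<^esub> (w \<oplus>\<^bsub>W\<^esub> w)" using w h(1) by (simp add: W.smult_l_distr W.smult_r_distr)
  also have "\<dots> = \<iota> (h \<odot>\<^bsub>A\<^esub> u) \<oplus>\<^bsub>W\<^esub> \<iota>' (h \<odot>\<^bsub>B\<^esub> v)"
    unfolding ww using uv(1,2) h(1) by (simp add: p_smult_left p_smult_right W.smult_r_distr)
  finally show ?thesis
    using that[of "h \<odot>\<^bsub>A\<^esub> u" "h \<odot>\<^bsub>B\<^esub> v"] uv(1,2) h(1) by simp
qed

lemma \<iota>_mult: "x \<in> carrier A \<Longrightarrow> x' \<in> carrier A \<Longrightarrow> \<iota> x \<otimes>\<^bsub>W\<^esub> \<iota> x' = \<iota> (x \<otimes>\<^bsub>A\<^esub> x')"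
  by (simp add: p_mult)

text \<open>
  The square of \<open>u \<otimes> 1 + 1 \<otimes> v\<close> is \<open>\<mu> + \<kappa> + 2 (u \<otimes> v)\<close>, and \<open>E\<close> annihilates \<open>u \<otimes> v\<close> because \<open>l' v = 0\<close>.
\<close>

lemma scalar_square_imp:
  assumes u: "u \<in> S" "u \<otimes>\<^bsub>A\<^esub> u = \<mu> \<odot>\<^bsub>A\<^esub> \<one>\<^bsub>A\<^esub>" and v: "v \<in> S'" "v \<otimes>\<^bsub>B\<^esub> v = \<kappa> \<odot>\<^bsub>B\<^esub> \<one>\<^bsub>B\<^esub>"
    and c: "\<mu> \<in> carrier R" "\<kappa> \<in> carrier R" "\<rho> \<in> carrier R"
    and sq: "(\<iota> u \<oplus>\<^bsub>W\<^esub> \<iota>' v) \<otimes>\<^bsub>W\<^esub> (\<iota> u \<oplus>\<^bsub>W\<^esub> \<iota>' v) = \<rho> \<odot>\<^bsub>W\<^esub> \<one>\<^bsub>W\<^esub>"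
  shows "\<mu> \<oplus>\<^bsub>R\<^esub> \<kappa> = \<rho>" "p u v = \<zero>\<^bsub>W\<^esub>"
proof -
  let ?d = "p u v \<oplus>\<^bsub>W\<^esub> p u v"
  have eq: "\<rho> \<odot>\<^bsub>W\<^esub> \<one>\<^bsub>W\<^esub> = (\<mu> \<oplus>\<^bsub>R\<^esub> \<kappa>) \<odot>\<^bsub>W\<^esub> \<one>\<^bsub>W\<^esub> \<oplus>\<^bsub>W\<^esub> ?d"
    unfolding sq[symmetric] using u v c
    by (simp add: W.mult_add_left W.mult_add_right p_mult p_smult_left p_smult_right p_one
        W.smult_l_distr W.a_ac W.unit_closed)
  have "E (\<rho> \<odot>\<^bsub>W\<^esub> \<one>\<^bsub>W\<^esub>) = E ((\<mu> \<oplus>\<^bsub>R\<^esub> \<kappa>) \<odot>\<^bsub>W\<^esub> \<one>\<^bsub>W\<^esub> \<oplus>\<^bsub>W\<^esub> ?d)"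
    by (rule arg_cong[OF eq])
  then have "\<rho> \<odot>\<^bsub>A\<^esub> \<one>\<^bsub>A\<^esub> = (\<mu> \<oplus>\<^bsub>R\<^esub> \<kappa>) \<odot>\<^bsub>A\<^esub> \<one>\<^bsub>A\<^esub>"
    using u(1) v(1) c by (simp add: W.unit_closed)
  then have \<rho>: "\<rho> = \<mu> \<oplus>\<^bsub>R\<^esub> \<kappa>" using c by (intro A.smult_one_cancel) auto
  then show "\<mu> \<oplus>\<^bsub>R\<^esub> \<kappa> = \<rho>" by simp
  have "\<rho> \<odot>\<^bsub>W\<^esub> \<one>\<^bsub>W\<^esub> = \<rho> \<odot>\<^bsub>W\<^esub> \<one>\<^bsub>W\<^esub> \<oplus>\<^bsub>W\<^esub> ?d"
    using eq unfolding \<rho>[symmetric] .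
  then have "?d = \<zero>\<^bsub>W\<^esub>"
    by (rule iffD1[OF W.add.l_cancel_one', rotated 2])
      (use u(1) v(1) c in \<open>auto simp: W.unit_closed\<close>)
  moreover have "p u v \<in> carrier W" using u v by simp
  ultimately show "p u v = \<zero>\<^bsub>W\<^esub>"
    using A.half W.double_zero by blast
qed

definition inv_endos where
  "inv_endos = {f \<in> linear_maps R W W.
     (\<forall>w \<in> carrier W. \<forall>w' \<in> carrier W. f (w \<otimes>\<^bsub>W\<^esub> w') = f w \<otimes>\<^bsub>W\<^esub> f w') \<and> f \<one>\<^bsub>W\<^esub> = \<one>\<^bsub>W\<^esub> \<and>
     (\<forall>w \<in> carrier W. f (\<sigma> w) = \<sigma> (f w))}"

lemma inv_endosD:
  assumes "f \<in> inv_endos"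
  shows "f \<in> linear_maps R W W" "\<And>w. w \<in> carrier W \<Longrightarrow> f w \<in> carrier W"
    "\<And>w w'. w \<in> carrier W \<Longrightarrow> w' \<in> carrier W \<Longrightarrow> f (w \<oplus>\<^bsub>W\<^esub> w') = f w \<oplus>\<^bsub>W\<^esub> f w'"
    "\<And>r w. r \<in> carrier R \<Longrightarrow> w \<in> carrier W \<Longrightarrow> f (r \<odot>\<^bsub>W\<^esub> w) = r \<odot>\<^bsub>W\<^esub> f w"
    "\<And>w w'. w \<in> carrier W \<Longrightarrow> w' \<in> carrier W \<Longrightarrow> f (w \<otimes>\<^bsub>W\<^esub> w') = f w \<otimes>\<^bsub>W\<^esub> f w'"
    "f \<one>\<^bsub>W\<^esub> = \<one>\<^bsub>W\<^esub>" "\<And>w. w \<in> carrier W \<Longrightarrow> f (\<sigma> w) = \<sigma> (f w)"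
    "f \<zero>\<^bsub>W\<^esub> = \<zero>\<^bsub>W\<^esub>"
proof -
  show l: "f \<in> linear_maps R W W" using assms by (simp add: inv_endos_def)
  show "f \<zero>\<^bsub>W\<^esub> = \<zero>\<^bsub>W\<^esub>"
    by (rule add_hom_zero[OF W.abelian_group_axioms W.abelian_group_axioms linear_maps_add_hom[OF l]])
  note linear_mapsD[OF l]
  then show "\<And>w. w \<in> carrier W \<Longrightarrow> f w \<in> carrier W"
    "\<And>w w'. w \<in> carrier W \<Longrightarrow> w' \<in> carrier W \<Longrightarrow> f (w \<oplus>\<^bsub>W\<^esub> w') = f w \<oplus>\<^bsub>W\<^esub> f w'"
    "\<And>r w. r \<in> carrier R \<Longrightarrow> w \<in> carrier W \<Longrightarrow> f (r \<odot>\<^bsub>W\<^esub> w) = r \<odot>\<^bsub>W\<^esub> f w"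
    by blast+
qed (use assms in \<open>auto simp: inv_endos_def\<close>)

lemma endo_components:
  assumes f: "f \<in> inv_endos" and s: "s \<in> S"
  obtains a c where "a \<in> S" "c \<in> S'" "f (\<iota> s) = \<iota> a \<oplus>\<^bsub>W\<^esub> \<iota>' c"
proof -
  note fs = inv_endosD[OF f]
  have cl: "\<iota> s \<in> carrier W" using s by simp
  have "\<sigma> (\<iota> s) = \<ominus>\<^bsub>W\<^esub> \<iota> s" using s by (simp add: \<sigma>_p p_minus_left)
  then have "\<sigma> (f (\<iota> s)) = f (\<ominus>\<^bsub>W\<^esub> \<iota> s)" using fs(7)[OF cl] by simp
  also have "\<dots> = \<ominus>\<^bsub>W\<^esub> f (\<iota> s)"
    by (rule add_hom_a_inv[OF W.abelian_group_axioms W.abelian_group_axioms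
          linear_maps_add_hom[OF fs(1)] cl])
  finally show ?thesis using skew_decomposition[OF fs(2)[OF cl]] that by blast
qed

lemma endo_square:
  assumes f: "f \<in> inv_endos" and s: "s \<in> S" "s \<otimes>\<^bsub>A\<^esub> s = \<rho> \<odot>\<^bsub>A\<^esub> \<one>\<^bsub>A\<^esub>" and \<rho>: "\<rho> \<in> carrier R"
  shows "f (\<iota> s) \<otimes>\<^bsub>W\<^esub> f (\<iota> s) = \<rho> \<odot>\<^bsub>W\<^esub> \<one>\<^bsub>W\<^esub>"
proof -
  note fs = inv_endosD[OF f]
  have "f (\<iota> s) \<otimes>\<^bsub>W\<^esub> f (\<iota> s) = f (\<iota> s \<otimes>\<^bsub>W\<^esub> \<iota> s)" using s(1) by (simp add: fs(5))
  also have "\<iota> s \<otimes>\<^bsub>W\<^esub> \<iota> s = \<rho> \<odot>\<^bsub>W\<^esub> \<one>\<^bsub>W\<^esub>"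
    using s \<rho> by (simp add: p_mult p_smult_left p_one)
  also have "f \<dots> = \<rho> \<odot>\<^bsub>W\<^esub> \<one>\<^bsub>W\<^esub>" using fs(4)[OF \<rho> W.unit_closed] fs(6) by simp
  finally show ?thesis .
qed

lemma endo_components_product:
  assumes f: "f \<in> inv_endos" and s: "s \<in> S" and ac: "a \<in> S" "c \<in> S'"
    and eq: "f (\<iota> s) = \<iota> a \<oplus>\<^bsub>W\<^esub> \<iota>' c"
  shows "p a c = \<zero>\<^bsub>W\<^esub>"
proof -
  obtain \<rho> where \<rho>: "\<rho> \<in> carrier R" "s \<otimes>\<^bsub>A\<^esub> s = \<rho> \<odot>\<^bsub>A\<^esub> \<one>\<^bsub>A\<^esub>"
    using A.traceless_square[of s] s by auto
  obtain \<mu> where \<mu>: "\<mu> \<in> carrier R" "a \<otimes>\<^bsub>A\<^esub> a = \<mu> \<odot>\<^bsub>A\<^esub> \<one>\<^bsub>A\<^esub>"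
    using A.traceless_square[of a] ac by auto
  obtain \<kappa> where \<kappa>: "\<kappa> \<in> carrier R" "c \<otimes>\<^bsub>B\<^esub> c = \<kappa> \<odot>\<^bsub>B\<^esub> \<one>\<^bsub>B\<^esub>"
    using B.traceless_square[of c] ac by auto
  show ?thesis
    using scalar_square_imp(2)[OF ac(1) \<mu>(2) ac(2) \<kappa>(2) \<mu>(1) \<kappa>(1) \<rho>(1)]
      endo_square[OF f s \<rho>(2,1)] unfolding eq by blast
qed

text \<open>
  If \<open>s\<^sub>0\<close> is traceless with square \<open>\<nu>\<close> and \<open>f s\<^sub>0 = a\<^sub>0 + c\<^sub>0\<close>, the squares \<open>\<mu>\<close> of \<open>a\<^sub>0\<close> and \<open>\<kappa>\<close> of \<open>c\<^sub>0\<close>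
  add up to \<open>\<nu>\<close>.  Multiplication by \<open>\<mu>\<close> cuts out the part of the base on which \<open>f\<close> maps
  the traceless elements of \<open>A\<close> to \<open>A\<close>, multiplication by \<open>\<kappa>\<close> the part on which it maps them to
  \<open>B\<close>: polarizing \<open>a\<^sub>0 \<otimes> c\<^sub>0 = 0\<close> gives \<open>a\<^sub>0 \<otimes> c = - a \<otimes> c\<^sub>0\<close>, and multiplication by \<open>a\<^sub>0\<close> or \<open>c\<^sub>0\<close>
  yields \<open>\<mu> c = 0\<close> and \<open>\<kappa> a = 0\<close>.
\<close>

lemma base_splits:
  assumes f: "f \<in> inv_endos" and s0: "s\<^sub>0 \<in> S" "s\<^sub>0 \<otimes>\<^bsub>A\<^esub> s\<^sub>0 = \<nu> \<odot>\<^bsub>A\<^esub> \<one>\<^bsub>A\<^esub>" and \<nu>: "\<nu> \<in> carrier R"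
  obtains \<mu> \<kappa> where "\<mu> \<in> carrier R" "\<kappa> \<in> carrier R" "\<mu> \<oplus>\<^bsub>R\<^esub> \<kappa> = \<nu>"
    "\<And>s a c. \<lbrakk>s \<in> S; a \<in> S; c \<in> S'; f (\<iota> s) = \<iota> a \<oplus>\<^bsub>W\<^esub> \<iota>' c\<rbrakk>
      \<Longrightarrow> \<mu> \<odot>\<^bsub>B\<^esub> c = \<zero>\<^bsub>B\<^esub> \<and> \<kappa> \<odot>\<^bsub>A\<^esub> a = \<zero>\<^bsub>A\<^esub>"
proof -
  note fs = inv_endosD[OF f]
  obtain a0 c0 where ac0: "a0 \<in> S" "c0 \<in> S'" and eq0: "f (\<iota> s\<^sub>0) = \<iota> a0 \<oplus>\<^bsub>W\<^esub> \<iota>' c0"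
    using endo_components[OF f s0(1)] by blast
  obtain \<mu> where \<mu>: "\<mu> \<in> carrier R" "a0 \<otimes>\<^bsub>A\<^esub> a0 = \<mu> \<odot>\<^bsub>A\<^esub> \<one>\<^bsub>A\<^esub>"
    using A.traceless_square[of a0] ac0 by auto
  obtain \<kappa> where \<kappa>: "\<kappa> \<in> carrier R" "c0 \<otimes>\<^bsub>B\<^esub> c0 = \<kappa> \<odot>\<^bsub>B\<^esub> \<one>\<^bsub>B\<^esub>"
    using B.traceless_square[of c0] ac0 by auto
  have sq: "(\<iota> a0 \<oplus>\<^bsub>W\<^esub> \<iota>' c0) \<otimes>\<^bsub>W\<^esub> (\<iota> a0 \<oplus>\<^bsub>W\<^esub> \<iota>' c0) = \<nu> \<odot>\<^bsub>W\<^esub> \<one>\<^bsub>W\<^esub>"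
    using endo_square[OF f s0 \<nu>] unfolding eq0 .
  note prod0 = scalar_square_imp[OF ac0(1) \<mu>(2) ac0(2) \<kappa>(2) \<mu>(1) \<kappa>(1) \<nu> sq]
  have key: "\<mu> \<odot>\<^bsub>B\<^esub> c = \<zero>\<^bsub>B\<^esub> \<and> \<kappa> \<odot>\<^bsub>A\<^esub> a = \<zero>\<^bsub>A\<^esub>"
    if s: "s \<in> S" and ac: "a \<in> S" "c \<in> S'" and eq: "f (\<iota> s) = \<iota> a \<oplus>\<^bsub>W\<^esub> \<iota>' c" for s a c
  proof -
    have cl: "a \<in> carrier A" "c \<in> carrier B" "a0 \<in> carrier A" "c0 \<in> carrier B"
      using ac ac0 by simp_all
    have "f (\<iota> (s \<oplus>\<^bsub>A\<^esub> s\<^sub>0)) = f (\<iota> s) \<oplus>\<^bsub>W\<^esub> f (\<iota> s\<^sub>0)"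
      using s s0(1) by (simp add: p_add_left fs(3))
    also have "\<dots> = \<iota> (a \<oplus>\<^bsub>A\<^esub> a0) \<oplus>\<^bsub>W\<^esub> \<iota>' (c \<oplus>\<^bsub>B\<^esub> c0)"
      unfolding eq eq0 using cl by (simp add: p_add_left p_add_right W.a_ac)
    finally have "p (a \<oplus>\<^bsub>A\<^esub> a0) (c \<oplus>\<^bsub>B\<^esub> c0) = \<zero>\<^bsub>W\<^esub>"
      using endo_components_product[OF f, of "s \<oplus>\<^bsub>A\<^esub> s\<^sub>0"] s s0(1) ac ac0 by simp
    moreover have "p a c = \<zero>\<^bsub>W\<^esub>" by (rule endo_components_product[OF f s ac eq])
    ultimately have pol: "p a0 c \<oplus>\<^bsub>W\<^esub> p a c0 = \<zero>\<^bsub>W\<^esub>"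
      using cl prod0(2) by (simp add: p_add_left p_add_right W.a_comm)
    have "\<zero>\<^bsub>W\<^esub> = \<iota> a0 \<otimes>\<^bsub>W\<^esub> (p a0 c \<oplus>\<^bsub>W\<^esub> p a c0)"
      unfolding pol using cl by (simp add: W.mult_zero_right)
    also have "\<dots> = p (a0 \<otimes>\<^bsub>A\<^esub> a0) c \<oplus>\<^bsub>W\<^esub> p a0 c0 \<otimes>\<^bsub>W\<^esub> \<iota> a"
      using cl by (simp add: W.mult_add_right p_mult)
    also have "\<dots> = \<mu> \<odot>\<^bsub>W\<^esub> \<iota>' c"
      unfolding prod0(2) \<mu>(2) using cl \<mu>(1) by (simp add: W.mult_zero_left p_smult_left)
    finally have "E' (\<mu> \<odot>\<^bsub>W\<^esub> \<iota>' c) = E' \<zero>\<^bsub>W\<^esub>" by simp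
    then have 1: "\<mu> \<odot>\<^bsub>B\<^esub> c = \<zero>\<^bsub>B\<^esub>"
      using cl \<mu>(1) add_hom_zero[OF W.abelian_group_axioms B.abelian_group_axioms E'_hom] by simp
    have "\<zero>\<^bsub>W\<^esub> = (p a0 c \<oplus>\<^bsub>W\<^esub> p a c0) \<otimes>\<^bsub>W\<^esub> \<iota>' c0"
      unfolding pol using cl by (simp add: W.mult_zero_left)
    also have "\<dots> = \<iota>' c \<otimes>\<^bsub>W\<^esub> p a0 c0 \<oplus>\<^bsub>W\<^esub> p a (c0 \<otimes>\<^bsub>B\<^esub> c0)"
      using cl by (simp add: W.mult_add_left p_mult)
    also have "\<dots> = \<kappa> \<odot>\<^bsub>W\<^esub> \<iota> a"
      unfolding prod0(2) \<kappa>(2) using cl \<kappa>(1) by (simp add: W.mult_zero_right p_smult_right)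
    finally have "E (\<kappa> \<odot>\<^bsub>W\<^esub> \<iota> a) = E \<zero>\<^bsub>W\<^esub>" by simp
    then have "\<kappa> \<odot>\<^bsub>A\<^esub> a = \<zero>\<^bsub>A\<^esub>"
      using cl \<kappa>(1) add_hom_zero[OF W.abelian_group_axioms A.abelian_group_axioms E_hom] by simp
    then show ?thesis using 1 by simp
  qed
  show ?thesis using that[OF \<mu>(1) \<kappa>(1) prod0(1)] key by blast
qed

text \<open>
  On no part of the base can both factors be mapped to \<open>B\<close>: by surjectivity \<open>s\<^sub>0 \<otimes> 1\<close> is the image of some
  \<open>s \<otimes> 1 + 1 \<otimes> t\<close>, so \<open>r\<close> annihilates \<open>s\<^sub>0\<close>, whose square is invertible.
\<close>

lemma no_merge:
  assumes f: "f \<in> inv_endos" and g: "g \<in> inv_endos" and fg: "\<And>w. w \<in> carrier W \<Longrightarrow> f (g w) = w"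
    and s0: "A.unit_square s\<^sub>0" and r: "r \<in> carrier R"
    and fA: "\<And>s a c. \<lbrakk>s \<in> S; a \<in> S; c \<in> S'; f (\<iota> s) = \<iota> a \<oplus>\<^bsub>W\<^esub> \<iota>' c\<rbrakk> \<Longrightarrow> r \<odot>\<^bsub>A\<^esub> a = \<zero>\<^bsub>A\<^esub>"
    and fB: "\<And>t a c. \<lbrakk>t \<in> S'; a \<in> S; c \<in> S'; f (\<iota>' t) = \<iota> a \<oplus>\<^bsub>W\<^esub> \<iota>' c\<rbrakk> \<Longrightarrow> r \<odot>\<^bsub>A\<^esub> a = \<zero>\<^bsub>A\<^esub>"
  shows "r = \<zero>\<^bsub>R\<^esub>"
proof -
  interpret sw: algebra_product R B l' bar' A l bar W "\<lambda>y x. p x y" E' E \<sigma> by (rule swapped)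
  note fs = inv_endosD[OF f] and gs = inv_endosD[OF g]
  have s0': "s\<^sub>0 \<in> S" using s0 by (simp add: A.unit_square_def)
  obtain s t where st: "s \<in> S" "t \<in> S'" "g (\<iota> s\<^sub>0) = \<iota> s \<oplus>\<^bsub>W\<^esub> \<iota>' t"
    using endo_components[OF g s0'] by blast
  obtain a c where ac: "a \<in> S" "c \<in> S'" "f (\<iota> s) = \<iota> a \<oplus>\<^bsub>W\<^esub> \<iota>' c"
    using endo_components[OF f st(1)] by blast
  obtain c' a' where ac': "c' \<in> S'" "a' \<in> S" "f (\<iota>' t) = \<iota>' c' \<oplus>\<^bsub>W\<^esub> \<iota> a'"
    using sw.endo_components[OF f st(2)] by blast
  have e': "f (\<iota>' t) = \<iota> a' \<oplus>\<^bsub>W\<^esub> \<iota>' c'"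
    unfolding ac'(3) using ac'(1,2) by (simp add: W.a_comm)
  have "\<iota> s\<^sub>0 \<oplus>\<^bsub>W\<^esub> \<iota>' \<zero>\<^bsub>B\<^esub> = f (g (\<iota> s\<^sub>0))"
    using s0' by (simp add: fg p_zero_right)
  also have "\<dots> = (\<iota> a \<oplus>\<^bsub>W\<^esub> \<iota>' c) \<oplus>\<^bsub>W\<^esub> (\<iota> a' \<oplus>\<^bsub>W\<^esub> \<iota>' c')"
    unfolding st(3) using st(1,2) by (simp add: fs(3) ac(3) e')
  also have "\<dots> = \<iota> (a \<oplus>\<^bsub>A\<^esub> a') \<oplus>\<^bsub>W\<^esub> \<iota>' (c \<oplus>\<^bsub>B\<^esub> c')"
    using ac(1,2) ac'(1,2) by (simp add: p_add_left p_add_right W.a_ac)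
  finally have "s\<^sub>0 = a \<oplus>\<^bsub>A\<^esub> a'"
    by (rule components_unique(1)[rotated 4]) (use s0' ac(1,2) ac'(1,2) in auto)
  then have "r \<odot>\<^bsub>A\<^esub> s\<^sub>0 = \<zero>\<^bsub>A\<^esub>"
    using r ac(1,2) ac'(1,2) fA[OF st(1) ac] fB[OF st(2) ac'(2,1) e'] by (simp add: A.smult_r_distr)
  then show ?thesis using A.unit_square_cancel[OF s0 r] by simp
qed

text \<open>
  Where \<open>f\<close> exchanges the factors, it induces maps \<open>G\<close> from \<open>A\<close> to \<open>B\<close> and \<open>H\<close> back that become
  inverse to each other after multiplication by \<open>\<theta>\<close>.  The two composites have equal traces, and
  \<open>\<theta>\<close> times these traces is \<open>\<theta>\<close> times the rank of \<open>A\<close> and of \<open>B\<close>, respectively.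
\<close>

lemma no_swap:
  assumes f: "f \<in> inv_endos" and g: "g \<in> inv_endos"
    and fg: "\<And>w. w \<in> carrier W \<Longrightarrow> f (g w) = w" and gf: "\<And>w. w \<in> carrier W \<Longrightarrow> g (f w) = w"
    and \<theta>: "\<theta> \<in> carrier R"
    and fA: "\<And>s a c. \<lbrakk>s \<in> S; a \<in> S; c \<in> S'; f (\<iota> s) = \<iota> a \<oplus>\<^bsub>W\<^esub> \<iota>' c\<rbrakk> \<Longrightarrow> \<theta> \<odot>\<^bsub>A\<^esub> a = \<zero>\<^bsub>A\<^esub>"
    and fB: "\<And>t a c. \<lbrakk>t \<in> S'; a \<in> S; c \<in> S'; f (\<iota>' t) = \<iota> a \<oplus>\<^bsub>W\<^esub> \<iota>' c\<rbrakk> \<Longrightarrow> \<theta> \<odot>\<^bsub>B\<^esub> c = \<zero>\<^bsub>B\<^esub>"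
    and x: "dual_basis R A I x \<xi>" and y: "dual_basis R B J y \<eta>"
  shows "[card I] \<cdot>\<^bsub>R\<^esub> \<theta> = [card J] \<cdot>\<^bsub>R\<^esub> \<theta>"
proof -
  interpret sw: algebra_product R B l' bar' A l bar W "\<lambda>y x. p x y" E' E \<sigma> by (rule swapped)
  note fs = inv_endosD[OF f] and gs = inv_endosD[OF g]
  note [simp] = A.unit_closed B.unit_closed W.unit_closed
  define G where "G u = E' (f (\<iota> u))" for u
  define H where "H v = E (g (\<iota>' v))" for v
  have G: "G \<in> linear_maps R A B"
    by (simp add: linear_maps_def add_hom_iff G_def fs p_add_left p_smult_left)
  have H: "H \<in> linear_maps R B A"
    by (simp add: linear_maps_def add_hom_iff H_def gs p_add_right p_smult_right)
  have G_one: "G \<one>\<^bsub>A\<^esub> = \<one>\<^bsub>B\<^esub>" and H_one: "H \<one>\<^bsub>B\<^esub> = \<one>\<^bsub>A\<^esub>"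
    by (simp_all add: G_def H_def p_one fs gs)
  have G_S: "G s = c" if "a \<in> S" "c \<in> S'" "f (\<iota> s) = \<iota> a \<oplus>\<^bsub>W\<^esub> \<iota>' c" for s a c
    using that by (simp add: G_def)
  have HG_S: "\<theta> \<odot>\<^bsub>A\<^esub> H (G s) = \<theta> \<odot>\<^bsub>A\<^esub> s" if s: "s \<in> S" for s
  proof -
    obtain a c where ac: "a \<in> S" "c \<in> S'" "f (\<iota> s) = \<iota> a \<oplus>\<^bsub>W\<^esub> \<iota>' c"
      using endo_components[OF f s] by blast
    have "\<theta> \<odot>\<^bsub>W\<^esub> \<iota> a = \<zero>\<^bsub>W\<^esub>"
      using p_smult_left[of \<theta> a "\<one>\<^bsub>B\<^esub>"] fA[OF s ac] \<theta> ac by (simp add: p_zero_left)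
    then have \<theta>f: "\<theta> \<odot>\<^bsub>W\<^esub> f (\<iota> s) = \<theta> \<odot>\<^bsub>W\<^esub> \<iota>' c"
      unfolding ac(3) using \<theta> ac(1,2) by (simp add: W.smult_r_distr)
    have "\<theta> \<odot>\<^bsub>A\<^esub> H (G s) = E (g (\<theta> \<odot>\<^bsub>W\<^esub> \<iota>' c))"
      using \<theta> ac(1,2) by (simp add: G_S[OF ac] H_def gs)
    also have "\<dots> = E (\<theta> \<odot>\<^bsub>W\<^esub> g (f (\<iota> s)))"
      unfolding \<theta>f[symmetric] using \<theta> s by (simp add: gs fs)
    also have "\<dots> = \<theta> \<odot>\<^bsub>A\<^esub> s" using \<theta> s by (simp add: gf)
    finally show ?thesis .
  qed
  have GH_S: "\<theta> \<odot>\<^bsub>B\<^esub> G (H t) = \<theta> \<odot>\<^bsub>B\<^esub> t" if t: "t \<in> S'" for t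
  proof -
    obtain v u where uv: "v \<in> S'" "u \<in> S" "g (\<iota>' t) = \<iota>' v \<oplus>\<^bsub>W\<^esub> \<iota> u"
      using sw.endo_components[OF g t] by blast
    obtain a c where ac: "a \<in> S" "c \<in> S'" "f (\<iota> u) = \<iota> a \<oplus>\<^bsub>W\<^esub> \<iota>' c"
      using endo_components[OF f uv(2)] by blast
    obtain c' a' where ac': "c' \<in> S'" "a' \<in> S" "f (\<iota>' v) = \<iota>' c' \<oplus>\<^bsub>W\<^esub> \<iota> a'"
      using sw.endo_components[OF f uv(1)] by blast
    have e': "f (\<iota>' v) = \<iota> a' \<oplus>\<^bsub>W\<^esub> \<iota>' c'"
      unfolding ac'(3) using ac'(1,2) by (simp add: W.a_comm)
    have Ht: "H t = u" using uv by (simp add: H_def)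
    have "\<iota> \<zero>\<^bsub>A\<^esub> \<oplus>\<^bsub>W\<^esub> \<iota>' t = f (g (\<iota>' t))"
      using t by (simp add: fg p_zero_left)
    also have "\<dots> = (\<iota> a' \<oplus>\<^bsub>W\<^esub> \<iota>' c') \<oplus>\<^bsub>W\<^esub> (\<iota> a \<oplus>\<^bsub>W\<^esub> \<iota>' c)"
      unfolding uv(3) using uv(1,2) by (simp add: fs(3) ac(3) e')
    also have "\<dots> = \<iota> (a' \<oplus>\<^bsub>A\<^esub> a) \<oplus>\<^bsub>W\<^esub> \<iota>' (c' \<oplus>\<^bsub>B\<^esub> c)"
      using ac(1,2) ac'(1,2) by (simp add: p_add_left p_add_right W.a_ac)
    finally have "t = c' \<oplus>\<^bsub>B\<^esub> c"
      by (rule components_unique(2)[rotated 4]) (use t ac(1,2) ac'(1,2) in auto)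
    then have "\<theta> \<odot>\<^bsub>B\<^esub> t = \<theta> \<odot>\<^bsub>B\<^esub> c"
      using \<theta> ac(1,2) ac'(1,2) fB[OF uv(1) ac'(2,1) e'] by (simp add: B.smult_r_distr)
    then show ?thesis unfolding Ht G_S[OF ac] by simp
  qed
  have HG_lin: "(\<lambda>u. H (G u)) \<in> linear_maps R A A" and GH_lin: "(\<lambda>v. G (H v)) \<in> linear_maps R B B"
    by (simp_all add: linear_maps_def add_hom_iff linear_mapsD(1-3)[OF G] linear_mapsD(1-3)[OF H])
  have trA: "\<theta> \<otimes>\<^bsub>R\<^esub> (\<Oplus>\<^bsub>R\<^esub>i \<in> I. \<xi> i (H (G (x i)))) = [card I] \<cdot>\<^bsub>R\<^esub> \<theta>"
    using A.scaled_identityI[OF HG_lin _ \<theta> HG_S] G_one H_one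
    by (intro A.trace_of_scaled_identity[OF x HG_lin \<theta>]) simp
  have trB: "\<theta> \<otimes>\<^bsub>R\<^esub> (\<Oplus>\<^bsub>R\<^esub>j \<in> J. \<eta> j (G (H (y j)))) = [card J] \<cdot>\<^bsub>R\<^esub> \<theta>"
    using B.scaled_identityI[OF GH_lin _ \<theta> GH_S] G_one H_one
    by (intro B.trace_of_scaled_identity[OF y GH_lin \<theta>]) simp
  have "(\<Oplus>\<^bsub>R\<^esub>i \<in> I. \<xi> i (H (G (x i)))) = (\<Oplus>\<^bsub>R\<^esub>j \<in> J. \<eta> j (G (H (y j))))"
    by (rule trace_commute[OF A.module_axioms B.module_axioms x y G H])
  then show ?thesis using trA trB by simp
qed

text \<open>
  With \<open>\<kappa>\<close> belonging to a unit square of \<open>A\<close> and \<open>\<mu>'\<close>, \<open>\<kappa>'\<close> to one of \<open>B\<close>, the product \<open>\<mu>' \<kappa>\<close> vanishes by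
  \<open>no_merge\<close> and \<open>\<kappa>' \<kappa>\<close> by \<open>no_swap\<close>.  Since \<open>\<mu>' + \<kappa>'\<close> is a unit, \<open>\<kappa> = 0\<close>; hence \<open>\<mu>\<close> is a unit, and
  \<open>\<mu> c = 0\<close> gives \<open>c = 0\<close>.
\<close>

lemma components_preserved:
  assumes f: "f \<in> inv_endos" and g: "g \<in> inv_endos"
    and fg: "\<And>w. w \<in> carrier W \<Longrightarrow> f (g w) = w" and gf: "\<And>w. w \<in> carrier W \<Longrightarrow> g (f w) = w"
    and alt: "A.trivial_algebra \<or> B.trivial_algebra \<or>
      (\<exists>s. A.unit_square s) \<and> (\<exists>t. B.unit_square t) \<and>
      dual_basis R A I x \<xi> \<and> dual_basis R B J y \<eta> \<and>
      (\<forall>r \<in> carrier R. [card I] \<cdot>\<^bsub>R\<^esub> r = [card J] \<cdot>\<^bsub>R\<^esub> r \<longrightarrow> r = \<zero>\<^bsub>R\<^esub>)"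
    and s: "s \<in> S" and ac: "a \<in> S" "c \<in> S'" and eq: "f (\<iota> s) = \<iota> a \<oplus>\<^bsub>W\<^esub> \<iota>' c"
  shows "c = \<zero>\<^bsub>B\<^esub>"
proof -
  interpret sw: algebra_product R B l' bar' A l bar W "\<lambda>y x. p x y" E' E \<sigma> by (rule swapped)
  consider "A.trivial_algebra" | "B.trivial_algebra" | s0 t0 where
    "A.unit_square s0" "B.unit_square t0" "dual_basis R A I x \<xi>" "dual_basis R B J y \<eta>"
    "\<And>r. r \<in> carrier R \<Longrightarrow> [card I] \<cdot>\<^bsub>R\<^esub> r = [card J] \<cdot>\<^bsub>R\<^esub> r \<Longrightarrow> r = \<zero>\<^bsub>R\<^esub>"
    using alt by blast
  then show ?thesis
  proof cases
    case 1
    then have "s = \<zero>\<^bsub>A\<^esub>" using A.traceless_of_trivial s by blast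
    moreover have "f (\<iota> \<zero>\<^bsub>A\<^esub>) = \<iota> \<zero>\<^bsub>A\<^esub> \<oplus>\<^bsub>W\<^esub> \<iota>' \<zero>\<^bsub>B\<^esub>"
      using inv_endosD(8)[OF f] by (simp add: p_zero_left p_zero_right A.unit_closed B.unit_closed)
    ultimately have "\<iota> \<zero>\<^bsub>A\<^esub> \<oplus>\<^bsub>W\<^esub> \<iota>' \<zero>\<^bsub>B\<^esub> = \<iota> a \<oplus>\<^bsub>W\<^esub> \<iota>' c"
      using eq by simp
    then show ?thesis using components_unique(2)[of "\<zero>\<^bsub>A\<^esub>" "\<zero>\<^bsub>B\<^esub>" a c] ac by simp
  next
    case 2
    then show ?thesis using B.traceless_of_trivial ac(2) by blast
  next
    case 3
    obtain \<nu> where s0: "s0 \<in> S" and \<nu>: "\<nu> \<in> Units R" "s0 \<otimes>\<^bsub>A\<^esub> s0 = \<nu> \<odot>\<^bsub>A\<^esub> \<one>\<^bsub>A\<^esub>"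
      using 3(1) by (auto simp: A.unit_square_def)
    obtain \<nu>' where t0: "t0 \<in> S'" and \<nu>': "\<nu>' \<in> Units R" "t0 \<otimes>\<^bsub>B\<^esub> t0 = \<nu>' \<odot>\<^bsub>B\<^esub> \<one>\<^bsub>B\<^esub>"
      using 3(2) by (auto simp: B.unit_square_def)
    have \<nu>_cl: "\<nu> \<in> carrier R" "\<nu>' \<in> carrier R" using \<nu> \<nu>' by auto
    obtain \<mu> \<kappa> where mk: "\<mu> \<in> carrier R" "\<kappa> \<in> carrier R" "\<mu> \<oplus>\<^bsub>R\<^esub> \<kappa> = \<nu>"
      and spl: "\<And>s a c. \<lbrakk>s \<in> S; a \<in> S; c \<in> S'; f (\<iota> s) = \<iota> a \<oplus>\<^bsub>W\<^esub> \<iota>' c\<rbrakk>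
        \<Longrightarrow> \<mu> \<odot>\<^bsub>B\<^esub> c = \<zero>\<^bsub>B\<^esub> \<and> \<kappa> \<odot>\<^bsub>A\<^esub> a = \<zero>\<^bsub>A\<^esub>"
      using base_splits[OF f s0 \<nu>(2) \<nu>_cl(1)] by blast
    obtain \<mu>' \<kappa>' where mk': "\<mu>' \<in> carrier R" "\<kappa>' \<in> carrier R" "\<mu>' \<oplus>\<^bsub>R\<^esub> \<kappa>' = \<nu>'"
      and spl'': "\<And>s a c. \<lbrakk>s \<in> S'; a \<in> S'; c \<in> S; f (\<iota>' s) = \<iota>' a \<oplus>\<^bsub>W\<^esub> \<iota> c\<rbrakk>
        \<Longrightarrow> \<mu>' \<odot>\<^bsub>A\<^esub> c = \<zero>\<^bsub>A\<^esub> \<and> \<kappa>' \<odot>\<^bsub>B\<^esub> a = \<zero>\<^bsub>B\<^esub>"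
      using sw.base_splits[OF f t0 \<nu>'(2) \<nu>_cl(2)] by blast
    have spl': "\<mu>' \<odot>\<^bsub>A\<^esub> a = \<zero>\<^bsub>A\<^esub> \<and> \<kappa>' \<odot>\<^bsub>B\<^esub> c = \<zero>\<^bsub>B\<^esub>"
      if "t \<in> S'" "a \<in> S" "c \<in> S'" "f (\<iota>' t) = \<iota> a \<oplus>\<^bsub>W\<^esub> \<iota>' c" for t a c
      using spl''[OF that(1,3,2)] that by (simp add: W.a_comm)
    have kA: "(r \<otimes>\<^bsub>R\<^esub> \<kappa>) \<odot>\<^bsub>A\<^esub> a = \<zero>\<^bsub>A\<^esub>"
      if "r \<in> carrier R" "s \<in> S" "a \<in> S" "c \<in> S'" "f (\<iota> s) = \<iota> a \<oplus>\<^bsub>W\<^esub> \<iota>' c" for r s a c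
      using that mk spl[OF that(2-5)] by (simp add: A.smult_assoc1)
    have "\<mu>' \<otimes>\<^bsub>R\<^esub> \<kappa> = \<zero>\<^bsub>R\<^esub>"
    proof (rule no_merge[OF f g fg 3(1)])
      fix t a c assume t: "t \<in> S'" "a \<in> S" "c \<in> S'" "f (\<iota>' t) = \<iota> a \<oplus>\<^bsub>W\<^esub> \<iota>' c"
      show "(\<mu>' \<otimes>\<^bsub>R\<^esub> \<kappa>) \<odot>\<^bsub>A\<^esub> a = \<zero>\<^bsub>A\<^esub>"
        using t mk mk' spl'[OF t] by (simp add: A.R.m_comm[of \<mu>'] A.smult_assoc1)
    qed (use mk mk' kA in auto)
    moreover have "\<kappa>' \<otimes>\<^bsub>R\<^esub> \<kappa> = \<zero>\<^bsub>R\<^esub>"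
    proof (rule 3(5))
      show "[card I] \<cdot>\<^bsub>R\<^esub> (\<kappa>' \<otimes>\<^bsub>R\<^esub> \<kappa>) = [card J] \<cdot>\<^bsub>R\<^esub> (\<kappa>' \<otimes>\<^bsub>R\<^esub> \<kappa>)"
      proof (rule no_swap[OF f g fg gf _ _ _ 3(3,4)])
        fix t a c assume t: "t \<in> S'" "a \<in> S" "c \<in> S'" "f (\<iota>' t) = \<iota> a \<oplus>\<^bsub>W\<^esub> \<iota>' c"
        show "(\<kappa>' \<otimes>\<^bsub>R\<^esub> \<kappa>) \<odot>\<^bsub>B\<^esub> c = \<zero>\<^bsub>B\<^esub>"
          using t mk mk' spl'[OF t] by (simp add: A.R.m_comm[of \<kappa>'] B.smult_assoc1)
      qed (use mk mk' kA in auto)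
    qed (use mk mk' in auto)
    ultimately have "(\<mu>' \<oplus>\<^bsub>R\<^esub> \<kappa>') \<otimes>\<^bsub>R\<^esub> \<kappa> = \<zero>\<^bsub>R\<^esub>"
      using mk mk'(1,2) by (simp add: A.R.l_distr)
    then have "inv\<^bsub>R\<^esub> \<nu>' \<otimes>\<^bsub>R\<^esub> (\<nu>' \<otimes>\<^bsub>R\<^esub> \<kappa>) = \<zero>\<^bsub>R\<^esub>" using \<nu>' mk'(3) by simp
    then have "\<kappa> = \<zero>\<^bsub>R\<^esub>" using \<nu>'(1) \<nu>_cl mk(2) by (simp add: A.R.m_assoc[symmetric])
    then have "\<mu> = \<nu>" using mk by simp
    then have "\<nu> \<odot>\<^bsub>B\<^esub> c = \<zero>\<^bsub>B\<^esub>" using spl[OF s ac eq] by simp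
    then have "inv\<^bsub>R\<^esub> \<nu> \<odot>\<^bsub>B\<^esub> (\<nu> \<odot>\<^bsub>B\<^esub> c) = \<zero>\<^bsub>B\<^esub>" using \<nu>(1) by simp
    then show ?thesis
      using \<nu>(1) \<nu>_cl ac(2) by (simp add: B.smult_assoc1[symmetric])
  qed
qed

lemma preserves_left:
  assumes f: "f \<in> inv_endos" and g: "g \<in> inv_endos"
    and fg: "\<And>w. w \<in> carrier W \<Longrightarrow> f (g w) = w" and gf: "\<And>w. w \<in> carrier W \<Longrightarrow> g (f w) = w"
    and alt: "A.trivial_algebra \<or> B.trivial_algebra \<or>
      (\<exists>s. A.unit_square s) \<and> (\<exists>t. B.unit_square t) \<and>
      dual_basis R A I x \<xi> \<and> dual_basis R B J y \<eta> \<and>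
      (\<forall>r \<in> carrier R. [card I] \<cdot>\<^bsub>R\<^esub> r = [card J] \<cdot>\<^bsub>R\<^esub> r \<longrightarrow> r = \<zero>\<^bsub>R\<^esub>)"
    and u: "u \<in> carrier A"
  shows "f (\<iota> u) = \<iota> (E (f (\<iota> u)))"
proof -
  note fs = inv_endosD[OF f]
  obtain s where s: "s \<in> S" "u = l u \<odot>\<^bsub>A\<^esub> \<one>\<^bsub>A\<^esub> \<oplus>\<^bsub>A\<^esub> s"
    using A.scalar_plus_traceless[OF u] by blast
  define \<alpha> where "\<alpha> = l u"
  have \<alpha>: "\<alpha> \<in> carrier R" using u by (simp add: \<alpha>_def)
  obtain a c where ac: "a \<in> S" "c \<in> S'" "f (\<iota> s) = \<iota> a \<oplus>\<^bsub>W\<^esub> \<iota>' c"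
    using endo_components[OF f s(1)] by blast
  have "c = \<zero>\<^bsub>B\<^esub>" by (rule components_preserved[OF f g fg gf alt s(1) ac])
  then have fs0: "f (\<iota> s) = \<iota> a"
    using ac by (simp add: p_zero_right A.unit_closed B.unit_closed)
  have fu: "f (\<iota> u) = \<iota> (\<alpha> \<odot>\<^bsub>A\<^esub> \<one>\<^bsub>A\<^esub> \<oplus>\<^bsub>A\<^esub> a)"
    using \<alpha> s(1) ac(1) by (subst s(2)[folded \<alpha>_def]) (simp add: p_add_left p_smult_left fs fs0 p_one A.unit_closed B.unit_closed W.unit_closed)
  have "E (f (\<iota> u)) = \<alpha> \<odot>\<^bsub>A\<^esub> \<one>\<^bsub>A\<^esub> \<oplus>\<^bsub>A\<^esub> a"
    unfolding fu using \<alpha> ac(1) by simp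
  then show ?thesis using fu by simp
qed

theorem automorphism_splits:
  assumes f: "f \<in> inv_endos" and g: "g \<in> inv_endos"
    and fg: "\<And>w. w \<in> carrier W \<Longrightarrow> f (g w) = w" and gf: "\<And>w. w \<in> carrier W \<Longrightarrow> g (f w) = w"
    and alt: "A.trivial_algebra \<or> B.trivial_algebra \<or>
      (\<exists>s. A.unit_square s) \<and> (\<exists>t. B.unit_square t) \<and>
      dual_basis R A I x \<xi> \<and> dual_basis R B J y \<eta> \<and>
      (\<forall>r \<in> carrier R. [card I] \<cdot>\<^bsub>R\<^esub> r = [card J] \<cdot>\<^bsub>R\<^esub> r \<longrightarrow> r = \<zero>\<^bsub>R\<^esub>)"
  shows "(\<lambda>u. E (f (\<iota> u))) \<in> A.algebra_endos" "(\<lambda>v. E' (f (\<iota>' v))) \<in> B.algebra_endos"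
    "\<And>u. u \<in> carrier A \<Longrightarrow> E (g (\<iota> (E (f (\<iota> u))))) = u"
    "\<And>v. v \<in> carrier B \<Longrightarrow> E' (g (\<iota>' (E' (f (\<iota>' v))))) = v"
    "\<And>u v. u \<in> carrier A \<Longrightarrow> v \<in> carrier B \<Longrightarrow> f (p u v) = p (E (f (\<iota> u))) (E' (f (\<iota>' v)))"
proof -
  interpret sw: algebra_product R B l' bar' A l bar W "\<lambda>y x. p x y" E' E \<sigma> by (rule swapped)
  note fs = inv_endosD[OF f] and gs = inv_endosD[OF g]
  note [simp] = A.unit_closed B.unit_closed W.unit_closed
  have alt': "B.trivial_algebra \<or> A.trivial_algebra \<or>
      (\<exists>s. B.unit_square s) \<and> (\<exists>t. A.unit_square t) \<and>
      dual_basis R B J y \<eta> \<and> dual_basis R A I x \<xi> \<and>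
      (\<forall>r \<in> carrier R. [card J] \<cdot>\<^bsub>R\<^esub> r = [card I] \<cdot>\<^bsub>R\<^esub> r \<longrightarrow> r = \<zero>\<^bsub>R\<^esub>)"
  proof -
    have "\<forall>r \<in> carrier R. [card J] \<cdot>\<^bsub>R\<^esub> r = [card I] \<cdot>\<^bsub>R\<^esub> r \<longrightarrow> r = \<zero>\<^bsub>R\<^esub>"
      if "\<forall>r \<in> carrier R. [card I] \<cdot>\<^bsub>R\<^esub> r = [card J] \<cdot>\<^bsub>R\<^esub> r \<longrightarrow> r = \<zero>\<^bsub>R\<^esub>"
      using that by force
    then show ?thesis using alt by blast
  qed
  have pA: "f (\<iota> u) = \<iota> (E (f (\<iota> u)))" if "u \<in> carrier A" for u
    by (rule preserves_left[OF f g fg gf alt that])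
  have pB: "f (\<iota>' v) = \<iota>' (E' (f (\<iota>' v)))" if "v \<in> carrier B" for v
    by (rule sw.preserves_left[OF f g fg gf alt' that])
  show "f (p u v) = p (E (f (\<iota> u))) (E' (f (\<iota>' v)))" if uv: "u \<in> carrier A" "v \<in> carrier B" for u v
  proof -
    have "f (p u v) = f (\<iota> u \<otimes>\<^bsub>W\<^esub> \<iota>' v)" using uv by (simp add: p_mult)
    also have "\<dots> = f (\<iota> u) \<otimes>\<^bsub>W\<^esub> f (\<iota>' v)" using uv by (simp add: fs)
    also have "\<dots> = \<iota> (E (f (\<iota> u))) \<otimes>\<^bsub>W\<^esub> \<iota>' (E' (f (\<iota>' v)))"
      by (rule arg_cong2[OF pA[OF uv(1)] pB[OF uv(2)]])
    also have "\<dots> = p (E (f (\<iota> u))) (E' (f (\<iota>' v)))" using uv by (simp add: p_mult fs)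
    finally show ?thesis .
  qed
  show "E (g (\<iota> (E (f (\<iota> u))))) = u" if "u \<in> carrier A" for u
    unfolding pA[OF that, symmetric] using that by (simp add: gf)
  show "E' (g (\<iota>' (E' (f (\<iota>' v))))) = v" if "v \<in> carrier B" for v
    unfolding pB[OF that, symmetric] using that by (simp add: gf)
  have "E (f (\<iota> (u \<otimes>\<^bsub>A\<^esub> u'))) = E (f (\<iota> u)) \<otimes>\<^bsub>A\<^esub> E (f (\<iota> u'))"
    if "u \<in> carrier A" "u' \<in> carrier A" for u u'
  proof -
    have "f (\<iota> (u \<otimes>\<^bsub>A\<^esub> u')) = f (\<iota> u) \<otimes>\<^bsub>W\<^esub> f (\<iota> u')"
      using that fs(5)[of "\<iota> u" "\<iota> u'"] by (simp add: \<iota>_mult)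
    also have "\<dots> = \<iota> (E (f (\<iota> u))) \<otimes>\<^bsub>W\<^esub> \<iota> (E (f (\<iota> u')))"
      by (rule arg_cong2[OF pA[OF that(1)] pA[OF that(2)]])
    also have "\<dots> = \<iota> (E (f (\<iota> u)) \<otimes>\<^bsub>A\<^esub> E (f (\<iota> u')))" using that by (simp add: \<iota>_mult fs)
    also have "E \<dots> = E (f (\<iota> u)) \<otimes>\<^bsub>A\<^esub> E (f (\<iota> u'))" using that by (simp add: fs)
    finally show ?thesis .
  qed
  then show "(\<lambda>u. E (f (\<iota> u))) \<in> A.algebra_endos"
    by (simp add: A.algebra_endos_def linear_maps_def add_hom_iff fs p_add_left p_smult_left p_one)
  have "E' (f (\<iota>' (u \<otimes>\<^bsub>B\<^esub> u'))) = E' (f (\<iota>' u)) \<otimes>\<^bsub>B\<^esub> E' (f (\<iota>' u'))"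
    if "u \<in> carrier B" "u' \<in> carrier B" for u u'
  proof -
    have "f (\<iota>' (u \<otimes>\<^bsub>B\<^esub> u')) = f (\<iota>' u) \<otimes>\<^bsub>W\<^esub> f (\<iota>' u')"
      using that fs(5)[of "\<iota>' u" "\<iota>' u'"] by (simp add: sw.\<iota>_mult)
    also have "\<dots> = \<iota>' (E' (f (\<iota>' u))) \<otimes>\<^bsub>W\<^esub> \<iota>' (E' (f (\<iota>' u')))"
      by (rule arg_cong2[OF pB[OF that(1)] pB[OF that(2)]])
    also have "\<dots> = \<iota>' (E' (f (\<iota>' u)) \<otimes>\<^bsub>B\<^esub> E' (f (\<iota>' u')))" using that by (simp add: sw.\<iota>_mult fs)
    also have "E' \<dots> = E' (f (\<iota>' u)) \<otimes>\<^bsub>B\<^esub> E' (f (\<iota>' u'))" using that by (simp add: fs)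
    finally show ?thesis .
  qed
  then show "(\<lambda>v. E' (f (\<iota>' v))) \<in> B.algebra_endos"
    by (simp add: B.algebra_endos_def linear_maps_def add_hom_iff fs p_add_right p_smult_right p_one)
qed

end

section \<open>Composition algebras and their extensions\<close>

lemma (in vectorspace) dual_basis_exists:
  assumes "fin_dim"
  obtains X \<xi> where "card X = dim" "dual_basis K V X (\<lambda>x. x) \<xi>"
proof -
  obtain X where X: "finite X" "basis X" using finite_basis_exists[OF assms] by blast
  then have XV: "X \<subseteq> carrier V" by (simp add: basis_def)
  have ex1: "\<exists>!a. a \<in> X \<rightarrow>\<^sub>E carrier K \<and> lincomb a X = v" if "v \<in> carrier V" for v
    using basis_criterion[OF X(1) XV] X(2) that by blast
  define co where "co v = (THE a. a \<in> X \<rightarrow>\<^sub>E carrier K \<and> lincomb a X = v)" for v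
  have co: "co v \<in> X \<rightarrow>\<^sub>E carrier K" "lincomb (co v) X = v" if "v \<in> carrier V" for v
    using theI'[OF ex1[OF that]] by (auto simp: co_def)
  have co_eq: "co v = a" if "v \<in> carrier V" "a \<in> X \<rightarrow>\<^sub>E carrier K" "lincomb a X = v" for v a
    using ex1[OF that(1)] co[OF that(1)] that(2,3) by blast
  have co_cl: "co v b \<in> carrier K" if "v \<in> carrier V" "b \<in> X" for v b
    using co(1)[OF that(1)] that(2) by auto
  have cl: "(\<lambda>b. a b \<odot>\<^bsub>V\<^esub> b) \<in> X \<rightarrow> carrier V" if "\<And>b. b \<in> X \<Longrightarrow> a b \<in> carrier K" for a
    using that XV by auto
  have co_add: "co (v \<oplus>\<^bsub>V\<^esub> w) = (\<lambda>b \<in> X. co v b \<oplus>\<^bsub>K\<^esub> co w b)"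
    if vw: "v \<in> carrier V" "w \<in> carrier V" for v w
  proof (rule co_eq)
    have "lincomb (\<lambda>b \<in> X. co v b \<oplus>\<^bsub>K\<^esub> co w b) X = (\<Oplus>\<^bsub>V\<^esub>b \<in> X. co v b \<odot>\<^bsub>V\<^esub> b \<oplus>\<^bsub>V\<^esub> co w b \<odot>\<^bsub>V\<^esub> b)"
      unfolding lincomb_def using vw XV co_cl
      by (intro M.finsum_cong') (auto simp: smult_l_distr)
    also have "\<dots> = lincomb (co v) X \<oplus>\<^bsub>V\<^esub> lincomb (co w) X"
      unfolding lincomb_def using vw co_cl by (intro M.finsum_addf cl) auto
    finally show "lincomb (\<lambda>b \<in> X. co v b \<oplus>\<^bsub>K\<^esub> co w b) X = v \<oplus>\<^bsub>V\<^esub> w"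
      using vw co by simp
  qed (use vw co_cl in auto)
  have co_smult: "co (r \<odot>\<^bsub>V\<^esub> v) = (\<lambda>b \<in> X. r \<otimes>\<^bsub>K\<^esub> co v b)"
    if rv: "r \<in> carrier K" "v \<in> carrier V" for r v
  proof (rule co_eq)
    have "lincomb (\<lambda>b \<in> X. r \<otimes>\<^bsub>K\<^esub> co v b) X = (\<Oplus>\<^bsub>V\<^esub>b \<in> X. r \<odot>\<^bsub>V\<^esub> (co v b \<odot>\<^bsub>V\<^esub> b))"
      unfolding lincomb_def using rv XV co_cl
      by (intro M.finsum_cong') (auto simp: smult_assoc1)
    also have "\<dots> = r \<odot>\<^bsub>V\<^esub> lincomb (co v) X"
      unfolding lincomb_def using X(1) rv co_cl by (intro finsum_smult_ldistr[symmetric] cl) auto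
    finally show "lincomb (\<lambda>b \<in> X. r \<otimes>\<^bsub>K\<^esub> co v b) X = r \<odot>\<^bsub>V\<^esub> v"
      using rv co by simp
  qed (use rv co_cl in auto)
  have co_basis: "co b = (\<lambda>c \<in> X. if b = c then \<one>\<^bsub>K\<^esub> else \<zero>\<^bsub>K\<^esub>)" if b: "b \<in> X" for b
  proof (rule co_eq)
    have "lincomb (\<lambda>c \<in> X. if b = c then \<one>\<^bsub>K\<^esub> else \<zero>\<^bsub>K\<^esub>) X = (\<Oplus>\<^bsub>V\<^esub>c \<in> X. if b = c then c else \<zero>\<^bsub>V\<^esub>)"
      unfolding lincomb_def using XV by (intro M.finsum_cong') auto
    also have "\<dots> = b" using M.finsum_singleton[OF b X(1), of "\<lambda>c. c"] XV by auto
    finally show "lincomb (\<lambda>c \<in> X. if b = c then \<one>\<^bsub>K\<^esub> else \<zero>\<^bsub>K\<^esub>) X = b" .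
  qed (use b XV in auto)
  have "dual_basis K V X (\<lambda>x. x) (\<lambda>b v. co v b)"
    unfolding dual_basis_def
  proof (intro conjI ballI)
    show "(\<lambda>b v. co v b) \<in> X \<rightarrow> functionals K V"
      using co_cl by (auto simp: functionals_def add_hom_iff co_add co_smult)
    show "co b b = \<one>\<^bsub>K\<^esub>" if "b \<in> X" for b using that by (simp add: co_basis)
    show "v = (\<Oplus>\<^bsub>V\<^esub>b \<in> X. co v b \<odot>\<^bsub>V\<^esub> b)" if "v \<in> carrier V" for v
      using co(2)[OF that] by (simp add: lincomb_def)
  qed (use X XV in auto)
  moreover have "card X = dim" using dim_basis[OF X] by simp
  ultimately show ?thesis using that by blast
qed

context composition_algebra
begin

abbreviation b where "b \<equiv> polar_form k C n"

lemma b_closed [simp]: "x \<in> carrier C \<Longrightarrow> y \<in> carrier C \<Longrightarrow> b x y \<in> carrier k"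
  by (simp add: polar_form_def norm_closed)

lemma b_commute: "x \<in> carrier C \<Longrightarrow> y \<in> carrier C \<Longrightarrow> b x y = b y x"
  by (simp add: polar_form_def norm_closed R.minus_eq M.a_comm R.a_ac)

lemma norm_add: "x \<in> carrier C \<Longrightarrow> y \<in> carrier C \<Longrightarrow> n (x \<oplus>\<^bsub>C\<^esub> y) = n x \<oplus>\<^bsub>k\<^esub> n y \<oplus>\<^bsub>k\<^esub> b x y"
  by (simp add: polar_form_def norm_closed R.minus_eq R.a_ac R.r_neg1 R.r_neg2)

lemma b_add_right: "\<lbrakk>x \<in> carrier C; y \<in> carrier C; z \<in> carrier C\<rbrakk>
    \<Longrightarrow> b z (x \<oplus>\<^bsub>C\<^esub> y) = b z x \<oplus>\<^bsub>k\<^esub> b z y"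
  using polar_add[of x y z] by (simp add: b_commute[of z])

lemma b_smult_right: "\<lbrakk>r \<in> carrier k; x \<in> carrier C; y \<in> carrier C\<rbrakk>
    \<Longrightarrow> b x (r \<odot>\<^bsub>C\<^esub> y) = r \<otimes>\<^bsub>k\<^esub> b x y"
  using polar_smult[of r y x] by (simp add: b_commute[of x])

lemma norm_one:
  assumes "\<one>\<^bsub>C\<^esub> \<noteq> \<zero>\<^bsub>C\<^esub>" shows "n \<one>\<^bsub>C\<^esub> = \<one>\<^bsub>k\<^esub>"
proof -
  have "\<exists>x \<in> carrier C. n x \<noteq> \<zero>\<^bsub>k\<^esub>"
  proof (rule ccontr)
    assume "\<not> ?thesis"
    then have "b \<one>\<^bsub>C\<^esub> y = \<zero>\<^bsub>k\<^esub>" if "y \<in> carrier C" for y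
      using that by (simp add: polar_form_def unit_closed R.minus_eq)
    then show False using norm_nondegenerate[OF unit_closed] assms by blast
  qed
  then obtain x where x: "x \<in> carrier C" "n x \<noteq> \<zero>\<^bsub>k\<^esub>" by blast
  have "n \<one>\<^bsub>C\<^esub> \<otimes>\<^bsub>k\<^esub> n x = \<one>\<^bsub>k\<^esub> \<otimes>\<^bsub>k\<^esub> n x"
    using norm_mult[OF unit_closed x(1)] x by (simp add: unit_left norm_closed)
  then show ?thesis
    using x m_rcancel[of "n x" "n \<one>\<^bsub>C\<^esub>" "\<one>\<^bsub>k\<^esub>"] by (simp add: norm_closed unit_closed)
qed

lemma b_self: "x \<in> carrier C \<Longrightarrow> b x x = n x \<oplus>\<^bsub>k\<^esub> n x"
proof -
  assume x: "x \<in> carrier C"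
  have "n x \<oplus>\<^bsub>k\<^esub> n x \<oplus>\<^bsub>k\<^esub> b x x = n (x \<oplus>\<^bsub>C\<^esub> x)" using x by (simp add: norm_add)
  also have "x \<oplus>\<^bsub>C\<^esub> x = (\<one>\<^bsub>k\<^esub> \<oplus>\<^bsub>k\<^esub> \<one>\<^bsub>k\<^esub>) \<odot>\<^bsub>C\<^esub> x" using x by (simp add: smult_l_distr)
  also have "n \<dots> = n x \<oplus>\<^bsub>k\<^esub> n x \<oplus>\<^bsub>k\<^esub> (n x \<oplus>\<^bsub>k\<^esub> n x)"
    using x by (subst norm_smult) (auto simp: norm_closed R.l_distr R.r_distr R.a_ac)
  finally show ?thesis using x by (simp add: norm_closed)
qed

lemma b_mult_right:
  assumes "x \<in> carrier C" "y \<in> carrier C" "z \<in> carrier C"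
  shows "b (x \<otimes>\<^bsub>C\<^esub> z) (y \<otimes>\<^bsub>C\<^esub> z) = b x y \<otimes>\<^bsub>k\<^esub> n z"
proof -
  have "n (x \<otimes>\<^bsub>C\<^esub> z \<oplus>\<^bsub>C\<^esub> y \<otimes>\<^bsub>C\<^esub> z) = n (x \<oplus>\<^bsub>C\<^esub> y) \<otimes>\<^bsub>k\<^esub> n z"
    using assms by (simp add: mult_add_left[symmetric] norm_mult)
  then show ?thesis
    using assms by (simp add: norm_add norm_mult mult_closed norm_closed R.l_distr)
qed

lemma b_mult_left:
  assumes "x \<in> carrier C" "y \<in> carrier C" "z \<in> carrier C"
  shows "b (z \<otimes>\<^bsub>C\<^esub> x) (z \<otimes>\<^bsub>C\<^esub> y) = n z \<otimes>\<^bsub>k\<^esub> b x y"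
proof -
  have "n (z \<otimes>\<^bsub>C\<^esub> x \<oplus>\<^bsub>C\<^esub> z \<otimes>\<^bsub>C\<^esub> y) = n z \<otimes>\<^bsub>k\<^esub> n (x \<oplus>\<^bsub>C\<^esub> y)"
    using assms by (simp add: mult_add_right[symmetric] norm_mult)
  then show ?thesis
    using assms by (simp add: norm_add norm_mult mult_closed norm_closed R.r_distr)
qed

lemma b_mult_polarized:
  assumes c: "x \<in> carrier C" "y \<in> carrier C" "z \<in> carrier C" "w \<in> carrier C"
  shows "b (x \<otimes>\<^bsub>C\<^esub> z) (y \<otimes>\<^bsub>C\<^esub> w) \<oplus>\<^bsub>k\<^esub> b (x \<otimes>\<^bsub>C\<^esub> w) (y \<otimes>\<^bsub>C\<^esub> z) = b x y \<otimes>\<^bsub>k\<^esub> b z w"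
proof -
  let ?p = "b x y \<otimes>\<^bsub>k\<^esub> n z \<oplus>\<^bsub>k\<^esub> b x y \<otimes>\<^bsub>k\<^esub> n w"
  have "b (x \<otimes>\<^bsub>C\<^esub> (z \<oplus>\<^bsub>C\<^esub> w)) (y \<otimes>\<^bsub>C\<^esub> (z \<oplus>\<^bsub>C\<^esub> w)) = ?p \<oplus>\<^bsub>k\<^esub> b x y \<otimes>\<^bsub>k\<^esub> b z w"
    using c by (subst b_mult_right) (auto simp: norm_add norm_closed R.r_distr)
  moreover have "b (x \<otimes>\<^bsub>C\<^esub> (z \<oplus>\<^bsub>C\<^esub> w)) (y \<otimes>\<^bsub>C\<^esub> (z \<oplus>\<^bsub>C\<^esub> w)) =
      ?p \<oplus>\<^bsub>k\<^esub> (b (x \<otimes>\<^bsub>C\<^esub> z) (y \<otimes>\<^bsub>C\<^esub> w) \<oplus>\<^bsub>k\<^esub> b (x \<otimes>\<^bsub>C\<^esub> w) (y \<otimes>\<^bsub>C\<^esub> z))"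
    using c by (simp add: mult_add_right polar_add b_add_right mult_closed b_mult_right norm_closed R.a_ac)
  ultimately show ?thesis using c by (simp add: norm_closed mult_closed)
qed

text \<open>Every element satisfies its quadratic equation; by nondegeneracy it suffices to pair it with an arbitrary \<open>y\<close>.\<close>

lemma quadratic_equation:
  assumes x: "x \<in> carrier C"
  shows "x \<otimes>\<^bsub>C\<^esub> x \<oplus>\<^bsub>C\<^esub> n x \<odot>\<^bsub>C\<^esub> \<one>\<^bsub>C\<^esub> = b x \<one>\<^bsub>C\<^esub> \<odot>\<^bsub>C\<^esub> x"
proof -
  let ?q = "x \<otimes>\<^bsub>C\<^esub> x \<oplus>\<^bsub>C\<^esub> n x \<odot>\<^bsub>C\<^esub> \<one>\<^bsub>C\<^esub>" and ?t = "b x \<one>\<^bsub>C\<^esub> \<odot>\<^bsub>C\<^esub> x"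
  have cl: "?q \<in> carrier C" "?t \<in> carrier C" using x by (simp_all add: mult_closed unit_closed norm_closed)
  have "b (?q \<oplus>\<^bsub>C\<^esub> (\<ominus>\<^bsub>k\<^esub> \<one>\<^bsub>k\<^esub>) \<odot>\<^bsub>C\<^esub> ?t) y = \<zero>\<^bsub>k\<^esub>" if y: "y \<in> carrier C" for y
  proof -
    have "b (x \<otimes>\<^bsub>C\<^esub> y) x = n x \<otimes>\<^bsub>k\<^esub> b \<one>\<^bsub>C\<^esub> y"
      using b_mult_left[OF y unit_closed x] x y by (simp add: unit_right unit_closed b_commute[of y])
    then have "b (x \<otimes>\<^bsub>C\<^esub> x) y \<oplus>\<^bsub>k\<^esub> n x \<otimes>\<^bsub>k\<^esub> b \<one>\<^bsub>C\<^esub> y = b x \<one>\<^bsub>C\<^esub> \<otimes>\<^bsub>k\<^esub> b x y"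
      using b_mult_polarized[OF x unit_closed x y] x y by (simp add: unit_left)
    then have "b ?q y = b ?t y"
      using x y by (simp add: polar_add polar_smult mult_closed unit_closed norm_closed)
    then show ?thesis
      using cl y by (simp add: polar_add polar_smult R.l_minus R.r_neg)
  qed
  then have "?q \<oplus>\<^bsub>C\<^esub> (\<ominus>\<^bsub>k\<^esub> \<one>\<^bsub>k\<^esub>) \<odot>\<^bsub>C\<^esub> ?t = \<zero>\<^bsub>C\<^esub>"
    using cl by (intro norm_nondegenerate) auto
  then have "?q \<oplus>\<^bsub>C\<^esub> \<ominus>\<^bsub>C\<^esub> ?t = \<zero>\<^bsub>C\<^esub>" using cl by (simp only: smult_l_minus R.one_closed smult_one)
  then show ?thesis using cl M.minus_minus M.minus_equality M.a_inv_closed by metis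
qed

lemma quadratic_equation_polarized:
  assumes c: "x \<in> carrier C" "y \<in> carrier C"
  shows "(x \<otimes>\<^bsub>C\<^esub> y \<oplus>\<^bsub>C\<^esub> y \<otimes>\<^bsub>C\<^esub> x) \<oplus>\<^bsub>C\<^esub> b x y \<odot>\<^bsub>C\<^esub> \<one>\<^bsub>C\<^esub> =
    b x \<one>\<^bsub>C\<^esub> \<odot>\<^bsub>C\<^esub> y \<oplus>\<^bsub>C\<^esub> b y \<one>\<^bsub>C\<^esub> \<odot>\<^bsub>C\<^esub> x"
proof -
  note [simp] = mult_closed unit_closed norm_closed
  let ?p = "(x \<otimes>\<^bsub>C\<^esub> x \<oplus>\<^bsub>C\<^esub> n x \<odot>\<^bsub>C\<^esub> \<one>\<^bsub>C\<^esub>) \<oplus>\<^bsub>C\<^esub> (y \<otimes>\<^bsub>C\<^esub> y \<oplus>\<^bsub>C\<^esub> n y \<odot>\<^bsub>C\<^esub> \<one>\<^bsub>C\<^esub>)"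
  let ?q = "b x \<one>\<^bsub>C\<^esub> \<odot>\<^bsub>C\<^esub> x \<oplus>\<^bsub>C\<^esub> b y \<one>\<^bsub>C\<^esub> \<odot>\<^bsub>C\<^esub> y"
  let ?l = "(x \<otimes>\<^bsub>C\<^esub> y \<oplus>\<^bsub>C\<^esub> y \<otimes>\<^bsub>C\<^esub> x) \<oplus>\<^bsub>C\<^esub> b x y \<odot>\<^bsub>C\<^esub> \<one>\<^bsub>C\<^esub>"
  let ?r = "b x \<one>\<^bsub>C\<^esub> \<odot>\<^bsub>C\<^esub> y \<oplus>\<^bsub>C\<^esub> b y \<one>\<^bsub>C\<^esub> \<odot>\<^bsub>C\<^esub> x"
  have pq: "?p = ?q" using c by (simp only: quadratic_equation)
  have "?l \<oplus>\<^bsub>C\<^esub> ?p = (x \<oplus>\<^bsub>C\<^esub> y) \<otimes>\<^bsub>C\<^esub> (x \<oplus>\<^bsub>C\<^esub> y) \<oplus>\<^bsub>C\<^esub> n (x \<oplus>\<^bsub>C\<^esub> y) \<odot>\<^bsub>C\<^esub> \<one>\<^bsub>C\<^esub>"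
    using c by (simp add: mult_add_left mult_add_right norm_add smult_l_distr M.a_ac)
  also have "\<dots> = b (x \<oplus>\<^bsub>C\<^esub> y) \<one>\<^bsub>C\<^esub> \<odot>\<^bsub>C\<^esub> (x \<oplus>\<^bsub>C\<^esub> y)"
    using c by (intro quadratic_equation) auto
  also have "\<dots> = ?r \<oplus>\<^bsub>C\<^esub> ?q"
    using c by (simp add: polar_add smult_l_distr smult_r_distr M.a_ac)
  finally have "?l \<oplus>\<^bsub>C\<^esub> ?q = ?r \<oplus>\<^bsub>C\<^esub> ?q" unfolding pq .
  then show ?thesis using c by (subst (asm) M.add.right_cancel) auto
qed

text \<open>
  A traceless element with nonzero norm has an invertible square.  If the norm vanishes on all
  traceless elements, then so does its polar form; as traceless elements are orthogonal to 1,
  they are orthogonal to everything and hence zero, and only scalars are left.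
\<close>

lemma scalars_or_anisotropic:
  assumes h: "h \<in> carrier k" "h \<oplus>\<^bsub>k\<^esub> h = \<one>\<^bsub>k\<^esub>" and one: "\<one>\<^bsub>C\<^esub> \<noteq> \<zero>\<^bsub>C\<^esub>"
  shows "(\<forall>x \<in> carrier C. x = (h \<otimes>\<^bsub>k\<^esub> b x \<one>\<^bsub>C\<^esub>) \<odot>\<^bsub>C\<^esub> \<one>\<^bsub>C\<^esub>) \<or>
    (\<exists>s \<in> carrier C. b s \<one>\<^bsub>C\<^esub> = \<zero>\<^bsub>k\<^esub> \<and> (\<exists>\<nu> \<in> Units k. s \<otimes>\<^bsub>C\<^esub> s = \<nu> \<odot>\<^bsub>C\<^esub> \<one>\<^bsub>C\<^esub>))"
proof (rule disjCI)
  note [simp] = mult_closed unit_closed norm_closed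
  let ?t = "\<lambda>x. h \<otimes>\<^bsub>k\<^esub> b x \<one>\<^bsub>C\<^esub>"
  let ?z = "\<lambda>x. x \<oplus>\<^bsub>C\<^esub> (\<ominus>\<^bsub>k\<^esub> ?t x) \<odot>\<^bsub>C\<^esub> \<one>\<^bsub>C\<^esub>"
  assume no: "\<not> (\<exists>s \<in> carrier C. b s \<one>\<^bsub>C\<^esub> = \<zero>\<^bsub>k\<^esub> \<and> (\<exists>\<nu> \<in> Units k. s \<otimes>\<^bsub>C\<^esub> s = \<nu> \<odot>\<^bsub>C\<^esub> \<one>\<^bsub>C\<^esub>))"
  have iso: "n s = \<zero>\<^bsub>k\<^esub>" if s: "s \<in> carrier C" "b s \<one>\<^bsub>C\<^esub> = \<zero>\<^bsub>k\<^esub>" for s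
  proof (rule ccontr)
    assume "n s \<noteq> \<zero>\<^bsub>k\<^esub>"
    then have "n s \<in> Units k" using s field_Units by simp
    then have "\<ominus>\<^bsub>k\<^esub> n s \<in> Units k"
      using s by (metis R.Units_minus_one_closed R.Units_m_closed R.l_minus R.one_closed R.l_one norm_closed)
    moreover have "s \<otimes>\<^bsub>C\<^esub> s = (\<ominus>\<^bsub>k\<^esub> n s) \<odot>\<^bsub>C\<^esub> \<one>\<^bsub>C\<^esub>"
    proof -
      have "s \<otimes>\<^bsub>C\<^esub> s \<oplus>\<^bsub>C\<^esub> n s \<odot>\<^bsub>C\<^esub> \<one>\<^bsub>C\<^esub> = \<zero>\<^bsub>C\<^esub>"
        using quadratic_equation[OF s(1)] s by simp
      then show ?thesis using s by (simp add: smult_l_minus M.minus_equality)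
    qed
    ultimately show False using no s by blast
  qed
  have z: "?z x \<in> carrier C" "b (?z x) \<one>\<^bsub>C\<^esub> = \<zero>\<^bsub>k\<^esub>" if x: "x \<in> carrier C" for x
  proof -
    show "?z x \<in> carrier C" using x h by simp
    have "?t x \<oplus>\<^bsub>k\<^esub> ?t x = b x \<one>\<^bsub>C\<^esub>"
      using x h by (simp add: R.l_distr[symmetric])
    moreover have "b \<one>\<^bsub>C\<^esub> \<one>\<^bsub>C\<^esub> = \<one>\<^bsub>k\<^esub> \<oplus>\<^bsub>k\<^esub> \<one>\<^bsub>k\<^esub>"
      using one by (simp add: b_self norm_one)
    ultimately have "?t x \<otimes>\<^bsub>k\<^esub> b \<one>\<^bsub>C\<^esub> \<one>\<^bsub>C\<^esub> = b x \<one>\<^bsub>C\<^esub>"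
      using x h by (simp add: R.r_distr)
    then show "b (?z x) \<one>\<^bsub>C\<^esub> = \<zero>\<^bsub>k\<^esub>"
      using x h by (simp add: polar_add polar_smult R.l_minus R.r_neg)
  qed
  show "\<forall>x \<in> carrier C. x = ?t x \<odot>\<^bsub>C\<^esub> \<one>\<^bsub>C\<^esub>"
  proof
    fix x assume x: "x \<in> carrier C"
    have "?z x = \<zero>\<^bsub>C\<^esub>"
    proof (rule norm_nondegenerate[OF z(1)[OF x]])
      fix y assume y: "y \<in> carrier C"
      have y_eq: "?z y \<oplus>\<^bsub>C\<^esub> ?t y \<odot>\<^bsub>C\<^esub> \<one>\<^bsub>C\<^esub> = y"
        using y h by (simp add: smult_l_minus M.a_assoc M.l_neg)
      have "b (?z x) (?z y) = n (?z x \<oplus>\<^bsub>C\<^esub> ?z y) \<ominus>\<^bsub>k\<^esub> n (?z x) \<ominus>\<^bsub>k\<^esub> n (?z y)"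
        by (simp add: polar_form_def)
      also have "\<dots> = \<zero>\<^bsub>k\<^esub>"
        using z[OF x] z[OF y] iso[OF z[OF x]] iso[OF z[OF y]] iso[of "?z x \<oplus>\<^bsub>C\<^esub> ?z y"]
        by (simp only: polar_add R.r_zero M.add.m_closed unit_closed R.zero_closed R.minus_eq R.minus_zero)
      finally have "b (?z x) (?z y \<oplus>\<^bsub>C\<^esub> ?t y \<odot>\<^bsub>C\<^esub> \<one>\<^bsub>C\<^esub>) = \<zero>\<^bsub>k\<^esub>"
        using z[OF x] z[OF y] y h by (subst b_add_right) (auto simp: b_smult_right simp del: M.add.m_closed)
      then show "b (?z x) y = \<zero>\<^bsub>k\<^esub>" unfolding y_eq .
    qed
    then have "x \<oplus>\<^bsub>C\<^esub> \<ominus>\<^bsub>C\<^esub> (?t x \<odot>\<^bsub>C\<^esub> \<one>\<^bsub>C\<^esub>) = \<zero>\<^bsub>C\<^esub>" using x h by (simp add: smult_l_minus)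
    then show "x = ?t x \<odot>\<^bsub>C\<^esub> \<one>\<^bsub>C\<^esub>"
      using x h M.minus_equality[of x "\<ominus>\<^bsub>C\<^esub> (?t x \<odot>\<^bsub>C\<^esub> \<one>\<^bsub>C\<^esub>)"] by simp
  qed
qed

end

context scalar_extension
begin

definition ext_functional where
  "ext_functional \<xi> = tensor_lift k A R (add_monoid R) (\<lambda>x r. \<xi> x \<odot>\<^bsub>R\<^esub> r)"

lemma ext_functional_props:
  assumes "\<xi> \<in> functionals k A"
  shows ext_functional: "ext_functional \<xi> \<in> functionals R AR"
    and ext_functional_pure: "\<And>x r. x \<in> carrier A \<Longrightarrow> r \<in> carrier R \<Longrightarrow>
      ext_functional \<xi> (pure x r) = \<xi> x \<odot>\<^bsub>R\<^esub> r"
proof -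
  note \<xi> = functionalsD(1-3)[OF assms]
  have bal: "balanced k A R (add_monoid R) (\<lambda>x r. \<xi> x \<odot>\<^bsub>R\<^esub> r)"
    by (intro balancedI)
      (simp_all add: \<xi> S.smult_l_distr S.smult_r_distr S.smult_assoc1[symmetric] A.R.m_comm)
  have R: "abelian_group R" by (rule S.abelian_group_axioms)
  have hom: "ext_functional \<xi> \<in> add_hom AR R"
    unfolding ext_functional_def by (rule ext_lift_hom[OF R bal])
  show pr: "ext_functional \<xi> (pure x r) = \<xi> x \<odot>\<^bsub>R\<^esub> r" if "x \<in> carrier A" "r \<in> carrier R" for x r
    unfolding ext_functional_def by (rule ext_lift_pure[OF R bal that])
  have "ext_functional \<xi> (t \<odot>\<^bsub>AR\<^esub> U) = t \<otimes>\<^bsub>R\<^esub> ext_functional \<xi> U"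
    if "t \<in> carrier R" "U \<in> carrier AR" for t U
    using that(2)
  proof (induction rule: ext_induct)
    case (pure x r)
    then show ?case using that(1) by (simp add: pr \<xi> B.mult_smult_right)
  next
    case (add U V)
    then show ?case using that(1) hom by (simp add: add_hom_iff AR.smult_r_distr S.r_distr)
  qed
  then show "ext_functional \<xi> \<in> functionals R AR" using hom by (simp add: functionals_def)
qed

lemma pure_hom: "r \<in> carrier R \<Longrightarrow> (\<lambda>x. pure x r) \<in> add_hom A AR"
  by (simp add: add_hom_iff ext_pure_add_left)

lemma scalar_one: "r \<in> carrier R \<Longrightarrow> r \<odot>\<^bsub>AR\<^esub> \<one>\<^bsub>AR\<^esub> = pure \<one>\<^bsub>A\<^esub> r"
  by (simp add: ext_one A.unit_closed)

lemma ext_dual_basis: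
  assumes "dual_basis k A I x \<xi>"
  shows "dual_basis R AR I (\<lambda>i. pure (x i) \<one>\<^bsub>R\<^esub>) (\<lambda>i. ext_functional (\<xi> i))"
proof -
  have fin: "finite I" and xs: "\<And>i. i \<in> I \<Longrightarrow> x i \<in> carrier A"
    and xi: "\<And>i. i \<in> I \<Longrightarrow> \<xi> i \<in> functionals k A" and one: "\<And>i. i \<in> I \<Longrightarrow> \<xi> i (x i) = \<one>\<^bsub>k\<^esub>"
    and ex: "\<And>u. u \<in> carrier A \<Longrightarrow> u = (\<Oplus>\<^bsub>A\<^esub>i \<in> I. \<xi> i u \<odot>\<^bsub>A\<^esub> x i)"
    using assms unfolding dual_basis_def by blast+
  note xi_cl = functionals_closed[OF xi] and e_cl = functionals_closed[OF ext_functional[OF xi]]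
  have expand: "U = (\<Oplus>\<^bsub>AR\<^esub>i \<in> I. ext_functional (\<xi> i) U \<odot>\<^bsub>AR\<^esub> pure (x i) \<one>\<^bsub>R\<^esub>)" if "U \<in> carrier AR" for U
    using that
  proof (induction rule: ext_induct)
    case (pure y r)
    have "pure y r = pure (\<Oplus>\<^bsub>A\<^esub>i \<in> I. \<xi> i y \<odot>\<^bsub>A\<^esub> x i) r"
      by (rule arg_cong[OF ex[OF pure(1)]])
    also have "\<dots> = (\<Oplus>\<^bsub>AR\<^esub>i \<in> I. pure (\<xi> i y \<odot>\<^bsub>A\<^esub> x i) r)"
      using fin xs xi_cl pure
      by (intro add_hom_finsum[OF A.abelian_group_axioms AR.abelian_group_axioms pure_hom]) auto
    also have "\<dots> = (\<Oplus>\<^bsub>AR\<^esub>i \<in> I. ext_functional (\<xi> i) (pure y r) \<odot>\<^bsub>AR\<^esub> pure (x i) \<one>\<^bsub>R\<^esub>)"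
      using xs xi_cl pure
      by (intro AR.finsum_cong') (auto simp: ext_functional_pure[OF xi] pure_balanced)
    finally show ?case .
  next
    case (add U V)
    have "U \<oplus>\<^bsub>AR\<^esub> V =
        (\<Oplus>\<^bsub>AR\<^esub>i \<in> I. ext_functional (\<xi> i) U \<odot>\<^bsub>AR\<^esub> pure (x i) \<one>\<^bsub>R\<^esub>) \<oplus>\<^bsub>AR\<^esub>
        (\<Oplus>\<^bsub>AR\<^esub>i \<in> I. ext_functional (\<xi> i) V \<odot>\<^bsub>AR\<^esub> pure (x i) \<one>\<^bsub>R\<^esub>)"
      by (rule arg_cong2[OF add(3,4)])
    also have "\<dots> = (\<Oplus>\<^bsub>AR\<^esub>i \<in> I. ext_functional (\<xi> i) U \<odot>\<^bsub>AR\<^esub> pure (x i) \<one>\<^bsub>R\<^esub> \<oplus>\<^bsub>AR\<^esub>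
        ext_functional (\<xi> i) V \<odot>\<^bsub>AR\<^esub> pure (x i) \<one>\<^bsub>R\<^esub>)"
      using add(1,2) xs e_cl by (intro AR.finsum_addf[symmetric]) auto
    also have "\<dots> = (\<Oplus>\<^bsub>AR\<^esub>i \<in> I. ext_functional (\<xi> i) (U \<oplus>\<^bsub>AR\<^esub> V) \<odot>\<^bsub>AR\<^esub> pure (x i) \<one>\<^bsub>R\<^esub>)"
      using add(1,2) xs e_cl
      by (intro AR.finsum_cong')
        (auto simp: functionals_add[OF ext_functional[OF xi]] ext_pure_add_right)
    finally show ?case .
  qed
  show ?thesis
    unfolding dual_basis_def
  proof (intro conjI ballI fin)
    show "ext_functional (\<xi> i) (pure (x i) \<one>\<^bsub>R\<^esub>) = \<one>\<^bsub>R\<^esub>" if "i \<in> I" for i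
      using that xs one by (simp add: ext_functional_pure[OF xi])
    show "(\<lambda>i. pure (x i) \<one>\<^bsub>R\<^esub>) \<in> I \<rightarrow> carrier AR" using xs by auto
    show "(\<lambda>i. ext_functional (\<xi> i)) \<in> I \<rightarrow> functionals R AR" using ext_functional[OF xi] by auto
  qed (rule expand)
qed

definition ext_bar where
  "ext_bar l U = (ext_functional l U \<oplus>\<^bsub>R\<^esub> ext_functional l U) \<odot>\<^bsub>AR\<^esub> \<one>\<^bsub>AR\<^esub> \<ominus>\<^bsub>AR\<^esub> U"

lemma ext_bar_closed: "l \<in> functionals k A \<Longrightarrow> U \<in> carrier AR \<Longrightarrow> ext_bar l U \<in> carrier AR"
  using functionals_closed[OF ext_functional, of l U] AR.unit_closed by (simp add: ext_bar_def)

lemma ext_bar_add_self: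
  "l \<in> functionals k A \<Longrightarrow> U \<in> carrier AR \<Longrightarrow>
    ext_bar l U \<oplus>\<^bsub>AR\<^esub> U = (ext_functional l U \<oplus>\<^bsub>R\<^esub> ext_functional l U) \<odot>\<^bsub>AR\<^esub> \<one>\<^bsub>AR\<^esub>"
  using functionals_closed[OF ext_functional, of l U] AR.unit_closed
  by (simp add: ext_bar_def AR.minus_eq AR.a_assoc AR.l_neg)

lemma ext_bar_add:
  assumes l: "l \<in> functionals k A" and UV: "U \<in> carrier AR" "V \<in> carrier AR"
  shows "ext_bar l (U \<oplus>\<^bsub>AR\<^esub> V) = ext_bar l U \<oplus>\<^bsub>AR\<^esub> ext_bar l V"
proof -
  note L = functionalsD(1-3)[OF ext_functional[OF l]]
  have "(ext_bar l U \<oplus>\<^bsub>AR\<^esub> ext_bar l V) \<oplus>\<^bsub>AR\<^esub> (U \<oplus>\<^bsub>AR\<^esub> V) =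
      (ext_bar l U \<oplus>\<^bsub>AR\<^esub> U) \<oplus>\<^bsub>AR\<^esub> (ext_bar l V \<oplus>\<^bsub>AR\<^esub> V)"
    using UV l by (simp add: ext_bar_closed AR.a_ac)
  also have "\<dots> = ext_bar l (U \<oplus>\<^bsub>AR\<^esub> V) \<oplus>\<^bsub>AR\<^esub> (U \<oplus>\<^bsub>AR\<^esub> V)"
    using UV l AR.unit_closed by (simp add: ext_bar_add_self L AR.smult_l_distr AR.a_ac)
  finally show ?thesis using UV l by (subst (asm) AR.add.right_cancel) (auto simp: ext_bar_closed)
qed

lemma ext_bar_pure:
  assumes l: "l \<in> functionals k A" and x: "x \<in> carrier A" "x' \<in> carrier A" and r: "r \<in> carrier R"
    and eq: "x' \<oplus>\<^bsub>A\<^esub> x = (l x \<oplus>\<^bsub>k\<^esub> l x) \<odot>\<^bsub>A\<^esub> \<one>\<^bsub>A\<^esub>"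
  shows "ext_bar l (pure x r) = pure x' r"
proof -
  have lx: "l x \<in> carrier k" by (rule functionals_closed[OF l x(1)])
  have "ext_bar l (pure x r) \<oplus>\<^bsub>AR\<^esub> pure x r = pure ((l x \<oplus>\<^bsub>k\<^esub> l x) \<odot>\<^bsub>A\<^esub> \<one>\<^bsub>A\<^esub>) r"
    using x r lx A.unit_closed
    by (simp add: ext_bar_add_self[OF l] ext_functional_pure[OF l] scalar_one
        S.smult_l_distr[symmetric] pure_balanced)
  also have "\<dots> = pure x' r \<oplus>\<^bsub>AR\<^esub> pure x r"
    unfolding eq[symmetric] by (rule ext_pure_add_left[OF x(2,1) r])
  finally show ?thesis using x r l by (subst (asm) AR.add.right_cancel) (auto simp: ext_bar_closed)
qed

text \<open>
  The hypothesis is the polarized quadratic equation.  It passes to the extension because it is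
  additive in each variable, which the equation in a single variable is not.
\<close>

lemma quadratic_extension:
  assumes h: "h \<in> carrier k" "h \<oplus>\<^bsub>k\<^esub> h = \<one>\<^bsub>k\<^esub>"
    and l: "l \<in> functionals k A" and l_one: "l \<one>\<^bsub>A\<^esub> = \<one>\<^bsub>k\<^esub>"
    and quad: "\<And>x y. x \<in> carrier A \<Longrightarrow> y \<in> carrier A \<Longrightarrow> \<exists>\<rho> \<in> carrier k.
      (x \<otimes>\<^bsub>A\<^esub> y \<oplus>\<^bsub>A\<^esub> y \<otimes>\<^bsub>A\<^esub> x) \<oplus>\<^bsub>A\<^esub> \<rho> \<odot>\<^bsub>A\<^esub> \<one>\<^bsub>A\<^esub> = (l x \<oplus>\<^bsub>k\<^esub> l x) \<odot>\<^bsub>A\<^esub> y \<oplus>\<^bsub>A\<^esub> (l y \<oplus>\<^bsub>k\<^esub> l y) \<odot>\<^bsub>A\<^esub> x"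
  shows "quadratic_algebra R AR (ext_functional l) (ext_bar l)"
proof -
  let ?L = "ext_functional l"
  note L = functionalsD(1-3)[OF ext_functional[OF l]] and Lp = ext_functional_pure[OF l]
    and lcl = functionals_closed[OF l]
  note [simp] = A.unit_closed AR.unit_closed A.mult_closed AR.mult_closed
  have ext_quad: "\<exists>\<rho> \<in> carrier R. (U \<otimes>\<^bsub>AR\<^esub> V \<oplus>\<^bsub>AR\<^esub> V \<otimes>\<^bsub>AR\<^esub> U) \<oplus>\<^bsub>AR\<^esub> \<rho> \<odot>\<^bsub>AR\<^esub> \<one>\<^bsub>AR\<^esub> =
      (?L U \<oplus>\<^bsub>R\<^esub> ?L U) \<odot>\<^bsub>AR\<^esub> V \<oplus>\<^bsub>AR\<^esub> (?L V \<oplus>\<^bsub>R\<^esub> ?L V) \<odot>\<^bsub>AR\<^esub> U" (is "?Q U V")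
    if U: "U \<in> carrier AR" and V: "V \<in> carrier AR" for U V
    using U
  proof (induction rule: ext_induct)
    case p1: (pure x r)
    show ?case using V
    proof (induction rule: ext_induct)
      case p2: (pure y s)
      obtain \<rho> where \<rho>: "\<rho> \<in> carrier k"
        "(x \<otimes>\<^bsub>A\<^esub> y \<oplus>\<^bsub>A\<^esub> y \<otimes>\<^bsub>A\<^esub> x) \<oplus>\<^bsub>A\<^esub> \<rho> \<odot>\<^bsub>A\<^esub> \<one>\<^bsub>A\<^esub> = (l x \<oplus>\<^bsub>k\<^esub> l x) \<odot>\<^bsub>A\<^esub> y \<oplus>\<^bsub>A\<^esub> (l y \<oplus>\<^bsub>k\<^esub> l y) \<odot>\<^bsub>A\<^esub> x"
        using quad p1 p2 by blast
      let ?t = "r \<otimes>\<^bsub>R\<^esub> s"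
      have t: "?t \<in> carrier R" using p1 p2 by simp
      have "(pure x r \<otimes>\<^bsub>AR\<^esub> pure y s \<oplus>\<^bsub>AR\<^esub> pure y s \<otimes>\<^bsub>AR\<^esub> pure x r) \<oplus>\<^bsub>AR\<^esub> (\<rho> \<odot>\<^bsub>R\<^esub> ?t) \<odot>\<^bsub>AR\<^esub> \<one>\<^bsub>AR\<^esub> =
          pure ((x \<otimes>\<^bsub>A\<^esub> y \<oplus>\<^bsub>A\<^esub> y \<otimes>\<^bsub>A\<^esub> x) \<oplus>\<^bsub>A\<^esub> \<rho> \<odot>\<^bsub>A\<^esub> \<one>\<^bsub>A\<^esub>) ?t"
        using p1 p2 t \<rho>(1) by (simp add: ext_pure_add_left pure_balanced scalar_one S.m_comm[of s r])
      also have "\<dots> = pure ((l x \<oplus>\<^bsub>k\<^esub> l x) \<odot>\<^bsub>A\<^esub> y) ?t \<oplus>\<^bsub>AR\<^esub> pure ((l y \<oplus>\<^bsub>k\<^esub> l y) \<odot>\<^bsub>A\<^esub> x) ?t"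
        unfolding \<rho>(2) using p1 p2 t lcl by (intro ext_pure_add_left) auto
      also have "pure ((l x \<oplus>\<^bsub>k\<^esub> l x) \<odot>\<^bsub>A\<^esub> y) ?t = (?L (pure x r) \<oplus>\<^bsub>R\<^esub> ?L (pure x r)) \<odot>\<^bsub>AR\<^esub> pure y s"
        using p1 p2 t lcl by (simp add: pure_balanced Lp S.smult_l_distr[symmetric] B.mult_smult_left)
      also have "pure ((l y \<oplus>\<^bsub>k\<^esub> l y) \<odot>\<^bsub>A\<^esub> x) ?t = (?L (pure y s) \<oplus>\<^bsub>R\<^esub> ?L (pure y s)) \<odot>\<^bsub>AR\<^esub> pure x r"
        using p1 p2 t lcl
        by (simp add: pure_balanced Lp S.smult_l_distr[symmetric] B.mult_smult_left S.m_comm[of r s])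
      finally show ?case using \<rho>(1) t by blast
    next
      case (add V V')
      then obtain \<rho> \<rho>' where \<rho>: "\<rho> \<in> carrier R" "\<rho>' \<in> carrier R"
        and e: "(pure x r \<otimes>\<^bsub>AR\<^esub> V \<oplus>\<^bsub>AR\<^esub> V \<otimes>\<^bsub>AR\<^esub> pure x r) \<oplus>\<^bsub>AR\<^esub> \<rho> \<odot>\<^bsub>AR\<^esub> \<one>\<^bsub>AR\<^esub> =
          (?L (pure x r) \<oplus>\<^bsub>R\<^esub> ?L (pure x r)) \<odot>\<^bsub>AR\<^esub> V \<oplus>\<^bsub>AR\<^esub> (?L V \<oplus>\<^bsub>R\<^esub> ?L V) \<odot>\<^bsub>AR\<^esub> pure x r"
        "(pure x r \<otimes>\<^bsub>AR\<^esub> V' \<oplus>\<^bsub>AR\<^esub> V' \<otimes>\<^bsub>AR\<^esub> pure x r) \<oplus>\<^bsub>AR\<^esub> \<rho>' \<odot>\<^bsub>AR\<^esub> \<one>\<^bsub>AR\<^esub> =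
          (?L (pure x r) \<oplus>\<^bsub>R\<^esub> ?L (pure x r)) \<odot>\<^bsub>AR\<^esub> V' \<oplus>\<^bsub>AR\<^esub> (?L V' \<oplus>\<^bsub>R\<^esub> ?L V') \<odot>\<^bsub>AR\<^esub> pure x r"
        by blast
      define P where "P = pure x r"
      have P: "P \<in> carrier AR" using p1 by (simp add: P_def)
      have "(P \<otimes>\<^bsub>AR\<^esub> (V \<oplus>\<^bsub>AR\<^esub> V') \<oplus>\<^bsub>AR\<^esub> (V \<oplus>\<^bsub>AR\<^esub> V') \<otimes>\<^bsub>AR\<^esub> P) \<oplus>\<^bsub>AR\<^esub> (\<rho> \<oplus>\<^bsub>R\<^esub> \<rho>') \<odot>\<^bsub>AR\<^esub> \<one>\<^bsub>AR\<^esub> =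
        ((P \<otimes>\<^bsub>AR\<^esub> V \<oplus>\<^bsub>AR\<^esub> V \<otimes>\<^bsub>AR\<^esub> P) \<oplus>\<^bsub>AR\<^esub> \<rho> \<odot>\<^bsub>AR\<^esub> \<one>\<^bsub>AR\<^esub>) \<oplus>\<^bsub>AR\<^esub>
        ((P \<otimes>\<^bsub>AR\<^esub> V' \<oplus>\<^bsub>AR\<^esub> V' \<otimes>\<^bsub>AR\<^esub> P) \<oplus>\<^bsub>AR\<^esub> \<rho>' \<odot>\<^bsub>AR\<^esub> \<one>\<^bsub>AR\<^esub>)"
        using P add(1,2) \<rho> by (simp add: AR.mult_add_left AR.mult_add_right AR.smult_l_distr AR.a_ac)
      also have "\<dots> = (?L P \<oplus>\<^bsub>R\<^esub> ?L P) \<odot>\<^bsub>AR\<^esub> (V \<oplus>\<^bsub>AR\<^esub> V') \<oplus>\<^bsub>AR\<^esub>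
          (?L (V \<oplus>\<^bsub>AR\<^esub> V') \<oplus>\<^bsub>R\<^esub> ?L (V \<oplus>\<^bsub>AR\<^esub> V')) \<odot>\<^bsub>AR\<^esub> P"
        unfolding e[folded P_def] using P add(1,2)
        by (simp add: L AR.smult_l_distr AR.smult_r_distr AR.a_ac)
      finally show ?case unfolding P_def using \<rho> by blast
    qed
  next
    case (add U U')
    then obtain \<rho> \<rho>' where \<rho>: "\<rho> \<in> carrier R" "\<rho>' \<in> carrier R"
      and e: "(U \<otimes>\<^bsub>AR\<^esub> V \<oplus>\<^bsub>AR\<^esub> V \<otimes>\<^bsub>AR\<^esub> U) \<oplus>\<^bsub>AR\<^esub> \<rho> \<odot>\<^bsub>AR\<^esub> \<one>\<^bsub>AR\<^esub> =
        (?L U \<oplus>\<^bsub>R\<^esub> ?L U) \<odot>\<^bsub>AR\<^esub> V \<oplus>\<^bsub>AR\<^esub> (?L V \<oplus>\<^bsub>R\<^esub> ?L V) \<odot>\<^bsub>AR\<^esub> U"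
      "(U' \<otimes>\<^bsub>AR\<^esub> V \<oplus>\<^bsub>AR\<^esub> V \<otimes>\<^bsub>AR\<^esub> U') \<oplus>\<^bsub>AR\<^esub> \<rho>' \<odot>\<^bsub>AR\<^esub> \<one>\<^bsub>AR\<^esub> =
        (?L U' \<oplus>\<^bsub>R\<^esub> ?L U') \<odot>\<^bsub>AR\<^esub> V \<oplus>\<^bsub>AR\<^esub> (?L V \<oplus>\<^bsub>R\<^esub> ?L V) \<odot>\<^bsub>AR\<^esub> U'"
      by blast
    have "((U \<oplus>\<^bsub>AR\<^esub> U') \<otimes>\<^bsub>AR\<^esub> V \<oplus>\<^bsub>AR\<^esub> V \<otimes>\<^bsub>AR\<^esub> (U \<oplus>\<^bsub>AR\<^esub> U')) \<oplus>\<^bsub>AR\<^esub> (\<rho> \<oplus>\<^bsub>R\<^esub> \<rho>') \<odot>\<^bsub>AR\<^esub> \<one>\<^bsub>AR\<^esub> =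
      ((U \<otimes>\<^bsub>AR\<^esub> V \<oplus>\<^bsub>AR\<^esub> V \<otimes>\<^bsub>AR\<^esub> U) \<oplus>\<^bsub>AR\<^esub> \<rho> \<odot>\<^bsub>AR\<^esub> \<one>\<^bsub>AR\<^esub>) \<oplus>\<^bsub>AR\<^esub>
      ((U' \<otimes>\<^bsub>AR\<^esub> V \<oplus>\<^bsub>AR\<^esub> V \<otimes>\<^bsub>AR\<^esub> U') \<oplus>\<^bsub>AR\<^esub> \<rho>' \<odot>\<^bsub>AR\<^esub> \<one>\<^bsub>AR\<^esub>)"
      using V add(1,2) \<rho> by (simp add: AR.mult_add_left AR.mult_add_right AR.smult_l_distr AR.a_ac)
    also have "\<dots> = (?L (U \<oplus>\<^bsub>AR\<^esub> U') \<oplus>\<^bsub>R\<^esub> ?L (U \<oplus>\<^bsub>AR\<^esub> U')) \<odot>\<^bsub>AR\<^esub> V \<oplus>\<^bsub>AR\<^esub>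
        (?L V \<oplus>\<^bsub>R\<^esub> ?L V) \<odot>\<^bsub>AR\<^esub> (U \<oplus>\<^bsub>AR\<^esub> U')"
      unfolding e using V add(1,2) by (simp add: L AR.smult_l_distr AR.smult_r_distr AR.a_ac)
    finally show ?case using \<rho> by blast
  qed
  let ?h = "h \<odot>\<^bsub>R\<^esub> \<one>\<^bsub>R\<^esub>"
  have hR: "?h \<in> carrier R" "?h \<oplus>\<^bsub>R\<^esub> ?h = \<one>\<^bsub>R\<^esub>"
    using h by (simp_all add: S.smult_l_distr[symmetric])
  show ?thesis
  proof (intro quadratic_algebra.intro unital_algebra_AR quadratic_algebra_axioms.intro)
    show "\<exists>h \<in> carrier R. h \<oplus>\<^bsub>R\<^esub> h = \<one>\<^bsub>R\<^esub>" using hR by blast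
    show "?L \<one>\<^bsub>AR\<^esub> = \<one>\<^bsub>R\<^esub>" by (simp add: ext_one Lp l_one)
    fix s assume s: "s \<in> carrier AR" "?L s = \<zero>\<^bsub>R\<^esub>"
    obtain \<rho> where \<rho>: "\<rho> \<in> carrier R" "(s \<otimes>\<^bsub>AR\<^esub> s \<oplus>\<^bsub>AR\<^esub> s \<otimes>\<^bsub>AR\<^esub> s) \<oplus>\<^bsub>AR\<^esub> \<rho> \<odot>\<^bsub>AR\<^esub> \<one>\<^bsub>AR\<^esub> = \<zero>\<^bsub>AR\<^esub>"
      using ext_quad[OF s(1) s(1)] s by auto
    have ss: "s \<otimes>\<^bsub>AR\<^esub> s \<oplus>\<^bsub>AR\<^esub> s \<otimes>\<^bsub>AR\<^esub> s = \<ominus>\<^bsub>AR\<^esub> (\<rho> \<odot>\<^bsub>AR\<^esub> \<one>\<^bsub>AR\<^esub>)"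
      by (rule AR.minus_equality[OF \<rho>(2), symmetric]) (use s \<rho>(1) in auto)
    have "s \<otimes>\<^bsub>AR\<^esub> s = (?h \<oplus>\<^bsub>R\<^esub> ?h) \<odot>\<^bsub>AR\<^esub> (s \<otimes>\<^bsub>AR\<^esub> s)" using s hR by simp
    also have "\<dots> = ?h \<odot>\<^bsub>AR\<^esub> (s \<otimes>\<^bsub>AR\<^esub> s \<oplus>\<^bsub>AR\<^esub> s \<otimes>\<^bsub>AR\<^esub> s)"
      using s hR(1) by (simp only: AR.smult_l_distr AR.smult_r_distr AR.mult_closed)
    also have "\<dots> = (?h \<otimes>\<^bsub>R\<^esub> \<ominus>\<^bsub>R\<^esub> \<rho>) \<odot>\<^bsub>AR\<^esub> \<one>\<^bsub>AR\<^esub>"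
      unfolding ss using hR(1) \<rho>(1) by (simp only: AR.smult_assoc1 AR.smult_l_minus S.a_inv_closed AR.unit_closed)
    finally show "\<exists>\<rho> \<in> carrier R. s \<otimes>\<^bsub>AR\<^esub> s = \<rho> \<odot>\<^bsub>AR\<^esub> \<one>\<^bsub>AR\<^esub>"
      using hR(1) \<rho>(1) by blast
  qed (use ext_functional[OF l] ext_bar_closed[OF l] ext_bar_add_self[OF l] in auto)
qed

lemma ext_trivial:
  assumes l: "l \<in> functionals k A" and triv: "\<forall>x \<in> carrier A. x = l x \<odot>\<^bsub>A\<^esub> \<one>\<^bsub>A\<^esub>" and U: "U \<in> carrier AR"
  shows "U = ext_functional l U \<odot>\<^bsub>AR\<^esub> \<one>\<^bsub>AR\<^esub>"
  using U
proof (induction rule: ext_induct)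
  case (pure x r)
  have "pure x r = pure (l x \<odot>\<^bsub>A\<^esub> \<one>\<^bsub>A\<^esub>) r"
    using triv pure(1) by (intro arg_cong[where f = "\<lambda>x. pure x r"]) (rule bspec)
  also have "\<dots> = ext_functional l (pure x r) \<odot>\<^bsub>AR\<^esub> \<one>\<^bsub>AR\<^esub>"
    using pure functionals_closed[OF l]
    by (simp add: ext_functional_pure[OF l] scalar_one pure_balanced A.unit_closed)
  finally show ?case .
next
  case (add U V)
  have "U \<oplus>\<^bsub>AR\<^esub> V = ext_functional l U \<odot>\<^bsub>AR\<^esub> \<one>\<^bsub>AR\<^esub> \<oplus>\<^bsub>AR\<^esub> ext_functional l V \<odot>\<^bsub>AR\<^esub> \<one>\<^bsub>AR\<^esub>"
    by (rule arg_cong2[OF add(3,4)])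
  also have "\<dots> = ext_functional l (U \<oplus>\<^bsub>AR\<^esub> V) \<odot>\<^bsub>AR\<^esub> \<one>\<^bsub>AR\<^esub>"
    using add(1,2) AR.unit_closed functionalsD(1,2)[OF ext_functional[OF l]] by (simp add: AR.smult_l_distr)
  finally show ?case .
qed

lemma ext_unit_square:
  assumes l: "l \<in> functionals k A" and s: "s \<in> carrier A" "l s = \<zero>\<^bsub>k\<^esub>"
    and \<nu>: "\<nu> \<in> Units k" "s \<otimes>\<^bsub>A\<^esub> s = \<nu> \<odot>\<^bsub>A\<^esub> \<one>\<^bsub>A\<^esub>"
  shows "ext_functional l (pure s \<one>\<^bsub>R\<^esub>) = \<zero>\<^bsub>R\<^esub>"
    "\<exists>\<nu> \<in> Units R. pure s \<one>\<^bsub>R\<^esub> \<otimes>\<^bsub>AR\<^esub> pure s \<one>\<^bsub>R\<^esub> = \<nu> \<odot>\<^bsub>AR\<^esub> \<one>\<^bsub>AR\<^esub>"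
proof -
  show "ext_functional l (pure s \<one>\<^bsub>R\<^esub>) = \<zero>\<^bsub>R\<^esub>"
    using s by (simp add: ext_functional_pure[OF l])
  obtain \<nu>' where \<nu>': "\<nu> \<in> carrier k" "\<nu>' \<in> carrier k" "\<nu> \<otimes>\<^bsub>k\<^esub> \<nu>' = \<one>\<^bsub>k\<^esub>" "\<nu>' \<otimes>\<^bsub>k\<^esub> \<nu> = \<one>\<^bsub>k\<^esub>"
    using \<nu>(1) by (auto simp: Units_def)
  have "(a \<odot>\<^bsub>R\<^esub> \<one>\<^bsub>R\<^esub>) \<otimes>\<^bsub>R\<^esub> (c \<odot>\<^bsub>R\<^esub> \<one>\<^bsub>R\<^esub>) = \<one>\<^bsub>R\<^esub>"
    if "a \<in> carrier k" "c \<in> carrier k" "a \<otimes>\<^bsub>k\<^esub> c = \<one>\<^bsub>k\<^esub>" for a c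
    using that by (simp add: B.mult_smult_left S.smult_assoc1[symmetric])
  then have "\<nu> \<odot>\<^bsub>R\<^esub> \<one>\<^bsub>R\<^esub> \<in> Units R"
    using \<nu>' unfolding Units_def by (auto intro!: bexI[of _ "\<nu>' \<odot>\<^bsub>R\<^esub> \<one>\<^bsub>R\<^esub>"])
  moreover have "pure s \<one>\<^bsub>R\<^esub> \<otimes>\<^bsub>AR\<^esub> pure s \<one>\<^bsub>R\<^esub> = (\<nu> \<odot>\<^bsub>R\<^esub> \<one>\<^bsub>R\<^esub>) \<odot>\<^bsub>AR\<^esub> \<one>\<^bsub>AR\<^esub>"
    using s \<nu> \<nu>' by (simp add: scalar_one pure_balanced A.unit_closed)
  ultimately show "\<exists>\<nu> \<in> Units R. pure s \<one>\<^bsub>R\<^esub> \<otimes>\<^bsub>AR\<^esub> pure s \<one>\<^bsub>R\<^esub> = \<nu> \<odot>\<^bsub>AR\<^esub> \<one>\<^bsub>AR\<^esub>" by blast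
qed

end

context composition_algebra
begin

definition half_trace where "half_trace h x = h \<otimes>\<^bsub>k\<^esub> b x \<one>\<^bsub>C\<^esub>"

context
  fixes h
  assumes h [simp]: "h \<in> carrier k" and hh: "h \<oplus>\<^bsub>k\<^esub> h = \<one>\<^bsub>k\<^esub>"
begin

lemma half_trace_functional: "half_trace h \<in> functionals k C"
  by (simp add: functionals_def add_hom_iff half_trace_def unit_closed polar_add polar_smult R.r_distr R.m_lcomm)

lemma half_trace_double: "x \<in> carrier C \<Longrightarrow> half_trace h x \<oplus>\<^bsub>k\<^esub> half_trace h x = b x \<one>\<^bsub>C\<^esub>"
  by (simp add: half_trace_def R.l_distr[symmetric] hh unit_closed)

lemma half_trace_one: "\<one>\<^bsub>C\<^esub> \<noteq> \<zero>\<^bsub>C\<^esub> \<Longrightarrow> half_trace h \<one>\<^bsub>C\<^esub> = \<one>\<^bsub>k\<^esub>"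
  by (simp add: half_trace_def b_self unit_closed norm_one R.r_distr hh)

lemma half_trace_quadratic:
  "x \<in> carrier C \<Longrightarrow> y \<in> carrier C \<Longrightarrow> \<exists>\<rho> \<in> carrier k.
    (x \<otimes>\<^bsub>C\<^esub> y \<oplus>\<^bsub>C\<^esub> y \<otimes>\<^bsub>C\<^esub> x) \<oplus>\<^bsub>C\<^esub> \<rho> \<odot>\<^bsub>C\<^esub> \<one>\<^bsub>C\<^esub> =
    (half_trace h x \<oplus>\<^bsub>k\<^esub> half_trace h x) \<odot>\<^bsub>C\<^esub> y \<oplus>\<^bsub>C\<^esub> (half_trace h y \<oplus>\<^bsub>k\<^esub> half_trace h y) \<odot>\<^bsub>C\<^esub> x"
  by (intro bexI[of _ "b x y"]) (simp_all add: half_trace_double quadratic_equation_polarized)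

lemma standard_involution_add_self:
  "x \<in> carrier C \<Longrightarrow> standard_involution k C n x \<oplus>\<^bsub>C\<^esub> x =
    (half_trace h x \<oplus>\<^bsub>k\<^esub> half_trace h x) \<odot>\<^bsub>C\<^esub> \<one>\<^bsub>C\<^esub>"
  by (simp add: standard_involution_def half_trace_double unit_closed M.minus_eq M.a_assoc M.l_neg)

end

lemma standard_involution_linear: "standard_involution k C n \<in> linear_maps k C C"
proof -
  have "standard_involution k C n (x \<oplus>\<^bsub>C\<^esub> y) =
      standard_involution k C n x \<oplus>\<^bsub>C\<^esub> standard_involution k C n y"
    if "x \<in> carrier C" "y \<in> carrier C" for x y
    using that by (simp add: standard_involution_def polar_add unit_closed smult_l_distr M.minus_eq
        M.minus_add M.a_ac)
  moreover have "standard_involution k C n (r \<odot>\<^bsub>C\<^esub> x) = r \<odot>\<^bsub>C\<^esub> standard_involution k C n x"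
    if "r \<in> carrier k" "x \<in> carrier C" for r x
    using that by (simp add: standard_involution_def polar_smult unit_closed smult_assoc1 M.minus_eq
        smult_r_distr smult_r_minus)
  moreover have "standard_involution k C n x \<in> carrier C" if "x \<in> carrier C" for x
    using that by (simp add: standard_involution_def unit_closed)
  ultimately show ?thesis by (simp add: linear_maps_def add_hom_iff)
qed

lemma one_neq_zero_of_dimension:
  assumes "has_dimension k C m" "m \<noteq> 0"
  shows "\<one>\<^bsub>C\<^esub> \<noteq> \<zero>\<^bsub>C\<^esub>"
proof
  assume one: "\<one>\<^bsub>C\<^esub> = \<zero>\<^bsub>C\<^esub>"
  interpret V: vectorspace k C using assms by (simp add: has_dimension_def)
  obtain X \<xi> where X: "card X = m" "dual_basis k C X (\<lambda>x. x) \<xi>"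
    using V.dual_basis_exists assms unfolding has_dimension_def by metis
  then obtain x where x: "x \<in> X" using assms(2) by (metis card.empty all_not_in_conv)
  have xC: "x \<in> carrier C" and xi: "\<xi> x \<in> functionals k C" and xx: "\<xi> x x = \<one>\<^bsub>k\<^esub>"
    using X(2) x unfolding dual_basis_def by auto
  have "\<one>\<^bsub>C\<^esub> \<otimes>\<^bsub>C\<^esub> x = \<zero>\<^bsub>C\<^esub>" unfolding one using xC by (rule mult_zero_left)
  then have "x = \<zero>\<^bsub>C\<^esub>" using xC by (simp add: unit_left)
  moreover have "\<xi> x \<zero>\<^bsub>C\<^esub> = \<zero>\<^bsub>k\<^esub>"
    by (rule add_hom_zero[OF M.abelian_group_axioms R.abelian_group_axioms functionals_add_hom[OF xi]])
  ultimately show False using xx by simp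
qed

text \<open>
  The scalars form a line, so larger dimensions leave only the second alternative of
  \<open>scalars_or_anisotropic\<close>; in dimension one the half trace is injective because it maps 1 to 1, so that
  no traceless element has an invertible square.
\<close>

lemma dimension_alternatives:
  assumes h: "h \<in> carrier k" "h \<oplus>\<^bsub>k\<^esub> h = \<one>\<^bsub>k\<^esub>" and dim: "has_dimension k C m" "m \<noteq> 0"
  shows "m = 1 \<Longrightarrow> \<forall>x \<in> carrier C. x = half_trace h x \<odot>\<^bsub>C\<^esub> \<one>\<^bsub>C\<^esub>" (is "_ \<Longrightarrow> ?triv")
    and "m \<noteq> 1 \<Longrightarrow> \<exists>s \<in> carrier C. half_trace h s = \<zero>\<^bsub>k\<^esub> \<and> (\<exists>\<nu> \<in> Units k. s \<otimes>\<^bsub>C\<^esub> s = \<nu> \<odot>\<^bsub>C\<^esub> \<one>\<^bsub>C\<^esub>)" (is "_ \<Longrightarrow> ?unit")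
proof -
  note one = one_neq_zero_of_dimension[OF dim]
  interpret V: vectorspace k C using dim by (simp add: has_dimension_def)
  note lin = functionalsD(1-3)[OF half_trace_functional[OF h]]
  have alt: "?triv \<or> ?unit"
    using scalars_or_anisotropic[OF h one] h unfolding half_trace_def by fastforce
  show ?unit if "m \<noteq> 1"
  proof (rule ccontr)
    assume "\<not> ?unit"
    then have triv: ?triv using alt by blast
    have "x \<in> span {\<one>\<^bsub>C\<^esub>}" if x: "x \<in> carrier C" for x
    proof -
      have "x = lincomb (\<lambda>_. half_trace h x) {\<one>\<^bsub>C\<^esub>}"
        using triv x lin(1)[OF x] unit_closed by (simp add: lincomb_def)
      then show ?thesis using lin(1)[OF x] unfolding span_def by blast
    qed
    moreover have "span {\<one>\<^bsub>C\<^esub>} \<subseteq> carrier C" using unit_closed by (intro span_is_subset2) simp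
    ultimately have "span {\<one>\<^bsub>C\<^esub>} = carrier C" by blast
    then have "V.dim \<le> 1" using V.gen_ge_dim[of "{\<one>\<^bsub>C\<^esub>}"] unit_closed by simp
    then show False using dim that by (simp add: has_dimension_def)
  qed
  show ?triv if m: "m = 1"
  proof (rule ccontr)
    assume "\<not> ?triv"
    then obtain s \<nu> where s: "s \<in> carrier C" "half_trace h s = \<zero>\<^bsub>k\<^esub>"
      and \<nu>: "\<nu> \<in> Units k" "s \<otimes>\<^bsub>C\<^esub> s = \<nu> \<odot>\<^bsub>C\<^esub> \<one>\<^bsub>C\<^esub>"
      using alt by blast
    obtain X \<xi> where X: "card X = 1" "dual_basis k C X (\<lambda>x. x) \<xi>"
      using V.dual_basis_exists dim m unfolding has_dimension_def by metis
    then obtain e where e: "X = {e}" by (metis card_1_singletonE)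
    have eC: "e \<in> carrier C" and xi: "\<xi> e \<in> functionals k C"
      and sum: "\<And>u. u \<in> carrier C \<Longrightarrow> u = (\<Oplus>\<^bsub>C\<^esub>i \<in> {e}. \<xi> i u \<odot>\<^bsub>C\<^esub> i)"
      using X(2) unfolding dual_basis_def e by blast+
    note xi_cl = functionals_closed[OF xi]
    have ex: "u = \<xi> e u \<odot>\<^bsub>C\<^esub> e" if "u \<in> carrier C" for u
    proof -
      have "u = (\<Oplus>\<^bsub>C\<^esub>i \<in> {e}. \<xi> i u \<odot>\<^bsub>C\<^esub> i)" by (rule sum[OF that])
      also have "\<dots> = \<xi> e u \<odot>\<^bsub>C\<^esub> e" using xi_cl[OF that] eC by simp
      finally show ?thesis .
    qed
    have tr: "half_trace h u = \<xi> e u \<otimes>\<^bsub>k\<^esub> half_trace h e" if "u \<in> carrier C" for u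
      using arg_cong[OF ex[OF that], of "half_trace h"] lin(3)[OF xi_cl[OF that] eC] by simp
    have "half_trace h e \<noteq> \<zero>\<^bsub>k\<^esub>"
      using tr[OF unit_closed] half_trace_one[OF h one] xi_cl[OF unit_closed] by auto
    then have "\<xi> e s = \<zero>\<^bsub>k\<^esub>"
      using tr[OF s(1)] s(2) xi_cl[OF s(1)] lin(1)[OF eC] integral[of "\<xi> e s" "half_trace h e"] by auto
    then have s0: "s = \<zero>\<^bsub>C\<^esub>" using ex[OF s(1)] eC by simp
    have "half_trace h (\<nu> \<odot>\<^bsub>C\<^esub> \<one>\<^bsub>C\<^esub>) = half_trace h \<zero>\<^bsub>C\<^esub>"
      using \<nu>(2) unfolding s0 by (simp add: mult_zero_left)
    moreover have "half_trace h \<zero>\<^bsub>C\<^esub> = \<zero>\<^bsub>k\<^esub>"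
      using s(2) unfolding s0 .
    moreover have "half_trace h (\<nu> \<odot>\<^bsub>C\<^esub> \<one>\<^bsub>C\<^esub>) = \<nu>"
      using lin(3)[of \<nu> "\<one>\<^bsub>C\<^esub>"] \<nu>(1) half_trace_one[OF h one] unit_closed by (simp add: R.Units_closed)
    ultimately show False using \<nu>(1) field_Units by auto
  qed
qed

end

section \<open>Groups of automorphisms\<close>

lemma algebra_aut_iff:
  "f \<in> algebra_aut R X \<longleftrightarrow> f \<in> Bij (carrier X) \<and> f \<in> linear_maps R X X \<and>
    (\<forall>x \<in> carrier X. \<forall>y \<in> carrier X. f (x \<otimes>\<^bsub>X\<^esub> y) = f x \<otimes>\<^bsub>X\<^esub> f y) \<and> f \<one>\<^bsub>X\<^esub> = \<one>\<^bsub>X\<^esub>"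
  by (auto simp: algebra_aut_def algebra_hom_def ring_hom_def linear_maps_def add_hom_iff)

text \<open>For the identity \<open>\<sigma>\<close> these are all automorphisms, so this covers both kinds of automorphism groups.\<close>

definition involutive_automorphisms where
  "involutive_automorphisms R X \<sigma> =
    {f \<in> algebra_aut R X. \<forall>u \<in> carrier X. f (\<sigma> u) = \<sigma> (f u)}"

lemma algebra_aut_inverse:
  assumes X: "unital_algebra R X" and f: "f \<in> algebra_aut R X"
  defines "g \<equiv> restrict (inv_into (carrier X) f) (carrier X)"
  shows "g \<in> algebra_aut R X" "\<And>x. x \<in> carrier X \<Longrightarrow> g (f x) = x" "\<And>x. x \<in> carrier X \<Longrightarrow> f (g x) = x"
proof -
  interpret X: unital_algebra R X by fact
  have bij: "bij_betw f (carrier X) (carrier X)" and B: "f \<in> Bij (carrier X)"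
    using f by (auto simp: algebra_aut_iff Bij_def)
  have fl: "f \<in> linear_maps R X X" using f by (simp add: algebra_aut_iff)
  have fm: "f (x \<otimes>\<^bsub>X\<^esub> y) = f x \<otimes>\<^bsub>X\<^esub> f y" if "x \<in> carrier X" "y \<in> carrier X" for x y
    using f that by (simp add: algebra_aut_iff)
  note fs = linear_mapsD(1-3)[OF fl]
  show gf: "g (f x) = x" if "x \<in> carrier X" for x
    using that bij fs(1) by (simp add: g_def bij_betw_inv_into_left)
  show fg: "f (g x) = x" if "x \<in> carrier X" for x
    using that bij by (simp add: g_def bij_betw_inv_into_right)
  have gc: "g x \<in> carrier X" if "x \<in> carrier X" for x
    using that B by (simp add: g_def Bij_inv_into_mem)
  have "g (x \<oplus>\<^bsub>X\<^esub> y) = g x \<oplus>\<^bsub>X\<^esub> g y" if "x \<in> carrier X" "y \<in> carrier X" for x y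
    using gf[of "g x \<oplus>\<^bsub>X\<^esub> g y"] that by (simp add: fs gc fg)
  moreover have "g (r \<odot>\<^bsub>X\<^esub> x) = r \<odot>\<^bsub>X\<^esub> g x" if "r \<in> carrier R" "x \<in> carrier X" for r x
    using gf[of "r \<odot>\<^bsub>X\<^esub> g x"] that by (simp add: fs gc fg)
  moreover have "g (x \<otimes>\<^bsub>X\<^esub> y) = g x \<otimes>\<^bsub>X\<^esub> g y" if "x \<in> carrier X" "y \<in> carrier X" for x y
    using gf[of "g x \<otimes>\<^bsub>X\<^esub> g y"] that by (simp add: fm gc fg X.mult_closed)
  moreover have "g \<one>\<^bsub>X\<^esub> = \<one>\<^bsub>X\<^esub>"
    using gf[OF X.unit_closed] f by (simp add: algebra_aut_iff)
  ultimately show "g \<in> algebra_aut R X"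
    using B gc by (simp add: algebra_aut_iff linear_maps_def add_hom_iff g_def restrict_inv_into_Bij)
qed

lemma involutive_automorphisms_inverse:
  assumes X: "unital_algebra R X" and \<sigma>: "\<And>u. u \<in> carrier X \<Longrightarrow> \<sigma> u \<in> carrier X"
    and f: "f \<in> involutive_automorphisms R X \<sigma>"
  shows "restrict (inv_into (carrier X) f) (carrier X) \<in> involutive_automorphisms R X \<sigma>" (is "?g \<in> _")
proof -
  have fa: "f \<in> algebra_aut R X" and fs: "\<And>u. u \<in> carrier X \<Longrightarrow> f (\<sigma> u) = \<sigma> (f u)"
    using f by (auto simp: involutive_automorphisms_def)
  note g = algebra_aut_inverse[OF X fa]
  have gc: "?g u \<in> carrier X" if "u \<in> carrier X" for u
    using g(1) that by (auto simp: algebra_aut_iff linear_maps_def add_hom_iff)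
  have "?g (\<sigma> u) = \<sigma> (?g u)" if u: "u \<in> carrier X" for u
  proof -
    have "?g (\<sigma> u) = ?g (\<sigma> (f (?g u)))" using g(3)[OF u] by simp
    also have "\<dots> = ?g (f (\<sigma> (?g u)))" using fs[OF gc[OF u]] by simp
    also have "\<dots> = \<sigma> (?g u)" by (rule g(2)[OF \<sigma>[OF gc[OF u]]])
    finally show ?thesis .
  qed
  then show ?thesis using g(1) by (simp add: involutive_automorphisms_def)
qed

lemma involutive_automorphisms_group:
  assumes X: "unital_algebra R X" and \<sigma>: "\<And>u. u \<in> carrier X \<Longrightarrow> \<sigma> u \<in> carrier X"
  shows "group (BijGroup (carrier X) \<lparr>carrier := involutive_automorphisms R X \<sigma>\<rparr>)"
proof -
  interpret X: unital_algebra R X by fact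
  interpret G: group "BijGroup (carrier X)" by (rule group_BijGroup)
  have sub: "f \<in> Bij (carrier X)" if "f \<in> involutive_automorphisms R X \<sigma>" for f
    using that by (simp add: involutive_automorphisms_def algebra_aut_iff)
  have "subgroup (involutive_automorphisms R X \<sigma>) (BijGroup (carrier X))"
  proof (rule G.subgroupI)
    show "involutive_automorphisms R X \<sigma> \<subseteq> carrier (BijGroup (carrier X))"
      using sub by (auto simp: BijGroup_def)
    have "(\<lambda>x \<in> carrier X. x) \<in> involutive_automorphisms R X \<sigma>"
      using \<sigma> by (simp add: involutive_automorphisms_def algebra_aut_iff id_Bij linear_maps_def
          add_hom_iff X.mult_closed X.unit_closed)
    then show "involutive_automorphisms R X \<sigma> \<noteq> {}" by blast
    show "inv\<^bsub>BijGroup (carrier X)\<^esub> f \<in> involutive_automorphisms R X \<sigma>"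
      if f: "f \<in> involutive_automorphisms R X \<sigma>" for f
      using involutive_automorphisms_inverse[OF X \<sigma> f] sub[OF f] by (simp add: inv_BijGroup)
    show "f \<otimes>\<^bsub>BijGroup (carrier X)\<^esub> g \<in> involutive_automorphisms R X \<sigma>"
      if fg: "f \<in> involutive_automorphisms R X \<sigma>" "g \<in> involutive_automorphisms R X \<sigma>" for f g
    proof -
      have "compose (carrier X) f g \<in> Bij (carrier X)"
        using sub[OF fg(1)] sub[OF fg(2)] by (rule compose_Bij)
      then have "compose (carrier X) f g \<in> involutive_automorphisms R X \<sigma>"
        using fg \<sigma> by (simp add: involutive_automorphisms_def algebra_aut_iff linear_maps_def add_hom_iff
            compose_def X.mult_closed X.unit_closed)
      then show ?thesis using sub[OF fg(1)] sub[OF fg(2)] by (simp add: BijGroup_def)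
    qed
  qed
  then show ?thesis by (rule G.subgroup_imp_group)
qed

lemma Aut_scheme_eq:
  "Aut_scheme k A R =
    BijGroup (carrier (base_change k A R)) \<lparr>carrier := involutive_automorphisms R (base_change k A R) (\<lambda>u. u)\<rparr>"
  by (simp add: Aut_scheme_def involutive_automorphisms_def)

lemma Aut_inv_scheme_eq:
  "Aut_inv_scheme k A \<sigma> R =
    BijGroup (carrier (base_change k A R))
      \<lparr>carrier := involutive_automorphisms R (base_change k A R) (tensor_map k A R A R \<sigma> (\<lambda>r. r))\<rparr>"
  by (simp add: Aut_inv_scheme_def involutive_automorphisms_def)

text \<open>
  The conjugation is determined by the decomposition into a scalar and a traceless part, which
  automorphisms respect.
\<close>

lemma (in quadratic_algebra) automorphism_bar:
  assumes f: "f \<in> algebra_endos" and g: "g \<in> algebra_endos"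
    and gf: "\<And>x. x \<in> carrier A \<Longrightarrow> g (f x) = x"
    and nontriv: "trivial_algebra \<or> (\<exists>s. unit_square s)"
    and x: "x \<in> carrier A"
  shows "f (bar x) = bar (f x)"
proof -
  obtain s where s: "s \<in> traceless" "x = l x \<odot>\<^bsub>A\<^esub> \<one>\<^bsub>A\<^esub> \<oplus>\<^bsub>A\<^esub> s"
    using scalar_plus_traceless[OF x] by blast
  define r where "r = l x"
  have r: "r \<in> carrier R" using x by (simp add: r_def)
  have fl: "f \<in> linear_maps R A A" and f1: "f \<one>\<^bsub>A\<^esub> = \<one>\<^bsub>A\<^esub>" using f by (auto simp: algebra_endos_def)
  note fs = linear_mapsD(1-3)[OF fl]
  have fm: "f (\<ominus>\<^bsub>A\<^esub> s) = \<ominus>\<^bsub>A\<^esub> f s"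
    using s(1) by (intro add_hom_a_inv[OF abelian_group_axioms abelian_group_axioms linear_maps_add_hom[OF fl]]) auto
  have f_tr: "f s \<in> traceless" by (rule automorphism_traceless[OF f g gf nontriv s(1)])
  have "f (bar (r \<odot>\<^bsub>A\<^esub> \<one>\<^bsub>A\<^esub> \<oplus>\<^bsub>A\<^esub> s)) = bar (f (r \<odot>\<^bsub>A\<^esub> \<one>\<^bsub>A\<^esub> \<oplus>\<^bsub>A\<^esub> s))"
    using r s(1) f_tr by (simp add: bar_eq fs fm f1)
  then show ?thesis by (simp only: s(2)[folded r_def, symmetric])
qed

section \<open>The isomorphism on points\<close>

text \<open>
  The condition on the ranks is what excludes an exchange of the factors.  It is demanded only when both
  factors are nontrivial, because a trivial factor has no nonzero traceless elements to be exchanged.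
\<close>

locale split_extension =
  D: double_extension k A B R +
  P: algebra_product R "base_change k A R" l bar "base_change k B R" l' bar'
    "base_change k (tensor_algebra k A B) R" "double_extension.ext_prod k A B R" E E' \<sigma>
  for k and A and B and R and l and bar and l' and bar' and E and E' and \<sigma> +
  fixes I and x and \<xi> and J and y and \<eta>
  assumes alt_A: "P.A.trivial_algebra \<or> (\<exists>s. P.A.unit_square s)"
    and alt_B: "P.B.trivial_algebra \<or> (\<exists>t. P.B.unit_square t)"
    and ranks: "P.A.trivial_algebra \<or> P.B.trivial_algebra \<or>
      dual_basis R (base_change k A R) I x \<xi> \<and> dual_basis R (base_change k B R) J y \<eta> \<and>
      (\<forall>r \<in> carrier R. [card I] \<cdot>\<^bsub>R\<^esub> r = [card J] \<cdot>\<^bsub>R\<^esub> r \<longrightarrow> r = \<zero>\<^bsub>R\<^esub>)"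
begin

abbreviation p where "p \<equiv> D.ext_prod"
abbreviation \<phi> where "\<phi> \<equiv> tensor_aut k A B R"

lemma aut_endos_A: "f \<in> algebra_aut R D.A\<^sub>R \<longleftrightarrow> f \<in> Bij (carrier D.A\<^sub>R) \<and> f \<in> P.A.algebra_endos"
  by (auto simp: algebra_aut_iff P.A.algebra_endos_def)

lemma aut_endos_B: "f \<in> algebra_aut R D.B\<^sub>R \<longleftrightarrow> f \<in> Bij (carrier D.B\<^sub>R) \<and> f \<in> P.B.algebra_endos"
  by (auto simp: algebra_aut_iff P.B.algebra_endos_def)

lemma aut_endos_W:
  "f \<in> involutive_automorphisms R D.W \<sigma> \<longleftrightarrow> f \<in> Bij (carrier D.W) \<and> f \<in> P.inv_endos"
  by (auto simp: involutive_automorphisms_def algebra_aut_iff P.inv_endos_def)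

lemma \<sigma>_closed: "w \<in> carrier D.W \<Longrightarrow> \<sigma> w \<in> carrier D.W"
  using P.\<sigma>_hom by (simp add: add_hom_iff)

lemma phi_inv_endo:
  assumes f1: "f1 \<in> P.A.algebra_endos" and f2: "f2 \<in> P.B.algebra_endos"
    and b1: "\<And>u. u \<in> carrier D.A\<^sub>R \<Longrightarrow> f1 (bar u) = bar (f1 u)"
    and b2: "\<And>v. v \<in> carrier D.B\<^sub>R \<Longrightarrow> f2 (bar' v) = bar' (f2 v)"
  shows "\<phi> (f1, f2) \<in> P.inv_endos"
proof -
  have l1: "f1 \<in> linear_maps R D.A\<^sub>R D.A\<^sub>R" and l2: "f2 \<in> linear_maps R D.B\<^sub>R D.B\<^sub>R"
    using f1 f2 by (auto simp: P.A.algebra_endos_def P.B.algebra_endos_def)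
  have m1: "f1 (u \<otimes>\<^bsub>D.A\<^sub>R\<^esub> u') = f1 u \<otimes>\<^bsub>D.A\<^sub>R\<^esub> f1 u'" if "u \<in> carrier D.A\<^sub>R" "u' \<in> carrier D.A\<^sub>R" for u u'
    using f1 that by (simp add: P.A.algebra_endos_def)
  have m2: "f2 (u \<otimes>\<^bsub>D.B\<^sub>R\<^esub> u') = f2 u \<otimes>\<^bsub>D.B\<^sub>R\<^esub> f2 u'" if "u \<in> carrier D.B\<^sub>R" "u' \<in> carrier D.B\<^sub>R" for u u'
    using f2 that by (simp add: P.B.algebra_endos_def)
  have o1: "f1 \<one>\<^bsub>D.A\<^sub>R\<^esub> = \<one>\<^bsub>D.A\<^sub>R\<^esub>" "f2 \<one>\<^bsub>D.B\<^sub>R\<^esub> = \<one>\<^bsub>D.B\<^sub>R\<^esub>"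
    using f1 f2 by (auto simp: P.A.algebra_endos_def P.B.algebra_endos_def)
  note fs = linear_mapsD(1-3)[OF l1] linear_mapsD(1-3)[OF l2]
  define F where "F = \<phi> (f1, f2)"
  have F: "F \<in> add_hom D.W D.W" and Fp: "\<And>u v. u \<in> carrier D.A\<^sub>R \<Longrightarrow> v \<in> carrier D.B\<^sub>R \<Longrightarrow> F (p u v) = p (f1 u) (f2 v)"
    using D.tensor_aut_hom[OF l1 l2] D.tensor_aut_prod[OF l1 l2] by (simp_all add: F_def)
  have Fc: "\<And>w. w \<in> carrier D.W \<Longrightarrow> F w \<in> carrier D.W"
    and Fa: "\<And>w w'. w \<in> carrier D.W \<Longrightarrow> w' \<in> carrier D.W \<Longrightarrow> F (w \<oplus>\<^bsub>D.W\<^esub> w') = F w \<oplus>\<^bsub>D.W\<^esub> F w'"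
    using F by (auto simp: add_hom_iff)
  have "F (r \<odot>\<^bsub>D.W\<^esub> w) = r \<odot>\<^bsub>D.W\<^esub> F w" if r: "r \<in> carrier R" and w: "w \<in> carrier D.W" for r w
    using w
  proof (induction rule: D.ext_prod_induct)
    case (prod U V)
    have "F (r \<odot>\<^bsub>D.W\<^esub> p U V) = F (p (r \<odot>\<^bsub>D.A\<^sub>R\<^esub> U) V)"
      by (simp only: P.p_smult_left[OF r prod])
    also have "\<dots> = p (f1 (r \<odot>\<^bsub>D.A\<^sub>R\<^esub> U)) (f2 V)"
      using prod r by (intro Fp) auto
    also have "\<dots> = r \<odot>\<^bsub>D.W\<^esub> F (p U V)"
      using prod r by (simp add: Fp fs P.p_smult_left)
    finally show ?case .
  next
    case (add w w')
    then show ?case using r by (simp add: D.W.AR.smult_r_distr Fa Fc)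
  qed
  then have Fl: "F \<in> linear_maps R D.W D.W" using F by (simp add: linear_maps_def)
  have "F (w \<otimes>\<^bsub>D.W\<^esub> w') = F w \<otimes>\<^bsub>D.W\<^esub> F w'" if w: "w \<in> carrier D.W" and w': "w' \<in> carrier D.W" for w w'
    using w
  proof (induction rule: D.ext_prod_induct)
    case p1: (prod U V)
    show ?case using w'
    proof (induction rule: D.ext_prod_induct)
      case p2: (prod U' V')
      show ?case
        using p1 p2 by (simp add: P.p_mult Fp fs m1 m2 D.AR.AR.mult_closed D.BR.AR.mult_closed)
    next
      case (add w w')
      then show ?case using p1 by (simp add: D.W.AR.mult_add_right D.W.AR.mult_closed Fa Fc)
    qed
  next
    case (add v v')
    then show ?case using w' by (simp add: D.W.AR.mult_add_left D.W.AR.mult_closed Fa Fc)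
  qed
  moreover have "F \<one>\<^bsub>D.W\<^esub> = \<one>\<^bsub>D.W\<^esub>"
    unfolding P.p_one[symmetric] by (simp add: Fp D.AR.AR.unit_closed D.BR.AR.unit_closed o1)
  moreover have "F (\<sigma> w) = \<sigma> (F w)" if w: "w \<in> carrier D.W" for w
    using w
  proof (induction rule: D.ext_prod_induct)
    case (prod U V)
    then show ?case by (simp add: P.\<sigma>_p Fp fs b1 b2 P.A.bar_closed P.B.bar_closed)
  next
    case (add w w')
    have "\<sigma> (w \<oplus>\<^bsub>D.W\<^esub> w') = \<sigma> w \<oplus>\<^bsub>D.W\<^esub> \<sigma> w'" "\<sigma> (F w \<oplus>\<^bsub>D.W\<^esub> F w') = \<sigma> (F w) \<oplus>\<^bsub>D.W\<^esub> \<sigma> (F w')"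
      using P.\<sigma>_hom add(1,2) Fc by (simp_all add: add_hom_iff)
    then show ?case using add by (simp add: Fa \<sigma>_closed)
  qed
  ultimately show ?thesis using Fl unfolding F_def[symmetric] by (simp add: P.inv_endos_def)
qed

lemma aut_data_A:
  assumes "f1 \<in> algebra_aut R D.A\<^sub>R"
  obtains g1 where "g1 \<in> algebra_aut R D.A\<^sub>R" "\<And>u. u \<in> carrier D.A\<^sub>R \<Longrightarrow> g1 (f1 u) = u"
    "\<And>u. u \<in> carrier D.A\<^sub>R \<Longrightarrow> f1 (g1 u) = u"
    "\<And>u. u \<in> carrier D.A\<^sub>R \<Longrightarrow> f1 (bar u) = bar (f1 u)"
    "\<And>u. u \<in> carrier D.A\<^sub>R \<Longrightarrow> g1 (bar u) = bar (g1 u)"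
proof -
  note g = algebra_aut_inverse[OF D.AR.AR.unital_algebra_axioms assms]
  have fe: "f1 \<in> P.A.algebra_endos"
    and ge: "restrict (inv_into (carrier D.A\<^sub>R) f1) (carrier D.A\<^sub>R) \<in> P.A.algebra_endos"
    using assms g(1) by (simp_all only: aut_endos_A)
  show ?thesis
    by (rule that[OF g P.A.automorphism_bar[OF fe ge g(2) alt_A] P.A.automorphism_bar[OF ge fe g(3) alt_A]])
qed

lemma aut_data_B:
  assumes "f2 \<in> algebra_aut R D.B\<^sub>R"
  obtains g2 where "g2 \<in> algebra_aut R D.B\<^sub>R" "\<And>u. u \<in> carrier D.B\<^sub>R \<Longrightarrow> g2 (f2 u) = u"
    "\<And>u. u \<in> carrier D.B\<^sub>R \<Longrightarrow> f2 (g2 u) = u"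
    "\<And>u. u \<in> carrier D.B\<^sub>R \<Longrightarrow> f2 (bar' u) = bar' (f2 u)"
    "\<And>u. u \<in> carrier D.B\<^sub>R \<Longrightarrow> g2 (bar' u) = bar' (g2 u)"
proof -
  note g = algebra_aut_inverse[OF D.BR.AR.unital_algebra_axioms assms]
  have fe: "f2 \<in> P.B.algebra_endos"
    and ge: "restrict (inv_into (carrier D.B\<^sub>R) f2) (carrier D.B\<^sub>R) \<in> P.B.algebra_endos"
    using assms g(1) by (simp_all only: aut_endos_B)
  show ?thesis
    by (rule that[OF g P.B.automorphism_bar[OF fe ge g(2) alt_B] P.B.automorphism_bar[OF ge fe g(3) alt_B]])
qed

lemma aut_linear:
  "f1 \<in> algebra_aut R D.A\<^sub>R \<Longrightarrow> f1 \<in> linear_maps R D.A\<^sub>R D.A\<^sub>R"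
  "f2 \<in> algebra_aut R D.B\<^sub>R \<Longrightarrow> f2 \<in> linear_maps R D.B\<^sub>R D.B\<^sub>R"
  by (simp_all add: algebra_aut_iff)

lemma phi_prod:
  assumes "f1 \<in> algebra_aut R D.A\<^sub>R" "f2 \<in> algebra_aut R D.B\<^sub>R"
    and "U \<in> carrier D.A\<^sub>R" "V \<in> carrier D.B\<^sub>R"
  shows "\<phi> (f1, f2) (p U V) = p (f1 U) (f2 V)"
  by (rule D.tensor_aut_prod[OF aut_linear(1)[OF assms(1)] aut_linear(2)[OF assms(2)] assms(3,4)])

lemma phi_mem:
  assumes f1: "f1 \<in> algebra_aut R D.A\<^sub>R" and f2: "f2 \<in> algebra_aut R D.B\<^sub>R"
  shows "\<phi> (f1, f2) \<in> involutive_automorphisms R D.W \<sigma>"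
proof -
  obtain g1 where g1: "g1 \<in> algebra_aut R D.A\<^sub>R" "\<And>u. u \<in> carrier D.A\<^sub>R \<Longrightarrow> g1 (f1 u) = u"
    "\<And>u. u \<in> carrier D.A\<^sub>R \<Longrightarrow> f1 (g1 u) = u"
    "\<And>u. u \<in> carrier D.A\<^sub>R \<Longrightarrow> f1 (bar u) = bar (f1 u)"
    "\<And>u. u \<in> carrier D.A\<^sub>R \<Longrightarrow> g1 (bar u) = bar (g1 u)"
    using aut_data_A[OF f1] by blast
  obtain g2 where g2: "g2 \<in> algebra_aut R D.B\<^sub>R" "\<And>u. u \<in> carrier D.B\<^sub>R \<Longrightarrow> g2 (f2 u) = u"
    "\<And>u. u \<in> carrier D.B\<^sub>R \<Longrightarrow> f2 (g2 u) = u"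
    "\<And>u. u \<in> carrier D.B\<^sub>R \<Longrightarrow> f2 (bar' u) = bar' (f2 u)"
    "\<And>u. u \<in> carrier D.B\<^sub>R \<Longrightarrow> g2 (bar' u) = bar' (g2 u)"
    using aut_data_B[OF f2] by blast
  have F: "\<phi> (f1, f2) \<in> P.inv_endos"
    using f1 f2 g1(4) g2(4) by (intro phi_inv_endo) (auto simp: aut_endos_A aut_endos_B)
  have G: "\<phi> (g1, g2) \<in> P.inv_endos"
    using g1(1,5) g2(1,5) by (intro phi_inv_endo) (auto simp: aut_endos_A aut_endos_B)
  note Fs = P.inv_endosD[OF F] and Gs = P.inv_endosD[OF G]
  note cl = linear_maps_closed[OF aut_linear(1)[OF f1]] linear_maps_closed[OF aut_linear(2)[OF f2]]
    linear_maps_closed[OF aut_linear(1)[OF g1(1)]] linear_maps_closed[OF aut_linear(2)[OF g2(1)]]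
  have GF: "\<phi> (g1, g2) (\<phi> (f1, f2) w) = w" if "w \<in> carrier D.W" for w
    using that
  proof (induction rule: D.ext_prod_induct)
    case (prod U V)
    then show ?case by (simp add: phi_prod[OF f1 f2] phi_prod[OF g1(1) g2(1)] cl g1(2) g2(2))
  qed (simp add: Fs Gs)
  have FG: "\<phi> (f1, f2) (\<phi> (g1, g2) w) = w" if "w \<in> carrier D.W" for w
    using that
  proof (induction rule: D.ext_prod_induct)
    case (prod U V)
    then show ?case by (simp add: phi_prod[OF f1 f2] phi_prod[OF g1(1) g2(1)] cl g1(3) g2(3))
  qed (simp add: Fs Gs)
  have "bij_betw (\<phi> (f1, f2)) (carrier D.W) (carrier D.W)"
    by (rule bij_betw_byWitness[where f' = "\<phi> (g1, g2)"]) (use GF FG Fs(2) Gs(2) in auto)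
  moreover have "\<phi> (f1, f2) \<in> extensional (carrier D.W)"
    by (rule D.tensor_aut_extensional[OF aut_linear(1)[OF f1] aut_linear(2)[OF f2]])
  ultimately show ?thesis unfolding aut_endos_W using F by (simp add: Bij_def)
qed

lemma phi_compose:
  assumes f1: "f1 \<in> algebra_aut R D.A\<^sub>R" and f2: "f2 \<in> algebra_aut R D.B\<^sub>R"
    and g1: "g1 \<in> algebra_aut R D.A\<^sub>R" and g2: "g2 \<in> algebra_aut R D.B\<^sub>R"
    and c1: "compose (carrier D.A\<^sub>R) f1 g1 \<in> algebra_aut R D.A\<^sub>R"
    and c2: "compose (carrier D.B\<^sub>R) f2 g2 \<in> algebra_aut R D.B\<^sub>R"
  shows "\<phi> (compose (carrier D.A\<^sub>R) f1 g1, compose (carrier D.B\<^sub>R) f2 g2) =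
    compose (carrier D.W) (\<phi> (f1, f2)) (\<phi> (g1, g2))" (is "?l = ?r")
proof (rule extensionalityI)
  note mem = phi_mem[OF f1 f2] phi_mem[OF g1 g2] phi_mem[OF c1 c2]
  have hom: "\<phi> (f1, f2) \<in> add_hom D.W D.W" "\<phi> (g1, g2) \<in> add_hom D.W D.W" "?l \<in> add_hom D.W D.W"
    using mem by (auto simp: involutive_automorphisms_def algebra_aut_iff linear_maps_def)
  show "?l \<in> extensional (carrier D.W)"
    by (rule D.tensor_aut_extensional[OF aut_linear(1)[OF c1] aut_linear(2)[OF c2]])
  show "?r \<in> extensional (carrier D.W)" by (simp add: compose_def)
  have "?r \<in> add_hom D.W D.W" using hom(1,2) by (auto simp: add_hom_iff compose_def)
  then show "?l w = ?r w" if "w \<in> carrier D.W" for w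
  proof (rule D.ext_add_hom_eq[OF hom(3) _ _ that])
    fix U V assume U: "U \<in> carrier D.A\<^sub>R" and V: "V \<in> carrier D.B\<^sub>R"
    have "?l (p U V) = p (compose (carrier D.A\<^sub>R) f1 g1 U) (compose (carrier D.B\<^sub>R) f2 g2 V)"
      by (rule phi_prod[OF c1 c2 U V])
    also have "\<dots> = p (f1 (g1 U)) (f2 (g2 V))" using U V by (simp add: compose_eq)
    also have "\<dots> = ?r (p U V)"
      using U V linear_maps_closed[OF aut_linear(1)[OF g1]] linear_maps_closed[OF aut_linear(2)[OF g2]]
      by (simp add: phi_prod[OF f1 f2] phi_prod[OF g1 g2] compose_eq)
    finally show "?l (p U V) = ?r (p U V)" .
  qed
qed

lemma phi_inj:
  assumes f1: "f1 \<in> algebra_aut R D.A\<^sub>R" and f2: "f2 \<in> algebra_aut R D.B\<^sub>R"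
    and g1: "g1 \<in> algebra_aut R D.A\<^sub>R" and g2: "g2 \<in> algebra_aut R D.B\<^sub>R"
    and eq: "\<phi> (f1, f2) = \<phi> (g1, g2)"
  shows "f1 = g1 \<and> f2 = g2"
proof
  note cl = linear_maps_closed[OF aut_linear(1)[OF f1]] linear_maps_closed[OF aut_linear(2)[OF f2]]
    linear_maps_closed[OF aut_linear(1)[OF g1]] linear_maps_closed[OF aut_linear(2)[OF g2]]
  have one: "f1 \<one>\<^bsub>D.A\<^sub>R\<^esub> = \<one>\<^bsub>D.A\<^sub>R\<^esub>" "f2 \<one>\<^bsub>D.B\<^sub>R\<^esub> = \<one>\<^bsub>D.B\<^sub>R\<^esub>" "g1 \<one>\<^bsub>D.A\<^sub>R\<^esub> = \<one>\<^bsub>D.A\<^sub>R\<^esub>" "g2 \<one>\<^bsub>D.B\<^sub>R\<^esub> = \<one>\<^bsub>D.B\<^sub>R\<^esub>"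
    using f1 f2 g1 g2 by (auto simp: algebra_aut_iff)
  note [simp] = D.AR.AR.unit_closed D.BR.AR.unit_closed
  have pq: "p (f1 U) (f2 V) = p (g1 U) (g2 V)" if "U \<in> carrier D.A\<^sub>R" "V \<in> carrier D.B\<^sub>R" for U V
    using phi_prod[OF f1 f2 that] phi_prod[OF g1 g2 that] eq by simp
  show "f1 = g1"
  proof (rule extensionalityI)
    show "f1 \<in> extensional (carrier D.A\<^sub>R)" "g1 \<in> extensional (carrier D.A\<^sub>R)"
      using f1 g1 by (auto simp: algebra_aut_iff Bij_def)
    show "f1 U = g1 U" if U: "U \<in> carrier D.A\<^sub>R" for U
      using arg_cong[OF pq[OF U D.BR.AR.unit_closed], of E] U by (simp add: one cl)
  qed
  show "f2 = g2"
  proof (rule extensionalityI)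
    show "f2 \<in> extensional (carrier D.B\<^sub>R)" "g2 \<in> extensional (carrier D.B\<^sub>R)"
      using f2 g2 by (auto simp: algebra_aut_iff Bij_def)
    show "f2 U = g2 U" if U: "U \<in> carrier D.B\<^sub>R" for U
      using arg_cong[OF pq[OF D.AR.AR.unit_closed U], of E'] U by (simp add: one cl)
  qed
qed

lemma phi_surj:
  assumes F: "F \<in> involutive_automorphisms R D.W \<sigma>"
  obtains f1 f2 where "f1 \<in> algebra_aut R D.A\<^sub>R" "f2 \<in> algebra_aut R D.B\<^sub>R" "F = \<phi> (f1, f2)"
proof -
  define G where "G = restrict (inv_into (carrier D.W) F) (carrier D.W)"
  have Fa: "F \<in> algebra_aut R D.W" using F by (simp add: involutive_automorphisms_def)
  have Gm: "G \<in> involutive_automorphisms R D.W \<sigma>"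
    unfolding G_def by (rule involutive_automorphisms_inverse[OF D.W.AR.unital_algebra_axioms \<sigma>_closed F])
  have GF: "G (F w) = w" and FG: "F (G w) = w" if "w \<in> carrier D.W" for w
    using algebra_aut_inverse(2,3)[OF D.W.AR.unital_algebra_axioms Fa that] by (simp_all add: G_def)
  have Fi: "F \<in> P.inv_endos" and Gi: "G \<in> P.inv_endos" using F Gm by (simp_all only: aut_endos_W)
  have alt: "P.A.trivial_algebra \<or> P.B.trivial_algebra \<or>
      (\<exists>s. P.A.unit_square s) \<and> (\<exists>t. P.B.unit_square t) \<and>
      dual_basis R D.A\<^sub>R I x \<xi> \<and> dual_basis R D.B\<^sub>R J y \<eta> \<and>
      (\<forall>r \<in> carrier R. [card I] \<cdot>\<^bsub>R\<^esub> r = [card J] \<cdot>\<^bsub>R\<^esub> r \<longrightarrow> r = \<zero>\<^bsub>R\<^esub>)"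
    using alt_A alt_B ranks by blast
  note sF = P.automorphism_splits[OF Fi Gi FG GF alt] and sG = P.automorphism_splits[OF Gi Fi GF FG alt]
  define f1 where "f1 = (\<lambda>u \<in> carrier D.A\<^sub>R. E (F (p u \<one>\<^bsub>D.B\<^sub>R\<^esub>)))"
  define f2 where "f2 = (\<lambda>v \<in> carrier D.B\<^sub>R. E' (F (p \<one>\<^bsub>D.A\<^sub>R\<^esub> v)))"
  have c1: "E (F (p u \<one>\<^bsub>D.B\<^sub>R\<^esub>)) \<in> carrier D.A\<^sub>R" "E (G (p u \<one>\<^bsub>D.B\<^sub>R\<^esub>)) \<in> carrier D.A\<^sub>R" if "u \<in> carrier D.A\<^sub>R" for u
    using that P.inv_endosD(2)[OF Fi] P.inv_endosD(2)[OF Gi] D.BR.AR.unit_closed by simp_all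
  have c2: "E' (F (p \<one>\<^bsub>D.A\<^sub>R\<^esub> v)) \<in> carrier D.B\<^sub>R" "E' (G (p \<one>\<^bsub>D.A\<^sub>R\<^esub> v)) \<in> carrier D.B\<^sub>R" if "v \<in> carrier D.B\<^sub>R" for v
    using that P.inv_endosD(2)[OF Fi] P.inv_endosD(2)[OF Gi] D.AR.AR.unit_closed by simp_all
  have b1: "bij_betw f1 (carrier D.A\<^sub>R) (carrier D.A\<^sub>R)"
    by (rule bij_betw_byWitness[where f' = "\<lambda>u. E (G (p u \<one>\<^bsub>D.B\<^sub>R\<^esub>))"])
      (use c1 sF(3) sG(3) in \<open>auto simp: f1_def\<close>)
  have b2: "bij_betw f2 (carrier D.B\<^sub>R) (carrier D.B\<^sub>R)"
    by (rule bij_betw_byWitness[where f' = "\<lambda>v. E' (G (p \<one>\<^bsub>D.A\<^sub>R\<^esub> v))"])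
      (use c2 sF(4) sG(4) in \<open>auto simp: f2_def\<close>)
  have e1: "f1 \<in> P.A.algebra_endos"
    using sF(1) D.AR.AR.unit_closed D.AR.AR.mult_closed
    by (auto simp: P.A.algebra_endos_def linear_maps_def add_hom_iff f1_def)
  have e2: "f2 \<in> P.B.algebra_endos"
    using sF(2) D.BR.AR.unit_closed D.BR.AR.mult_closed
    by (auto simp: P.B.algebra_endos_def linear_maps_def add_hom_iff f2_def)
  have a1: "f1 \<in> algebra_aut R D.A\<^sub>R" unfolding aut_endos_A using b1 e1 by (simp add: Bij_def f1_def)
  have a2: "f2 \<in> algebra_aut R D.B\<^sub>R" unfolding aut_endos_B using b2 e2 by (simp add: Bij_def f2_def)
  have "F = \<phi> (f1, f2)"
  proof (rule extensionalityI)
    show "F \<in> extensional (carrier D.W)" using Fa by (simp add: algebra_aut_iff Bij_def)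
    show "\<phi> (f1, f2) \<in> extensional (carrier D.W)"
      by (rule D.tensor_aut_extensional[OF aut_linear(1)[OF a1] aut_linear(2)[OF a2]])
    have "F \<in> add_hom D.W D.W" "\<phi> (f1, f2) \<in> add_hom D.W D.W"
      using Fa D.tensor_aut_hom[OF aut_linear(1)[OF a1] aut_linear(2)[OF a2]]
      by (simp_all add: algebra_aut_iff linear_maps_def)
    then show "F w = \<phi> (f1, f2) w" if "w \<in> carrier D.W" for w
    proof (rule D.ext_add_hom_eq[OF _ _ _ that])
      fix U V assume U: "U \<in> carrier D.A\<^sub>R" and V: "V \<in> carrier D.B\<^sub>R"
      have "\<phi> (f1, f2) (p U V) = p (f1 U) (f2 V)" by (rule phi_prod[OF a1 a2 U V])
      also have "\<dots> = F (p U V)" using sF(5)[of U V] U V by (simp add: f1_def f2_def)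
      finally show "F (p U V) = \<phi> (f1, f2) (p U V)" by (rule sym)
    qed
  qed
  then show ?thesis using that a1 a2 by blast
qed

theorem phi_iso:
  "\<phi> \<in> iso (Aut_scheme k A R \<times>\<times> Aut_scheme k B R)
    (BijGroup (carrier D.W) \<lparr>carrier := involutive_automorphisms R D.W \<sigma>\<rparr>)"
proof -
  let ?GA = "Aut_scheme k A R" and ?GB = "Aut_scheme k B R"
  interpret GA: group ?GA
    unfolding Aut_scheme_eq by (rule involutive_automorphisms_group[OF D.AR.AR.unital_algebra_axioms])
  interpret GB: group ?GB
    unfolding Aut_scheme_eq by (rule involutive_automorphisms_group[OF D.BR.AR.unital_algebra_axioms])
  have cA: "carrier ?GA = algebra_aut R D.A\<^sub>R" and cB: "carrier ?GB = algebra_aut R D.B\<^sub>R"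
    by (simp_all add: Aut_scheme_def)
  have mA: "f \<otimes>\<^bsub>?GA\<^esub> g = compose (carrier D.A\<^sub>R) f g" if "f \<in> algebra_aut R D.A\<^sub>R" "g \<in> algebra_aut R D.A\<^sub>R" for f g
    using that by (simp add: Aut_scheme_def BijGroup_def algebra_aut_iff)
  have mB: "f \<otimes>\<^bsub>?GB\<^esub> g = compose (carrier D.B\<^sub>R) f g" if "f \<in> algebra_aut R D.B\<^sub>R" "g \<in> algebra_aut R D.B\<^sub>R" for f g
    using that by (simp add: Aut_scheme_def BijGroup_def algebra_aut_iff)
  have hom: "\<phi> (f1 \<otimes>\<^bsub>?GA\<^esub> g1, f2 \<otimes>\<^bsub>?GB\<^esub> g2) = compose (carrier D.W) (\<phi> (f1, f2)) (\<phi> (g1, g2))"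
    if "f1 \<in> algebra_aut R D.A\<^sub>R" "g1 \<in> algebra_aut R D.A\<^sub>R" "f2 \<in> algebra_aut R D.B\<^sub>R" "g2 \<in> algebra_aut R D.B\<^sub>R"
    for f1 f2 g1 g2
    using phi_compose[OF that(1,3,2,4)] GA.m_closed[of f1 g1] GB.m_closed[of f2 g2] that
    by (simp add: cA cB mA mB)
  have Bij: "f \<in> Bij (carrier D.W)" if "f \<in> involutive_automorphisms R D.W \<sigma>" for f
    using that by (simp add: aut_endos_W)
  have inj: "inj_on \<phi> (algebra_aut R D.A\<^sub>R \<times> algebra_aut R D.B\<^sub>R)"
    using phi_inj by (auto intro!: inj_onI)
  have "\<phi> ` (algebra_aut R D.A\<^sub>R \<times> algebra_aut R D.B\<^sub>R) = involutive_automorphisms R D.W \<sigma>"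
  proof
    show "\<phi> ` (algebra_aut R D.A\<^sub>R \<times> algebra_aut R D.B\<^sub>R) \<subseteq> involutive_automorphisms R D.W \<sigma>"
      using phi_mem by auto
    show "involutive_automorphisms R D.W \<sigma> \<subseteq> \<phi> ` (algebra_aut R D.A\<^sub>R \<times> algebra_aut R D.B\<^sub>R)"
    proof
      fix F assume "F \<in> involutive_automorphisms R D.W \<sigma>"
      then obtain f1 f2 where "f1 \<in> algebra_aut R D.A\<^sub>R" "f2 \<in> algebra_aut R D.B\<^sub>R" "F = \<phi> (f1, f2)"
        using phi_surj by blast
      then show "F \<in> \<phi> ` (algebra_aut R D.A\<^sub>R \<times> algebra_aut R D.B\<^sub>R)" by blast
    qed
  qed
  then show ?thesis
    using inj phi_mem hom Bij
    by (auto simp: iso_def hom_def bij_betw_def cA cB BijGroup_def)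
qed

end

section \<open>Naturality in the base\<close>

locale base_morphism =
  AR: scalar_extension k A R + AS: scalar_extension k A S for k and A and R and S +
  fixes \<rho>
  assumes \<rho>: "\<rho> \<in> algebra_hom k R S"
begin

abbreviation push where "push \<equiv> tensor_map k A R A S (\<lambda>a. a) \<rho>"

lemma \<rho>_simps [simp]:
  "r \<in> carrier R \<Longrightarrow> \<rho> r \<in> carrier S"
  "r \<in> carrier R \<Longrightarrow> r' \<in> carrier R \<Longrightarrow> \<rho> (r \<oplus>\<^bsub>R\<^esub> r') = \<rho> r \<oplus>\<^bsub>S\<^esub> \<rho> r'"
  "r \<in> carrier R \<Longrightarrow> r' \<in> carrier R \<Longrightarrow> \<rho> (r \<otimes>\<^bsub>R\<^esub> r') = \<rho> r \<otimes>\<^bsub>S\<^esub> \<rho> r'"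
  "\<rho> \<one>\<^bsub>R\<^esub> = \<one>\<^bsub>S\<^esub>"
  "c \<in> carrier k \<Longrightarrow> r \<in> carrier R \<Longrightarrow> \<rho> (c \<odot>\<^bsub>R\<^esub> r) = c \<odot>\<^bsub>S\<^esub> \<rho> r"
  using \<rho> by (auto simp: algebra_hom_def ring_hom_def)

lemma push_props:
  shows push_hom: "push \<in> add_hom AR.AR AS.AR"
    and push_pure: "\<And>x r. x \<in> carrier A \<Longrightarrow> r \<in> carrier R \<Longrightarrow> push (AR.pure x r) = AS.pure x (\<rho> r)"
proof -
  have id: "(\<lambda>a. a) \<in> linear_maps k A A" by (simp add: linear_maps_def add_hom_iff)
  have lin: "\<rho> \<in> linear_maps k R S" by (simp add: linear_maps_def add_hom_iff)
  note props = tensor_map_props[OF AR.tensor_modules_axioms AS.tensor_modules_axioms id lin]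
  show "push \<in> add_hom AR.AR AS.AR"
    using props(1) by (auto simp: hom_def AR.AR_simps AS.AR_simps)
  show "push (AR.pure x r) = AS.pure x (\<rho> r)" if "x \<in> carrier A" "r \<in> carrier R" for x r
    by (rule props(2)[OF that])
qed

lemma push_simps:
  shows push_closed: "U \<in> carrier AR.AR \<Longrightarrow> push U \<in> carrier AS.AR"
    and push_add: "U \<in> carrier AR.AR \<Longrightarrow> V \<in> carrier AR.AR \<Longrightarrow> push (U \<oplus>\<^bsub>AR.AR\<^esub> V) = push U \<oplus>\<^bsub>AS.AR\<^esub> push V"
  using push_hom unfolding add_hom_iff by blast+

lemma push_smult:
  assumes "t \<in> carrier R" "U \<in> carrier AR.AR"
  shows "push (t \<odot>\<^bsub>AR.AR\<^esub> U) = \<rho> t \<odot>\<^bsub>AS.AR\<^esub> push U"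
  using assms(2)
proof (induction rule: AR.ext_induct)
  case (pure x r)
  then show ?case using assms(1) by (simp add: push_pure)
next
  case (add U V)
  then show ?case using assms(1) by (simp add: push_add push_closed AR.AR.smult_r_distr AS.AR.smult_r_distr)
qed

lemma Aut_map_props:
  assumes f: "f \<in> linear_maps R AR.AR AR.AR"
  shows Aut_map_linear: "Aut_map k A R S \<rho> f \<in> linear_maps S AS.AR AS.AR"
    and Aut_map_extensional: "Aut_map k A R S \<rho> f \<in> extensional (carrier AS.AR)"
    and Aut_map_pure: "\<And>x s. x \<in> carrier A \<Longrightarrow> s \<in> carrier S \<Longrightarrow>
      Aut_map k A R S \<rho> f (AS.pure x s) = s \<odot>\<^bsub>AS.AR\<^esub> push (f (AR.pure x \<one>\<^bsub>R\<^esub>))"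
proof -
  note fs = linear_mapsD(1-3)[OF f]
  let ?h = "\<lambda>x s. s \<odot>\<^bsub>AS.AR\<^esub> push (f (AR.pure x \<one>\<^bsub>R\<^esub>))"
  have bal: "balanced k A S (add_monoid AS.AR) ?h"
  proof (rule balancedI)
    fix c x s assume c: "c \<in> carrier k" and x: "x \<in> carrier A" and s: "s \<in> carrier S"
    have "AR.pure (c \<odot>\<^bsub>A\<^esub> x) \<one>\<^bsub>R\<^esub> = (c \<odot>\<^bsub>R\<^esub> \<one>\<^bsub>R\<^esub>) \<odot>\<^bsub>AR.AR\<^esub> AR.pure x \<one>\<^bsub>R\<^esub>"
      using c x by (simp add: AR.pure_balanced)
    then have "?h (c \<odot>\<^bsub>A\<^esub> x) s = s \<odot>\<^bsub>AS.AR\<^esub> ((c \<odot>\<^bsub>S\<^esub> \<one>\<^bsub>S\<^esub>) \<odot>\<^bsub>AS.AR\<^esub> push (f (AR.pure x \<one>\<^bsub>R\<^esub>)))"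
      using c x by (simp add: fs push_smult del: AR.ext_smult_pure)
    also have "\<dots> = (s \<otimes>\<^bsub>S\<^esub> (c \<odot>\<^bsub>S\<^esub> \<one>\<^bsub>S\<^esub>)) \<odot>\<^bsub>AS.AR\<^esub> push (f (AR.pure x \<one>\<^bsub>R\<^esub>))"
      using c x s by (simp add: AS.AR.smult_assoc1 fs push_closed)
    also have "s \<otimes>\<^bsub>S\<^esub> (c \<odot>\<^bsub>S\<^esub> \<one>\<^bsub>S\<^esub>) = c \<odot>\<^bsub>S\<^esub> s"
      using c s by (simp add: AS.B.mult_smult_right)
    finally show "?h (c \<odot>\<^bsub>A\<^esub> x) s = ?h x (c \<odot>\<^bsub>S\<^esub> s)" .
  qed (simp_all add: fs push_closed push_add AR.ext_pure_add_left AS.AR.smult_l_distr AS.AR.smult_r_distr)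
  have eq: "Aut_map k A R S \<rho> f = tensor_lift k A S (add_monoid AS.AR) ?h"
    unfolding Aut_map_def by (rule tensor_lift_cong_group) (simp_all add: AS.AR_simps)
  note lift = AS.ext_lift[OF AS.AR.abelian_group_axioms bal, folded eq]
  show "Aut_map k A R S \<rho> f \<in> extensional (carrier AS.AR)" by (rule lift(2))
  show pr: "Aut_map k A R S \<rho> f (AS.pure x s) = ?h x s" if "x \<in> carrier A" "s \<in> carrier S" for x s
    by (rule lift(3)[OF that])
  have "Aut_map k A R S \<rho> f (t \<odot>\<^bsub>AS.AR\<^esub> U) = t \<odot>\<^bsub>AS.AR\<^esub> Aut_map k A R S \<rho> f U"
    if "t \<in> carrier S" "U \<in> carrier AS.AR" for t U
    using that(2)
  proof (induction rule: AS.ext_induct)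
    case (pure x s)
    then show ?case using that(1) by (simp add: pr AS.AR.smult_assoc1 fs push_closed)
  next
    case (add U V)
    then show ?case using that(1) lift(1) by (simp add: add_hom_iff AS.AR.smult_r_distr)
  qed
  then show "Aut_map k A R S \<rho> f \<in> linear_maps S AS.AR AS.AR"
    using lift(1) by (simp add: linear_maps_def)
qed

end

locale double_base_morphism =
  R: double_extension k A B R + S: double_extension k A B S for k and A and B and R and S +
  fixes \<rho>
  assumes \<rho>: "\<rho> \<in> algebra_hom k R S"
begin

sublocale A: base_morphism k A R S \<rho>
  by (intro base_morphism.intro base_morphism_axioms.intro R.AR.scalar_extension_axioms
      S.AR.scalar_extension_axioms \<rho>)

sublocale B: base_morphism k B R S \<rho>
  by (intro base_morphism.intro base_morphism_axioms.intro R.BR.scalar_extension_axioms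
      S.BR.scalar_extension_axioms \<rho>)

sublocale W: base_morphism k "tensor_algebra k A B" R S \<rho>
  by (intro base_morphism.intro base_morphism_axioms.intro R.W.scalar_extension_axioms
      S.W.scalar_extension_axioms \<rho>)

lemma push_ext_prod:
  assumes U: "U \<in> carrier R.A\<^sub>R" and V: "V \<in> carrier R.B\<^sub>R"
  shows "W.push (R.ext_prod U V) = S.ext_prod (A.push U) (B.push V)"
  using U
proof (induction rule: R.AR.ext_induct)
  case p1: (pure x r)
  show ?case using V
  proof (induction rule: R.BR.ext_induct)
    case p2: (pure y s)
    then show ?case using p1 by (simp add: A.push_pure B.push_pure W.push_pure)
  next
    case (add V V')
    then show ?case
      using p1 by (simp add: R.ext_prod_add_right S.ext_prod_add_right W.push_add B.push_add
          A.push_closed B.push_closed)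
  qed
next
  case (add U U')
  then show ?case
    using V by (simp add: R.ext_prod_add_left S.ext_prod_add_left W.push_add A.push_add
        A.push_closed B.push_closed)
qed

lemma tensor_aut_natural:
  assumes f1: "f1 \<in> linear_maps R R.A\<^sub>R R.A\<^sub>R" and f2: "f2 \<in> linear_maps R R.B\<^sub>R R.B\<^sub>R"
    and F: "tensor_aut k A B R (f1, f2) \<in> linear_maps R R.W R.W"
  shows "tensor_aut k A B S (Aut_map k A R S \<rho> f1, Aut_map k B R S \<rho> f2) =
    Aut_map k (tensor_algebra k A B) R S \<rho> (tensor_aut k A B R (f1, f2))" (is "?l = ?r")
proof (rule extensionalityI)
  let ?g1 = "Aut_map k A R S \<rho> f1" and ?g2 = "Aut_map k B R S \<rho> f2"
  note g = A.Aut_map_linear[OF f1] B.Aut_map_linear[OF f2]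
  note cl = linear_maps_closed[OF f1] linear_maps_closed[OF f2]
  show "?l \<in> extensional (carrier S.W)" by (rule S.tensor_aut_extensional[OF g])
  show "?r \<in> extensional (carrier S.W)" by (rule W.Aut_map_extensional[OF F])
  have l: "?l \<in> add_hom S.W S.W" by (rule S.tensor_aut_hom[OF g])
  have r: "?r \<in> add_hom S.W S.W" by (rule linear_maps_add_hom[OF W.Aut_map_linear[OF F]])
  show "?l w = ?r w" if "w \<in> carrier S.W" for w
    using that
  proof (induction rule: S.triple_induct)
    case (triple x y s)
    let ?U = "R.AR.pure x \<one>\<^bsub>R\<^esub>" and ?V = "R.BR.pure y \<one>\<^bsub>R\<^esub>"
    have UV: "?U \<in> carrier R.A\<^sub>R" "?V \<in> carrier R.B\<^sub>R" using triple by simp_all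
    have pc: "A.push (f1 ?U) \<in> carrier S.A\<^sub>R" "B.push (f2 ?V) \<in> carrier S.B\<^sub>R"
      using cl UV by (simp_all add: A.push_closed B.push_closed)
    have "?l (S.triple x y s) = ?l (S.ext_prod (S.AR.pure x \<one>\<^bsub>S\<^esub>) (S.BR.pure y s))"
      using triple by simp
    also have "\<dots> = S.ext_prod (?g1 (S.AR.pure x \<one>\<^bsub>S\<^esub>)) (?g2 (S.BR.pure y s))"
      using triple by (intro S.tensor_aut_prod[OF g]) auto
    also have "\<dots> = S.ext_prod (A.push (f1 ?U)) (s \<odot>\<^bsub>S.B\<^sub>R\<^esub> B.push (f2 ?V))"
      using triple pc by (simp add: A.Aut_map_pure[OF f1] B.Aut_map_pure[OF f2])
    also have "\<dots> = s \<odot>\<^bsub>S.W\<^esub> W.push (R.ext_prod (f1 ?U) (f2 ?V))"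
      using triple pc cl UV by (simp add: S.ext_prod_smult_right push_ext_prod)
    also have "R.ext_prod (f1 ?U) (f2 ?V) = tensor_aut k A B R (f1, f2) (R.ext_prod ?U ?V)"
      by (rule R.tensor_aut_prod[OF f1 f2 UV, symmetric])
    also have "R.ext_prod ?U ?V = R.triple x y \<one>\<^bsub>R\<^esub>" using triple by simp
    also have "s \<odot>\<^bsub>S.W\<^esub> W.push (tensor_aut k A B R (f1, f2) (R.triple x y \<one>\<^bsub>R\<^esub>)) = ?r (S.triple x y s)"
      using triple by (intro W.Aut_map_pure[OF F, symmetric]) auto
    finally show ?case .
  next
    case (add w w')
    then show ?case using l r by (simp add: add_hom_iff)
  qed
qed

end

section \<open>Composition algebras of different dimensions\<close>

text \<open>Distinct elements of \<open>{2, 4, 8}\<close> differ by 2, 4 or 6, whose only prime factors are 2 and 3.\<close>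

lemma rank_difference_cancels:
  assumes R: "cring R" and r: "r \<in> carrier R"
    and two: "\<And>r. r \<in> carrier R \<Longrightarrow> [(2::nat)] \<cdot>\<^bsub>R\<^esub> r = \<zero>\<^bsub>R\<^esub> \<Longrightarrow> r = \<zero>\<^bsub>R\<^esub>"
    and three: "\<And>r. r \<in> carrier R \<Longrightarrow> [(3::nat)] \<cdot>\<^bsub>R\<^esub> r = \<zero>\<^bsub>R\<^esub> \<Longrightarrow> r = \<zero>\<^bsub>R\<^esub>"
    and m: "m \<in> {2, 4, 8::nat}" "m' \<in> {2, 4, 8}" "m \<noteq> m'"
    and eq: "[m] \<cdot>\<^bsub>R\<^esub> r = [m'] \<cdot>\<^bsub>R\<^esub> r"
  shows "r = \<zero>\<^bsub>R\<^esub>"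
proof -
  interpret R: cring R by fact
  have diff: "[d] \<cdot>\<^bsub>R\<^esub> r = \<zero>\<^bsub>R\<^esub>" if "[(a + d)] \<cdot>\<^bsub>R\<^esub> r = [a] \<cdot>\<^bsub>R\<^esub> r" for a d :: nat
  proof -
    have "[a] \<cdot>\<^bsub>R\<^esub> r \<oplus>\<^bsub>R\<^esub> [d] \<cdot>\<^bsub>R\<^esub> r = [a] \<cdot>\<^bsub>R\<^esub> r"
      using that R.add.nat_pow_mult[OF r, of a d] by simp
    then show ?thesis using r by (subst (asm) R.add.l_cancel_one) auto
  qed
  have 2: "[(2::nat)] \<cdot>\<^bsub>R\<^esub> r = \<zero>\<^bsub>R\<^esub> \<Longrightarrow> ?thesis" by (rule two[OF r])
  have mul: "[(a * c)] \<cdot>\<^bsub>R\<^esub> r = [c] \<cdot>\<^bsub>R\<^esub> ([a] \<cdot>\<^bsub>R\<^esub> r)" for a c :: nat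
    using R.add.nat_pow_pow[OF r, of c a] by simp
  have 4: ?thesis if "[(4::nat)] \<cdot>\<^bsub>R\<^esub> r = \<zero>\<^bsub>R\<^esub>"
  proof (rule 2, rule two)
    show "[(2::nat)] \<cdot>\<^bsub>R\<^esub> ([(2::nat)] \<cdot>\<^bsub>R\<^esub> r) = \<zero>\<^bsub>R\<^esub>"
      using that mul[of 2 2, symmetric] by simp
  qed (use r in simp)
  have 6: ?thesis if "[(6::nat)] \<cdot>\<^bsub>R\<^esub> r = \<zero>\<^bsub>R\<^esub>"
  proof (rule 2, rule three)
    show "[(3::nat)] \<cdot>\<^bsub>R\<^esub> ([(2::nat)] \<cdot>\<^bsub>R\<^esub> r) = \<zero>\<^bsub>R\<^esub>"
      using that mul[of 2 3, symmetric] by simp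
  qed (use r in simp)
  from m consider "m = 2" "m' = 4" | "m = 2" "m' = 8" | "m = 4" "m' = 8"
    | "m = 4" "m' = 2" | "m = 8" "m' = 2" | "m = 8" "m' = 4" by auto
  then show ?thesis
  proof cases
    case 1 show ?thesis by (rule 2, rule diff[of 2 2]) (use eq 1 in simp)
  next
    case c: 2 show ?thesis by (rule 6, rule diff[of 2 6]) (use eq c in simp)
  next
    case 3 show ?thesis by (rule 4, rule diff[of 4 4]) (use eq 3 in simp)
  next
    case c: 4 show ?thesis by (rule 2, rule diff[of 2 2]) (use eq c in simp)
  next
    case 5 show ?thesis by (rule 6, rule diff[of 2 6]) (use eq 5 in simp)
  next
    case c: 6 show ?thesis by (rule 4, rule diff[of 4 4]) (use eq c in simp)
  qed
qed

lemma (in algebra) integer_multiple_cancel: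
  assumes k: "field R" and d: "[(d::nat)] \<cdot>\<^bsub>R\<^esub> \<one>\<^bsub>R\<^esub> \<noteq> \<zero>\<^bsub>R\<^esub>" and x: "x \<in> carrier M" "[d] \<cdot>\<^bsub>M\<^esub> x = \<zero>\<^bsub>M\<^esub>"
  shows "x = \<zero>\<^bsub>M\<^esub>"
proof -
  interpret k: field R by fact
  have mult: "([(n::nat)] \<cdot>\<^bsub>R\<^esub> \<one>\<^bsub>R\<^esub>) \<odot>\<^bsub>M\<^esub> x = [n] \<cdot>\<^bsub>M\<^esub> x" for n
    by (induction n) (use x(1) in \<open>simp_all add: smult_l_distr\<close>)
  define c where "c = [d] \<cdot>\<^bsub>R\<^esub> \<one>\<^bsub>R\<^esub>"
  have c: "c \<in> Units R" using d k.field_Units by (simp add: c_def)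
  have "x = (inv\<^bsub>R\<^esub> c \<otimes>\<^bsub>R\<^esub> c) \<odot>\<^bsub>M\<^esub> x" using c x(1) by (simp add: R.Units_l_inv)
  also have "\<dots> = inv\<^bsub>R\<^esub> c \<odot>\<^bsub>M\<^esub> (c \<odot>\<^bsub>M\<^esub> x)"
    using c x(1) by (intro smult_assoc1) (auto intro: R.Units_inv_closed R.Units_closed)
  also have "c \<odot>\<^bsub>M\<^esub> x = \<zero>\<^bsub>M\<^esub>" unfolding c_def mult by (rule x(2))
  finally show ?thesis using c by (simp add: R.Units_inv_closed)
qed

text \<open>
  A factor of dimension one becomes trivial over \<open>R\<close>, so ranks have to be compared only
  for dimensions among 2, 4 and 8, where \<open>rank_difference_cancels\<close> applies.
\<close>

lemma composition_split_extension:
  fixes C\<^sub>1 :: "('k, 'a) module" and C\<^sub>2 :: "('k, 'b) module"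
  assumes k: "field k"
    and two: "[(2::nat)] \<cdot>\<^bsub>k\<^esub> \<one>\<^bsub>k\<^esub> \<noteq> \<zero>\<^bsub>k\<^esub>" and three: "[(3::nat)] \<cdot>\<^bsub>k\<^esub> \<one>\<^bsub>k\<^esub> \<noteq> \<zero>\<^bsub>k\<^esub>"
    and C1: "composition_algebra k C\<^sub>1 n\<^sub>1" and C2: "composition_algebra k C\<^sub>2 n\<^sub>2"
    and d1: "has_dimension k C\<^sub>1 m\<^sub>1" and d2: "has_dimension k C\<^sub>2 m\<^sub>2"
    and m: "m\<^sub>1 \<in> {1, 2, 4, 8}" "m\<^sub>2 \<in> {1, 2, 4, 8}" "m\<^sub>1 \<noteq> m\<^sub>2"
    and R: "algebra k R"
  obtains l bar l' bar' E E'
      and I :: "'a set" and x \<xi> and J :: "'b set" and y \<eta> where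
    "split_extension k C\<^sub>1 C\<^sub>2 R l bar l' bar' E E'
      (tensor_map k (tensor_algebra k C\<^sub>1 C\<^sub>2) R (tensor_algebra k C\<^sub>1 C\<^sub>2) R
        (tensor_map k C\<^sub>1 C\<^sub>2 C\<^sub>1 C\<^sub>2 (standard_involution k C\<^sub>1 n\<^sub>1) (standard_involution k C\<^sub>2 n\<^sub>2)) (\<lambda>r. r))
      I x \<xi> J y \<eta>"
proof -
  interpret k: field k by fact
  interpret R: algebra k R by fact
  interpret C1: composition_algebra k C\<^sub>1 n\<^sub>1 by fact
  interpret C2: composition_algebra k C\<^sub>2 n\<^sub>2 by fact
  interpret D: double_extension k C\<^sub>1 C\<^sub>2 R
    by (intro double_extension.intro C1.unital_algebra_axioms C2.unital_algebra_axioms R)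
  define h where "h = inv\<^bsub>k\<^esub> ([(2::nat)] \<cdot>\<^bsub>k\<^esub> \<one>\<^bsub>k\<^esub>)"
  have two_eq: "[(2::nat)] \<cdot>\<^bsub>k\<^esub> \<one>\<^bsub>k\<^esub> = \<one>\<^bsub>k\<^esub> \<oplus>\<^bsub>k\<^esub> \<one>\<^bsub>k\<^esub>"
    by (simp add: numeral_2_eq_2)
  have two_unit: "\<one>\<^bsub>k\<^esub> \<oplus>\<^bsub>k\<^esub> \<one>\<^bsub>k\<^esub> \<in> Units k"
    using two k.field_Units unfolding two_eq by simp
  have h: "h \<in> carrier k" unfolding h_def two_eq by (rule k.Units_inv_closed[OF two_unit])
  have "h \<oplus>\<^bsub>k\<^esub> h = h \<otimes>\<^bsub>k\<^esub> (\<one>\<^bsub>k\<^esub> \<oplus>\<^bsub>k\<^esub> \<one>\<^bsub>k\<^esub>)" using h by (simp add: k.r_distr)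
  also have "\<dots> = \<one>\<^bsub>k\<^esub>" unfolding h_def two_eq by (rule k.Units_l_inv[OF two_unit])
  finally have hh: "h \<oplus>\<^bsub>k\<^esub> h = \<one>\<^bsub>k\<^esub>" .
  have m0: "m\<^sub>1 \<noteq> 0" "m\<^sub>2 \<noteq> 0" using m by auto
  note one1 = C1.half_trace_one[OF h hh C1.one_neq_zero_of_dimension[OF d1 m0(1)]]
    and one2 = C2.half_trace_one[OF h hh C2.one_neq_zero_of_dimension[OF d2 m0(2)]]
  note fun1 = C1.half_trace_functional[OF h hh] and fun2 = C2.half_trace_functional[OF h hh]
  note inv1 = C1.standard_involution_linear and inv2 = C2.standard_involution_linear
  let ?\<alpha> = "standard_involution k C\<^sub>1 n\<^sub>1" and ?\<beta> = "standard_involution k C\<^sub>2 n\<^sub>2"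
  let ?C = "tensor_algebra k C\<^sub>1 C\<^sub>2"
  let ?\<tau> = "tensor_map k C\<^sub>1 C\<^sub>2 C\<^sub>1 C\<^sub>2 ?\<alpha> ?\<beta>"
  let ?\<sigma> = "tensor_map k ?C R ?C R ?\<tau> (\<lambda>r. r)"
  let ?l = "D.AR.ext_functional (C1.half_trace h)" and ?bar = "D.AR.ext_bar (C1.half_trace h)"
  let ?l' = "D.BR.ext_functional (C2.half_trace h)" and ?bar' = "D.BR.ext_bar (C2.half_trace h)"
  interpret QA: quadratic_algebra R D.A\<^sub>R ?l ?bar
    by (rule D.AR.quadratic_extension[OF h hh fun1 one1 C1.half_trace_quadratic[OF h hh]])
  interpret QB: quadratic_algebra R D.B\<^sub>R ?l' ?bar'
    by (rule D.BR.quadratic_extension[OF h hh fun2 one2 C2.half_trace_quadratic[OF h hh]])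
  have balA: "balanced R D.A\<^sub>R D.B\<^sub>R (add_monoid D.A\<^sub>R) (\<lambda>U V. ?l' V \<odot>\<^bsub>D.A\<^sub>R\<^esub> U)"
    by (intro balancedI)
      (simp_all add: D.AR.AR.smult_l_distr D.AR.AR.smult_r_distr D.AR.AR.smult_assoc1[symmetric] R.m_comm)
  have balB: "balanced R D.A\<^sub>R D.B\<^sub>R (add_monoid D.B\<^sub>R) (\<lambda>U V. ?l U \<odot>\<^bsub>D.B\<^sub>R\<^esub> V)"
    by (intro balancedI)
      (simp_all add: D.BR.AR.smult_l_distr D.BR.AR.smult_r_distr D.BR.AR.smult_assoc1[symmetric] R.m_comm)
  let ?E = "D.ext_lift (add_monoid D.A\<^sub>R) (\<lambda>U V. ?l' V \<odot>\<^bsub>D.A\<^sub>R\<^esub> U)"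
  let ?E' = "D.ext_lift (add_monoid D.B\<^sub>R) (\<lambda>U V. ?l U \<odot>\<^bsub>D.B\<^sub>R\<^esub> V)"
  note \<sigma>0_hom = tensor_map_props(1)[OF D.AB.tensor_modules_axioms D.AB.tensor_modules_axioms inv1 inv2]
    and \<sigma>0_pure = tensor_map_props(2)[OF D.AB.tensor_modules_axioms D.AB.tensor_modules_axioms inv1 inv2]
  have \<sigma>0_closed: "?\<tau> Z \<in> carrier D.AB.T" if "Z \<in> carrier D.AB.T" for Z
    by (rule hom_in_carrier[OF \<sigma>0_hom that])
  have \<sigma>0_add: "?\<tau> (Z \<otimes>\<^bsub>D.AB.T\<^esub> Z') = ?\<tau> Z \<otimes>\<^bsub>D.AB.T\<^esub> ?\<tau> Z'"
    if "Z \<in> carrier D.AB.T" "Z' \<in> carrier D.AB.T" for Z Z'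
    by (rule hom_mult[OF \<sigma>0_hom that])
  have \<sigma>0_smult: "?\<tau> (c \<odot>\<^bsub>?C\<^esub> Z) = c \<odot>\<^bsub>?C\<^esub> ?\<tau> Z" if c: "c \<in> carrier k" and Z: "Z \<in> carrier D.AB.T" for c Z
    using Z
  proof (induction rule: D.AB.tensor_induct)
    case (pure x y)
    then show ?case
      using c by (simp add: \<sigma>0_pure linear_mapsD(1-3)[OF inv1] linear_mapsD(1-3)[OF inv2])
  next
    case (add Z Z')
    then show ?case using c by (simp add: \<sigma>0_add \<sigma>0_closed D.AB.smult_AB_add)
  qed
  have \<sigma>0_lin: "?\<tau> \<in> linear_maps k ?C ?C"
    using \<sigma>0_hom \<sigma>0_smult unfolding linear_maps_def by (simp add: hom_def)
  have id: "(\<lambda>r. r) \<in> linear_maps k R R" by (simp add: linear_maps_def add_hom_iff)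
  note \<sigma>_props = tensor_map_props[OF D.W.tensor_modules_axioms D.W.tensor_modules_axioms \<sigma>0_lin id]
  have \<sigma>_hom: "?\<sigma> \<in> add_hom D.W D.W"
    using \<sigma>_props(1) by (auto simp: hom_def D.W.AR_simps)
  have \<sigma>_closed: "\<And>w. w \<in> carrier D.W \<Longrightarrow> ?\<sigma> w \<in> carrier D.W"
    and \<sigma>_add: "\<And>w w'. w \<in> carrier D.W \<Longrightarrow> w' \<in> carrier D.W \<Longrightarrow> ?\<sigma> (w \<oplus>\<^bsub>D.W\<^esub> w') = ?\<sigma> w \<oplus>\<^bsub>D.W\<^esub> ?\<sigma> w'"
    using \<sigma>_hom unfolding add_hom_iff by blast+
  have \<sigma>_triple: "?\<sigma> (D.triple x y r) = D.triple (?\<alpha> x) (?\<beta> y) r"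
    if "x \<in> carrier C\<^sub>1" "y \<in> carrier C\<^sub>2" "r \<in> carrier R" for x y r
    using that by (simp add: \<sigma>_props(2) \<sigma>0_pure)
  have bar_pure: "?bar (D.AR.pure x r) = D.AR.pure (?\<alpha> x) r" if "x \<in> carrier C\<^sub>1" "r \<in> carrier R" for x r
    using that linear_maps_closed[OF inv1] C1.standard_involution_add_self[OF h hh]
    by (intro D.AR.ext_bar_pure[OF fun1]) auto
  have bar'_pure: "?bar' (D.BR.pure x r) = D.BR.pure (?\<beta> x) r" if "x \<in> carrier C\<^sub>2" "r \<in> carrier R" for x r
    using that linear_maps_closed[OF inv2] C2.standard_involution_add_self[OF h hh]
    by (intro D.BR.ext_bar_pure[OF fun2]) auto
  have \<sigma>_prod: "?\<sigma> (D.ext_prod U V) = D.ext_prod (?bar U) (?bar' V)"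
    if U: "U \<in> carrier D.A\<^sub>R" and V: "V \<in> carrier D.B\<^sub>R" for U V
    using U
  proof (induction rule: D.AR.ext_induct)
    case p1: (pure x r)
    show ?case using V
    proof (induction rule: D.BR.ext_induct)
      case p2: (pure y s)
      then show ?case
        using p1 linear_maps_closed[OF inv1] linear_maps_closed[OF inv2]
        by (simp add: bar_pure bar'_pure \<sigma>_triple)
    next
      case (add V V')
      then show ?case
        using p1 by (simp add: D.ext_prod_add_right \<sigma>_add D.BR.ext_bar_add[OF fun2] QA.bar_closed QB.bar_closed)
    qed
  next
    case (add U U')
    then show ?case
      using V by (simp add: D.ext_prod_add_left \<sigma>_add D.AR.ext_bar_add[OF fun1] QA.bar_closed QB.bar_closed)
  qed
  have product: "algebra_product R D.A\<^sub>R ?l ?bar D.B\<^sub>R ?l' ?bar' D.W D.ext_prod ?E ?E' ?\<sigma>"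
  proof (intro algebra_product.intro algebra_product_axioms.intro QA.quadratic_algebra_axioms
      QB.quadratic_algebra_axioms D.W.unital_algebra_AR)
    show "?E \<in> add_hom D.W D.A\<^sub>R" by (rule D.ext_lift_hom[OF D.AR.AR.abelian_group_axioms balA])
    show "?E' \<in> add_hom D.W D.B\<^sub>R" by (rule D.ext_lift_hom[OF D.BR.AR.abelian_group_axioms balB])
    show "?E (D.ext_prod x y) = ?l' y \<odot>\<^bsub>D.A\<^sub>R\<^esub> x" if "x \<in> carrier D.A\<^sub>R" "y \<in> carrier D.B\<^sub>R" for x y
      by (rule D.ext_lift_prod[OF D.AR.AR.abelian_group_axioms balA that])
    show "?E' (D.ext_prod x y) = ?l x \<odot>\<^bsub>D.B\<^sub>R\<^esub> y" if "x \<in> carrier D.A\<^sub>R" "y \<in> carrier D.B\<^sub>R" for x y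
      by (rule D.ext_lift_prod[OF D.BR.AR.abelian_group_axioms balB that])
    show "P w" if "w \<in> carrier D.W"
      "\<And>x y. x \<in> carrier D.A\<^sub>R \<Longrightarrow> y \<in> carrier D.B\<^sub>R \<Longrightarrow> P (D.ext_prod x y)"
      "\<And>w w'. w \<in> carrier D.W \<Longrightarrow> w' \<in> carrier D.W \<Longrightarrow> P w \<Longrightarrow> P w' \<Longrightarrow> P (w \<oplus>\<^bsub>D.W\<^esub> w')" for P w
      using that by (rule D.ext_prod_induct)
    show "?\<sigma> \<in> add_hom D.W D.W" by (rule \<sigma>_hom)
    show "?\<sigma> (D.ext_prod x y) = D.ext_prod (?bar x) (?bar' y)"
      if "x \<in> carrier D.A\<^sub>R" "y \<in> carrier D.B\<^sub>R" for x y using that by (rule \<sigma>_prod)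
  qed (simp_all only: D.ext_prod_closed D.ext_prod_add_left D.ext_prod_add_right D.ext_prod_smult_left
      D.ext_prod_smult_right D.ext_prod_mult D.ext_prod_one)
  have V1: "vectorspace k C\<^sub>1" "vectorspace.fin_dim k C\<^sub>1" "vectorspace.dim k C\<^sub>1 = m\<^sub>1"
    and V2: "vectorspace k C\<^sub>2" "vectorspace.fin_dim k C\<^sub>2" "vectorspace.dim k C\<^sub>2 = m\<^sub>2"
    using d1 d2 by (simp_all add: has_dimension_def)
  obtain X \<xi> where X: "card X = m\<^sub>1" "dual_basis k C\<^sub>1 X (\<lambda>x. x) \<xi>"
    using vectorspace.dual_basis_exists[OF V1(1,2)] unfolding V1(3) by auto
  obtain Y \<eta> where Y: "card Y = m\<^sub>2" "dual_basis k C\<^sub>2 Y (\<lambda>x. x) \<eta>"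
    using vectorspace.dual_basis_exists[OF V2(1,2)] unfolding V2(3) by auto
  have trA: "QA.trivial_algebra" if "m\<^sub>1 = 1"
    unfolding QA.trivial_algebra_def
    using D.AR.ext_trivial[OF fun1 C1.dimension_alternatives(1)[OF h hh d1 m0(1) that]] by (rule ballI)
  have trB: "QB.trivial_algebra" if "m\<^sub>2 = 1"
    unfolding QB.trivial_algebra_def
    using D.BR.ext_trivial[OF fun2 C2.dimension_alternatives(1)[OF h hh d2 m0(2) that]] by (rule ballI)
  have usA: "\<exists>s. QA.unit_square s" if n1: "m\<^sub>1 \<noteq> 1"
  proof -
    obtain s \<nu> where s: "s \<in> carrier C\<^sub>1" "C1.half_trace h s = \<zero>\<^bsub>k\<^esub>" "\<nu> \<in> Units k" "s \<otimes>\<^bsub>C\<^sub>1\<^esub> s = \<nu> \<odot>\<^bsub>C\<^sub>1\<^esub> \<one>\<^bsub>C\<^sub>1\<^esub>"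
      using C1.dimension_alternatives(2)[OF h hh d1 m0(1) n1] by blast
    have "D.AR.pure s \<one>\<^bsub>R\<^esub> \<in> carrier D.A\<^sub>R" using s(1) by simp
    then have "QA.unit_square (D.AR.pure s \<one>\<^bsub>R\<^esub>)"
      unfolding QA.unit_square_def QA.traceless_def using D.AR.ext_unit_square[OF fun1 s] by simp
    then show ?thesis by (rule exI)
  qed
  have usB: "\<exists>s. QB.unit_square s" if n1: "m\<^sub>2 \<noteq> 1"
  proof -
    obtain s \<nu> where s: "s \<in> carrier C\<^sub>2" "C2.half_trace h s = \<zero>\<^bsub>k\<^esub>" "\<nu> \<in> Units k" "s \<otimes>\<^bsub>C\<^sub>2\<^esub> s = \<nu> \<odot>\<^bsub>C\<^sub>2\<^esub> \<one>\<^bsub>C\<^sub>2\<^esub>"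
      using C2.dimension_alternatives(2)[OF h hh d2 m0(2) n1] by blast
    have "D.BR.pure s \<one>\<^bsub>R\<^esub> \<in> carrier D.B\<^sub>R" using s(1) by simp
    then have "QB.unit_square (D.BR.pure s \<one>\<^bsub>R\<^esub>)"
      unfolding QB.unit_square_def QB.traceless_def using D.BR.ext_unit_square[OF fun2 s] by simp
    then show ?thesis by (rule exI)
  qed
  have rank: "r = \<zero>\<^bsub>R\<^esub>"
    if "m\<^sub>1 \<noteq> 1" "m\<^sub>2 \<noteq> 1" "r \<in> carrier R" "[card X] \<cdot>\<^bsub>R\<^esub> r = [card Y] \<cdot>\<^bsub>R\<^esub> r" for r
  proof (rule rank_difference_cancels[OF R.M_cring that(3)])
    show "m\<^sub>1 \<in> {2, 4, 8}" "m\<^sub>2 \<in> {2, 4, 8}" using m(1,2) that(1,2) by blast+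
    show "m\<^sub>1 \<noteq> m\<^sub>2" by (rule m(3))
    show "[m\<^sub>1] \<cdot>\<^bsub>R\<^esub> r = [m\<^sub>2] \<cdot>\<^bsub>R\<^esub> r" using that(4) unfolding X(1) Y(1) .
  qed (rule R.integer_multiple_cancel[OF k two] R.integer_multiple_cancel[OF k three], assumption+)+
  have alt_A: "QA.trivial_algebra \<or> (\<exists>s. QA.unit_square s)" using trA usA by blast
  have alt_B: "QB.trivial_algebra \<or> (\<exists>s. QB.unit_square s)" using trB usB by blast
  have ranks: "QA.trivial_algebra \<or> QB.trivial_algebra \<or>
      dual_basis R D.A\<^sub>R X (\<lambda>i. D.AR.pure i \<one>\<^bsub>R\<^esub>) (\<lambda>i. D.AR.ext_functional (\<xi> i)) \<and>
      dual_basis R D.B\<^sub>R Y (\<lambda>i. D.BR.pure i \<one>\<^bsub>R\<^esub>) (\<lambda>i. D.BR.ext_functional (\<eta> i)) \<and>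
      (\<forall>r \<in> carrier R. [card X] \<cdot>\<^bsub>R\<^esub> r = [card Y] \<cdot>\<^bsub>R\<^esub> r \<longrightarrow> r = \<zero>\<^bsub>R\<^esub>)"
    using trA trB rank D.AR.ext_dual_basis[OF X(2)] D.BR.ext_dual_basis[OF Y(2)] by blast
  show ?thesis
    by (rule that, rule split_extension.intro[OF D.double_extension_axioms product],
        rule split_extension_axioms.intro[OF alt_A alt_B ranks])
qed

theorem theorem3p11:
  fixes k :: "('k, 'p) ring_scheme"
    and C\<^sub>1 :: "('k, 'a) module" and C\<^sub>2 :: "('k, 'b) module"
    and n\<^sub>1 :: "'a \<Rightarrow> 'k" and n\<^sub>2 :: "'b \<Rightarrow> 'k"
    and m\<^sub>1 m\<^sub>2 :: nat
  assumes "field k"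
    and "[(2::nat)] \<cdot>\<^bsub>k\<^esub> \<one>\<^bsub>k\<^esub> \<noteq> \<zero>\<^bsub>k\<^esub>" and "[(3::nat)] \<cdot>\<^bsub>k\<^esub> \<one>\<^bsub>k\<^esub> \<noteq> \<zero>\<^bsub>k\<^esub>"
    and "composition_algebra k C\<^sub>1 n\<^sub>1" and "composition_algebra k C\<^sub>2 n\<^sub>2"
    and "has_dimension k C\<^sub>1 m\<^sub>1" and "has_dimension k C\<^sub>2 m\<^sub>2"
    and "m\<^sub>1 \<in> {1, 2, 4, 8}" and "m\<^sub>2 \<in> {1, 2, 4, 8}" and "m\<^sub>1 \<noteq> m\<^sub>2"
  shows "group_scheme_iso k
    (\<lambda>R :: ('k, 'r) module. Aut_scheme k C\<^sub>1 R \<times>\<times> Aut_scheme k C\<^sub>2 R)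
    (\<lambda>R S \<rho> (f\<^sub>1, f\<^sub>2). (Aut_map k C\<^sub>1 R S \<rho> f\<^sub>1, Aut_map k C\<^sub>2 R S \<rho> f\<^sub>2))
    (Aut_inv_scheme k (tensor_algebra k C\<^sub>1 C\<^sub>2)
      (tensor_map k C\<^sub>1 C\<^sub>2 C\<^sub>1 C\<^sub>2 (standard_involution k C\<^sub>1 n\<^sub>1) (standard_involution k C\<^sub>2 n\<^sub>2)))
    (Aut_map k (tensor_algebra k C\<^sub>1 C\<^sub>2))
    (tensor_aut k C\<^sub>1 C\<^sub>2)"
proof -
  let ?\<sigma> = "tensor_map k C\<^sub>1 C\<^sub>2 C\<^sub>1 C\<^sub>2 (standard_involution k C\<^sub>1 n\<^sub>1) (standard_involution k C\<^sub>2 n\<^sub>2)"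
  let ?C = "tensor_algebra k C\<^sub>1 C\<^sub>2"
  interpret C1: composition_algebra k C\<^sub>1 n\<^sub>1 by fact
  interpret C2: composition_algebra k C\<^sub>2 n\<^sub>2 by fact
  have points: "group (Aut_scheme k C\<^sub>1 R \<times>\<times> Aut_scheme k C\<^sub>2 R)" "group (Aut_inv_scheme k ?C ?\<sigma> R)"
      "tensor_aut k C\<^sub>1 C\<^sub>2 R \<in> iso (Aut_scheme k C\<^sub>1 R \<times>\<times> Aut_scheme k C\<^sub>2 R) (Aut_inv_scheme k ?C ?\<sigma> R)"
      "\<And>f1 f2. (f1, f2) \<in> carrier (Aut_scheme k C\<^sub>1 R \<times>\<times> Aut_scheme k C\<^sub>2 R) \<Longrightarrow>
        f1 \<in> linear_maps R (base_change k C\<^sub>1 R) (base_change k C\<^sub>1 R) \<and>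
        f2 \<in> linear_maps R (base_change k C\<^sub>2 R) (base_change k C\<^sub>2 R) \<and>
        tensor_aut k C\<^sub>1 C\<^sub>2 R (f1, f2) \<in> linear_maps R (base_change k ?C R) (base_change k ?C R)"
    if R: "algebra k R" for R :: "('k, 'r) module"
  proof -
    obtain l bar l' bar' E E' and I :: "'a set" and x \<xi> and J :: "'b set" and y \<eta> where
      "split_extension k C\<^sub>1 C\<^sub>2 R l bar l' bar' E E' (tensor_map k ?C R ?C R ?\<sigma> (\<lambda>r. r)) I x \<xi> J y \<eta>"
      by (rule composition_split_extension[OF assms R])
    then interpret SE: split_extension k C\<^sub>1 C\<^sub>2 R l bar l' bar' E E'
      "tensor_map k ?C R ?C R ?\<sigma> (\<lambda>r. r)" I x \<xi> J y \<eta> .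
    have "group (Aut_scheme k C\<^sub>1 R)" "group (Aut_scheme k C\<^sub>2 R)"
      unfolding Aut_scheme_eq
      by (rule involutive_automorphisms_group[OF SE.D.AR.unital_algebra_AR]
          involutive_automorphisms_group[OF SE.D.BR.unital_algebra_AR], assumption)+
    then show "group (Aut_scheme k C\<^sub>1 R \<times>\<times> Aut_scheme k C\<^sub>2 R)" by (rule DirProd_group)
    show "group (Aut_inv_scheme k ?C ?\<sigma> R)"
      unfolding Aut_inv_scheme_eq
      by (rule involutive_automorphisms_group[OF SE.D.W.unital_algebra_AR SE.\<sigma>_closed])
    show "tensor_aut k C\<^sub>1 C\<^sub>2 R \<in> iso (Aut_scheme k C\<^sub>1 R \<times>\<times> Aut_scheme k C\<^sub>2 R) (Aut_inv_scheme k ?C ?\<sigma> R)"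
      unfolding Aut_inv_scheme_eq by (rule SE.phi_iso)
    fix f1 f2 assume "(f1, f2) \<in> carrier (Aut_scheme k C\<^sub>1 R \<times>\<times> Aut_scheme k C\<^sub>2 R)"
    then have f: "f1 \<in> algebra_aut R SE.D.A\<^sub>R" "f2 \<in> algebra_aut R SE.D.B\<^sub>R"
      by (simp_all add: Aut_scheme_def)
    show "f1 \<in> linear_maps R SE.D.A\<^sub>R SE.D.A\<^sub>R \<and> f2 \<in> linear_maps R SE.D.B\<^sub>R SE.D.B\<^sub>R \<and>
        tensor_aut k C\<^sub>1 C\<^sub>2 R (f1, f2) \<in> linear_maps R SE.D.W SE.D.W"
      using f SE.phi_mem[OF f] by (simp add: algebra_aut_iff involutive_automorphisms_def)
  qed
  show ?thesis
    unfolding group_scheme_iso_def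
  proof (intro conjI allI impI ballI)
    fix R S :: "('k, 'r) module" and \<rho> g
    assume "algebra k R \<and> algebra k S \<and> \<rho> \<in> algebra_hom k R S"
      and g: "g \<in> carrier (Aut_scheme k C\<^sub>1 R \<times>\<times> Aut_scheme k C\<^sub>2 R)"
    then have R: "algebra k R" and S: "algebra k S" and \<rho>: "\<rho> \<in> algebra_hom k R S" by auto
    interpret N: double_base_morphism k C\<^sub>1 C\<^sub>2 R S \<rho>
      by (intro double_base_morphism.intro double_base_morphism_axioms.intro double_extension.intro
          C1.unital_algebra_axioms C2.unital_algebra_axioms R S \<rho>)
    obtain f1 f2 where f: "g = (f1, f2)" by (cases g)
    show "tensor_aut k C\<^sub>1 C\<^sub>2 S (case g of (f\<^sub>1, f\<^sub>2) \<Rightarrow> (Aut_map k C\<^sub>1 R S \<rho> f\<^sub>1, Aut_map k C\<^sub>2 R S \<rho> f\<^sub>2)) =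
        Aut_map k ?C R S \<rho> (tensor_aut k C\<^sub>1 C\<^sub>2 R g)"
      unfolding f using points(4)[OF R g[unfolded f]] by (simp add: N.tensor_aut_natural)
  qed (simp_all only: points)
qed

end
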